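(* Fix $E_B<0$. There are constants $c,C>0$ such that for all $L>0$ and $\mu>0$ with $\mu/|E_B|\ge c$ and $L^2|E_B|\ge 1$, $$\bigl|E(\mu)-E_0(\mu)-e_P(\mu)\bigr|\le C\,\frac{|e_P(\mu)|}{\sqrt{\log(\mu/|E_B|)}}.$$
   Context: Let $L>0$, $\Omega=[-L/2,L/2]^2$ with periodic boundary conditions, and $\Lambda_L:=\frac{2\pi}{L}\mathbb Z^2$; all sums over momenta $k,l,q$ run over $\Lambda_L$ unless further restricted. Let $\varphi_k(x)=L^{-1}e^{ik\cdot x}$ ($k\in\Lambda_L$) and let $-\Delta$ be the periodic Laplacian on $L^2(\Omega)$. Fix $E_B<0$. Let $h$ be the self-adjoint operator on $L^2(\Omega)$ whose resolvent is $(h-z)^{-1}=(-\Delta-z)^{-1}+\frac{1}{(E_B-z)\langle\gamma_{E_B},\gamma_z\rangle}|\gamma_z\rangle\langle\gamma_{\bar z}|$, where $\gamma_z\in L^2(\Omega)$ has Fourier coefficients $\hat\gamma_z(k)=(k^2-z)^{-1}$ (this is the point-interaction extension of $-\Delta|_{C_0^\infty(\Omega\setminus\{0\})}$; its only negative eigenvalue is $E_B$). For $\mu>0$ let $N(\mu):=\#\{k\in\Lambda_L:k^2\le\mu\}$, $\mathscr H_N:=\bigwedge^N L^2(\Omega)$, $H_\mu:=d\Gamma(h)|_{\mathscr H_{N(\mu)}}$ (second quantization of $h$ restricted to $N(\mu)$ fermions) and $E(\mu):=\min\sigma(H_\mu)$. Let $E_0(\mu):=\sum_{k^2\le\mu}k^2$.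 For $\tau>-\mu$ let $G_\mu(\tau):=L^{-2}\sum_k\Bigl(\frac{1}{k^2-E_B}-\frac{\chi_{(\mu,\infty)}(k^2)}{k^2+\tau}\Bigr)$, a monotonically increasing function of $\tau$. The polaron energy $e_P(\mu)$ is the lowest solution $e$ of the polaron equation $-e=L^{-2}\sum_{k^2\le\mu}G_\mu(-k^2-e)^{-1}$; such a lowest solution exists and satisfies $e_P(\mu)<0$. *)

theory Defs
  imports "HOL-Analysis.Analysis" "HOL-Combinatorics.Permutations"
begin

text \<open>Momentum representation: the ONB phi_k of L2(Omega) identifies L2(Omega) with
  l2(Lambda_L), and Lambda_L = (2 pi / L) Z^2 is indexed by int x int.
  N-fermion wave functions are antisymmetric l2 functions on lists of momenta of length N.\<close>

definition ksq :: "real \<Rightarrow> int \<times> int \<Rightarrow> real" where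
  "ksq L n = (2 * pi / L)^2 * ((of_int (fst n))^2 + (of_int (snd n))^2)"

definition l2 :: "('a \<Rightarrow> complex) \<Rightarrow> bool" where
  "l2 f \<longleftrightarrow> (\<lambda>x. (cmod (f x))^2) summable_on UNIV"

definition l2norm :: "('a \<Rightarrow> complex) \<Rightarrow> real" where
  "l2norm f = sqrt (infsum (\<lambda>x. (cmod (f x))^2) UNIV)"

definition l2inner :: "('a \<Rightarrow> complex) \<Rightarrow> ('a \<Rightarrow> complex) \<Rightarrow> complex" where
  "l2inner f g = infsum (\<lambda>x. cnj (f x) * g x) UNIV"

definition gam :: "real \<Rightarrow> complex \<Rightarrow> int \<times> int \<Rightarrow> complex" where
  "gam L z n = 1 / (complex_of_real (ksq L n) - z)"

definition resolv :: "real \<Rightarrow> real \<Rightarrow> complex \<Rightarrow> (int \<times> int \<Rightarrow> complex) \<Rightarrow> (int \<times> int \<Rightarrow> complex)" where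
  "resolv L EB z f = (\<lambda>n. f n / (complex_of_real (ksq L n) - z)
      + (l2inner (gam L (cnj z)) f / ((complex_of_real EB - z) * l2inner (gam L (complex_of_real EB)) (gam L z)))
        * gam L z n)"

text \<open>Graph of h: the self-adjoint operator with resolvent resolv (determined by z = i):
  D(h) = ran (h - i)^(-1), and h (R f) = f + i R f.\<close>
definition hgraph :: "real \<Rightarrow> real \<Rightarrow> ((int \<times> int \<Rightarrow> complex) \<times> (int \<times> int \<Rightarrow> complex)) set" where
  "hgraph L EB = {(resolv L EB \<i> f, (\<lambda>n. f n + \<i> * resolv L EB \<i> f n)) | f. l2 f}"

definition slater :: "('a \<Rightarrow> complex) list \<Rightarrow> 'a list \<Rightarrow> complex" where
  "slater fs ks = (if length ks = length fs then
      (\<Sum>p\<in>{p. p permutes {..<length fs}}. of_int (sign p) * (\<Prod>i<length fs. (fs ! i) (ks ! (p i))))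
    else 0)"

definition elem_pairs :: "(('a \<Rightarrow> complex) \<times> ('a \<Rightarrow> complex)) set \<Rightarrow> nat
     \<Rightarrow> (('a list \<Rightarrow> complex) \<times> ('a list \<Rightarrow> complex)) set" where
  "elem_pairs G N = {(slater (map fst ps),
       (\<lambda>ks. \<Sum>i<N. slater ((map fst ps)[i := snd (ps ! i)]) ks)) | ps. length ps = N \<and> set ps \<subseteq> G}"

text \<open>Graph of sum_i h_i on the algebraic antisymmetric tensor product of D(h).\<close>
definition pre_dGamma :: "(('a \<Rightarrow> complex) \<times> ('a \<Rightarrow> complex)) set \<Rightarrow> nat
     \<Rightarrow> (('a list \<Rightarrow> complex) \<times> ('a list \<Rightarrow> complex)) set" where
  "pre_dGamma G N = {((\<lambda>ks. \<Sum>j<m. c j * fst (P j) ks), (\<lambda>ks. \<Sum>j<m. c j * snd (P j) ks))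
       | (m::nat) c P. \<forall>j<m. P j \<in> elem_pairs G N}"

definition dGamma :: "(('a \<Rightarrow> complex) \<times> ('a \<Rightarrow> complex)) set \<Rightarrow> nat
     \<Rightarrow> (('a list \<Rightarrow> complex) \<times> ('a list \<Rightarrow> complex)) set" where
  "dGamma G N = {(x, y). l2 x \<and> l2 y \<and> (\<exists>X Y. (\<forall>n. (X n, Y n) \<in> pre_dGamma G N)
       \<and> (\<lambda>n. l2norm (\<lambda>ks. X n ks - x ks)) \<longlonglongrightarrow> 0
       \<and> (\<lambda>n. l2norm (\<lambda>ks. Y n ks - y ks)) \<longlonglongrightarrow> 0)}"

definition fermion_space :: "nat \<Rightarrow> ('a list \<Rightarrow> complex) \<Rightarrow> bool" where
  "fermion_space N f \<longleftrightarrow> l2 f \<and> (\<forall>ks. length ks \<noteq> N \<longrightarrow> f ks = 0)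
     \<and> (\<forall>ks i j. i < length ks \<and> j < length ks \<and> i \<noteq> j \<longrightarrow> f (ks[i := ks ! j, j := ks ! i]) = - f ks)"

text \<open>Spectrum of a (closed) operator given by its graph G in a Hilbert space H:
  z is in the resolvent set iff A - z maps D(A) onto H and is bounded below.\<close>
definition op_spectrum :: "(('b \<Rightarrow> complex) \<Rightarrow> bool) \<Rightarrow> (('b \<Rightarrow> complex) \<times> ('b \<Rightarrow> complex)) set \<Rightarrow> complex set" where
  "op_spectrum H G = - {z. (\<forall>y. H y \<longrightarrow> (\<exists>x. (x, (\<lambda>k. y k + z * x k)) \<in> G))
       \<and> (\<exists>C. \<forall>(x, w)\<in>G. l2norm x \<le> C * l2norm (\<lambda>k. w k - z * x k))}"

definition Nmu :: "real \<Rightarrow> real \<Rightarrow> nat" where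
  "Nmu L \<mu> = card {n. ksq L n \<le> \<mu>}"

definition Egs :: "real \<Rightarrow> real \<Rightarrow> real \<Rightarrow> real" where
  "Egs L EB \<mu> = Inf {e::real. complex_of_real e \<in>
      op_spectrum (fermion_space (Nmu L \<mu>)) (dGamma (hgraph L EB) (Nmu L \<mu>))}"

definition E0 :: "real \<Rightarrow> real \<Rightarrow> real" where
  "E0 L \<mu> = (\<Sum>n\<in>{n. ksq L n \<le> \<mu>}. ksq L n)"

definition Gmu :: "real \<Rightarrow> real \<Rightarrow> real \<Rightarrow> real \<Rightarrow> real" where
  "Gmu L EB \<mu> \<tau> = (1 / L^2) * infsum (\<lambda>n. 1 / (ksq L n - EB)
      - (if ksq L n > \<mu> then 1 / (ksq L n + \<tau>) else 0)) UNIV"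

text \<open>Solutions of the polaron equation (arguments of G_mu in its domain tau > -mu).\<close>
definition polaron_solutions :: "real \<Rightarrow> real \<Rightarrow> real \<Rightarrow> real set" where
  "polaron_solutions L EB \<mu> = {e. (\<forall>n. ksq L n \<le> \<mu> \<longrightarrow> - ksq L n - e > - \<mu> \<and> Gmu L EB \<mu> (- ksq L n - e) \<noteq> 0)
      \<and> - e = (1 / L^2) * (\<Sum>n\<in>{n. ksq L n \<le> \<mu>}. 1 / Gmu L EB \<mu> (- ksq L n - e))}"

definition eP :: "real \<Rightarrow> real \<Rightarrow> real \<Rightarrow> real" where
  "eP L EB \<mu> = (LEAST e. e \<in> polaron_solutions L EB \<mu>)"

end

theory Submission
  imports Defs
begin

text \<open>
  The fermions do not interact, so \<open>E(\<mu>)\<close> is the sum of the \<open>N(\<mu>)\<close> lowest eigenvalues of \<open>h\<close>.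
  Write \<open>F(x) = \<Sum>k. 1/(k\<^sup>2 - E\<^sub>B) - 1/(k\<^sup>2 - x)\<close>. A level \<open>s\<close> of the Laplacian of multiplicity \<open>m\<close>
  survives as an eigenvalue of \<open>h\<close> of multiplicity \<open>m - 1\<close>, and one eigenvalue is pushed down to the
  zero \<open>\<lambda>\<^sub>s\<close> of \<open>F\<close> in the gap below \<open>s\<close>; these eigenvectors are complete because the resolvent is
  compact. Hence \<open>E - E\<^sub>0 = \<Sum>s\<le>\<mu>. \<lambda>\<^sub>s - s\<close>.

  Splitting \<open>F = g - P\<close>, where \<open>P(x)\<close> is the sum of \<open>1/(k\<^sup>2 - x)\<close> over \<open>k\<^sup>2 \<le> \<mu>\<close> and
  \<open>g(x) = L\<^sup>2 G\<^sub>\<mu>(-x)\<close> is decreasing, the \<open>\<lambda>\<^sub>s\<close> solve \<open>P = g\<close>. If \<open>g\<close> were a constant \<open>1/\<kappa>\<close>, the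
  total shift would be exactly \<open>- \<kappa> N\<close> (a trace identity). As \<open>g\<close> is monotone, \<open>E\<^sub>0 - E\<close> lies
  between \<open>N/g(-2\<mu>)\<close> and \<open>N/g(y) + (\<mu> - y)\<close> for every \<open>y < \<mu>\<close>, and the polaron equation puts
  \<open>- e\<^sub>P\<close> between \<open>N/g(-2\<mu>)\<close> and \<open>N/g(y)\<close>. With \<open>W = log(\<mu>/|E\<^sub>B|)\<close> and \<open>y = (1 - W\<^bsup>-3/2\<^esup>) \<mu>\<close>,
  lattice sums show that \<open>g\<close> is of order \<open>L\<^sup>2 W\<close> and varies by at most \<open>O(L\<^sup>2 \<surd>W)\<close> on \<open>[-2\<mu>, y]\<close>.
\<close>

section \<open>Square-summable families\<close>

text \<open>The delicate region lies just below \<open>\<mu>\<close>, where modes slightly above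
  \<open>\<mu>\<close> are nearly resonant and \<open>g\<close> varies fast. Eigenvalues above
  \<open>y\<close> are therefore treated without \<open>g\<close>: the intervals from
  \<open>lam s\<close> to \<open>s\<close> are disjoint and fit between \<open>y\<close> and
  \<open>\<mu>\<close>. With \<open>\<delta> = (\<mu> - y) / \<mu>\<close> this costs \<delta>
  \<mu>, while the variation of \<open>g\<close> below \<open>y\<close> costs a relative error of
  order log(1/\<delta>)/W. Since N is at least of order L^2 \<mu> and \<open>g\<close> is of order
  L^2 W, the polaron energy is at least of order \<mu>/W; the choice \<delta> = W^(-3/2) makes the
  first cost a W^(-1/2) fraction of it, and log(1/\<delta>), of order log W, stays below a multiple
  of sqrt W. The condition L^2 |E_B| \<ge> 1 keeps the lattice fine on the scale of E_B, so that the
  zero mode cannot dominate \<open>g\<close> at E_B.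

  On the operator side, the second quantization is the closure of an algebraic graph. A unitary
  change of basis on lists of momenta makes that closure diagonal, and its spectrum is read off from
  the coefficients.\<close>

lemma l2_mult_abs_summable:
  assumes "l2 f" "l2 g" shows "(\<lambda>x. norm (f x * g x)) summable_on UNIV"
proof (rule Infinite_Sum.abs_summable_on_comparison_test'[where g = "\<lambda>x. (cmod (f x))^2 + (cmod (g x))^2"])
  show "(\<lambda>x. (cmod (f x))^2 + (cmod (g x))^2) summable_on UNIV"
    using assms unfolding l2_def by (rule summable_on_add)
  show "norm (f x * g x) \<le> (cmod (f x))^2 + (cmod (g x))^2" for x
    using sum_squares_bound[of "cmod (f x)" "cmod (g x)"]
      mult_nonneg_nonneg[OF norm_ge_zero[of "f x"] norm_ge_zero[of "g x"]]
    unfolding norm_mult by linarith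
qed

lemma l2_mult_summable:
  assumes "l2 f" "l2 g" shows "(\<lambda>x. f x * g x) summable_on UNIV"
  using l2_mult_abs_summable[OF assms] by (rule abs_summable_summable)

lemma l2_cnj [simp]: "l2 (\<lambda>x. cnj (f x)) = l2 f"
  by (simp add: l2_def)

lemma l2norm_cnj [simp]: "l2norm (\<lambda>x. cnj (f x)) = l2norm f"
  by (simp add: l2norm_def)

lemma l2inner_summable:
  assumes "l2 f" "l2 g" shows "(\<lambda>x. cnj (f x) * g x) summable_on UNIV"
  using l2_mult_summable[of "\<lambda>x. cnj (f x)" g] assms by simp

lemma l2_add:
  assumes "l2 f" "l2 g" shows "l2 (\<lambda>x. f x + g x)"
  unfolding l2_def
proof (rule summable_on_comparison_test)
  show "(\<lambda>x. 2 * ((cmod (f x))^2 + (cmod (g x))^2)) summable_on UNIV"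
    using assms unfolding l2_def by (intro summable_on_cmult_right summable_on_add)
  show "(cmod (f x + g x))\<^sup>2 \<le> 2 * ((cmod (f x))\<^sup>2 + (cmod (g x))\<^sup>2)" for x
  proof -
    have "(cmod (f x + g x))\<^sup>2 \<le> (cmod (f x) + cmod (g x))^2"
      by (intro power_mono norm_triangle_ineq) auto
    also have "\<dots> \<le> 2 * ((cmod (f x))\<^sup>2 + (cmod (g x))\<^sup>2)"
      using sum_squares_bound[of "cmod (f x)" "cmod (g x)"] by (simp add: power2_sum)
    finally show ?thesis .
  qed
qed auto

lemma l2_cmult:
  assumes "l2 f" shows "l2 (\<lambda>x. c * f x)"
  using assms unfolding l2_def norm_mult power_mult_distrib by (intro summable_on_cmult_right)

lemma l2_diff:
  assumes "l2 f" "l2 g" shows "l2 (\<lambda>x. f x - g x)"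
  using l2_add[OF assms(1) l2_cmult[OF assms(2), of "-1"]] by simp

lemma l2_zero [simp]: "l2 (\<lambda>x. 0)"
  by (simp add: l2_def)

lemma l2_sum:
  assumes "\<And>i. i \<in> A \<Longrightarrow> l2 (f i)" shows "l2 (\<lambda>x. \<Sum>i\<in>A. f i x)"
  using assms by (induction A rule: infinite_finite_induct) (auto intro: l2_add)

lemma l2_dominated:
  assumes "l2 g" "\<And>x. cmod (f x) \<le> cmod (g x)" shows "l2 f"
  using assms unfolding l2_def
  by (auto intro!: summable_on_comparison_test[of "\<lambda>x. (cmod (g x))^2"] power_mono)

lemma l2_finite_support:
  assumes "finite A" "\<And>x. x \<notin> A \<Longrightarrow> f x = 0" shows "l2 f"
  unfolding l2_def
  by (rule finite_nonzero_values_imp_summable_on) (use assms in \<open>auto intro: finite_subset[of _ A]\<close>)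

lemma l2norm_nonneg [simp]: "0 \<le> l2norm f"
  by (simp add: l2norm_def infsum_nonneg)

lemma l2norm_sq: "(l2norm f)^2 = infsum (\<lambda>x. (cmod (f x))^2) UNIV"
  by (simp add: l2norm_def infsum_nonneg)

lemma l2norm_eq_0D:
  assumes "l2 f" "l2norm f = 0" shows "f x = 0"
proof -
  have "infsum (\<lambda>x. (cmod (f x))^2) UNIV \<le> 0"
    using l2norm_sq[of f] assms(2) by simp
  then have "(cmod (f x))^2 = 0"
    by (intro nonneg_infsum_le_0D[of "\<lambda>x. (cmod (f x))^2" UNIV x]) (use assms in \<open>auto simp: l2_def\<close>)
  then show ?thesis by simp
qed

lemma l2norm_zero [simp]: "l2norm (\<lambda>x. 0) = 0"
  by (simp add: l2norm_def)

lemma finite_sum_le_l2norm_sq: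
  assumes "l2 f" "finite A" shows "(\<Sum>x\<in>A. (cmod (f x))^2) \<le> (l2norm f)^2"
  unfolding l2norm_sq using assms by (intro finite_sum_le_infsum) (auto simp: l2_def)

lemma l2_bounded_finite_sums:
  assumes "\<And>A. finite A \<Longrightarrow> (\<Sum>x\<in>A. (cmod (f x))^2) \<le> S^2" and "0 \<le> S"
  shows "l2 f" "l2norm f \<le> S"
proof -
  show l: "l2 f"
    unfolding l2_def
    by (rule nonneg_bounded_partial_sums_imp_summable_on[where C = "S^2"])
       (use assms in \<open>auto intro!: eventually_finite_subsets_at_top_weakI\<close>)
  have "(l2norm f)^2 \<le> S^2"
    unfolding l2norm_sq using l assms by (intro infsum_le_finite_sums) (auto simp: l2_def)
  then show "l2norm f \<le> S"
    using assms(2) by (rule power2_le_imp_le)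
qed

lemma l2norm_mono:
  assumes "l2 g" "\<And>x. cmod (f x) \<le> cmod (g x)" shows "l2norm f \<le> l2norm g"
  unfolding l2norm_def
  using assms l2_dominated[OF assms] by (intro real_sqrt_le_mono infsum_mono) (auto simp: l2_def intro: power_mono)

lemma l2norm_cmult: "l2norm (\<lambda>x. c * f x) = cmod c * l2norm f"
  by (simp add: l2norm_def norm_mult power_mult_distrib infsum_cmult_right' real_sqrt_mult)

lemma l2_Cauchy_Schwarz_abs:
  assumes "l2 f" "l2 g" shows "infsum (\<lambda>x. cmod (f x * g x)) UNIV \<le> l2norm f * l2norm g"
proof (rule infsum_le_finite_sums)
  show "(\<lambda>x. cmod (f x * g x)) summable_on UNIV"
    by (rule l2_mult_abs_summable[OF assms])
  fix A :: "'a set" assume A: "finite A"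
  have "(\<Sum>x\<in>A. cmod (f x * g x)) = (\<Sum>x\<in>A. \<bar>cmod (f x)\<bar> * \<bar>cmod (g x)\<bar>)"
    by (simp add: norm_mult)
  also have "\<dots> \<le> L2_set (\<lambda>x. cmod (f x)) A * L2_set (\<lambda>x. cmod (g x)) A"
    by (rule L2_set_mult_ineq)
  also have "\<dots> \<le> l2norm f * l2norm g"
    using finite_sum_le_l2norm_sq[OF assms(1) A] finite_sum_le_l2norm_sq[OF assms(2) A]
    unfolding L2_set_def by (intro mult_mono real_le_lsqrt) (auto intro: sum_nonneg)
  finally show "(\<Sum>x\<in>A. cmod (f x * g x)) \<le> l2norm f * l2norm g" .
qed

lemma l2_Cauchy_Schwarz:
  assumes "l2 f" "l2 g" shows "cmod (l2inner f g) \<le> l2norm f * l2norm g"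
proof -
  have "cmod (l2inner f g) \<le> infsum (\<lambda>x. cmod (cnj (f x) * g x)) UNIV"
    unfolding l2inner_def using l2_mult_abs_summable[of "\<lambda>x. cnj (f x)" g] assms
    by (intro norm_infsum_bound) auto
  also have "\<dots> \<le> l2norm f * l2norm g"
    using l2_Cauchy_Schwarz_abs[of "\<lambda>x. cnj (f x)" g] assms by simp
  finally show ?thesis .
qed

lemma l2inner_self:
  assumes "l2 f" shows "l2inner f f = complex_of_real ((l2norm f)^2)"
proof -
  have "cnj (f x) * f x = complex_of_real ((cmod (f x))^2)" for x
    by (metis complex_norm_square mult.commute)
  then show ?thesis
    unfolding l2inner_def l2norm_sq
    using infsumI[OF has_sum_of_real[OF has_sum_infsum[OF assms[unfolded l2_def]]]] by simp
qed

lemma l2inner_commute: "l2inner g f = cnj (l2inner f g)"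
  unfolding l2inner_def infsum_cnj[symmetric] by (simp add: mult.commute)

lemma l2inner_add_right:
  assumes "l2 f" "l2 g" "l2 h" shows "l2inner f (\<lambda>x. g x + h x) = l2inner f g + l2inner f h"
  unfolding l2inner_def distrib_left
  using assms by (intro infsum_add l2inner_summable)

lemma l2inner_cmult_right: "l2inner f (\<lambda>x. c * g x) = c * l2inner f g"
proof -
  have "(\<lambda>x. cnj (f x) * (c * g x)) = (\<lambda>x. c * (cnj (f x) * g x))"
    by (auto simp: algebra_simps)
  then show ?thesis by (simp add: l2inner_def infsum_cmult_right')
qed

lemma l2inner_cmult_left: "l2inner (\<lambda>x. c * f x) g = cnj c * l2inner f g"
  using l2inner_cmult_right[of g c f] by (metis complex_cnj_mult l2inner_commute)

lemma l2inner_zero_right [simp]: "l2inner f (\<lambda>x. 0) = 0"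
  by (simp add: l2inner_def)

lemma l2inner_diff_right:
  assumes "l2 f" "l2 g" "l2 h" shows "l2inner f (\<lambda>x. g x - h x) = l2inner f g - l2inner f h"
  using l2inner_add_right[OF assms(1,2) l2_cmult[OF assms(3), of "-1"]] l2inner_cmult_right[of f "-1" h]
  by simp

lemma l2inner_sum_right:
  assumes "l2 f" "\<And>i. i \<in> A \<Longrightarrow> l2 (g i)"
  shows "l2inner f (\<lambda>x. \<Sum>i\<in>A. g i x) = (\<Sum>i\<in>A. l2inner f (g i))"
  using assms
proof (induction A rule: infinite_finite_induct)
  case (insert a A)
  then show ?case
    using l2inner_add_right[of f "g a" "\<lambda>x. \<Sum>i\<in>A. g i x"] l2_sum[of A g] by simp
qed auto

lemma l2inner_finite_support_right:
  assumes "finite A" "\<And>x. x \<notin> A \<Longrightarrow> g x = 0"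
  shows "l2inner f g = (\<Sum>x\<in>A. cnj (f x) * g x)"
proof -
  have "l2inner f g = infsum (\<lambda>x. cnj (f x) * g x) A"
    unfolding l2inner_def using assms by (intro infsum_cong_neutral) auto
  then show ?thesis using assms by simp
qed

lemma l2norm_sq_add:
  assumes "l2 f" "l2 g"
  shows "(l2norm (\<lambda>x. f x + g x))^2 = (l2norm f)^2 + 2 * Re (l2inner f g) + (l2norm g)^2"
proof -
  have fg: "l2 (\<lambda>x. f x + g x)" by (rule l2_add[OF assms])
  have 1: "l2inner (\<lambda>x. f x + g x) (\<lambda>x. f x + g x) =
      cnj (l2inner f f + l2inner f g) + cnj (l2inner g f + l2inner g g)"
    using l2inner_add_right[OF fg assms] l2inner_add_right[OF assms(1) assms]
      l2inner_add_right[OF assms(2) assms]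
      l2inner_commute[of "\<lambda>x. f x + g x" f] l2inner_commute[of "\<lambda>x. f x + g x" g] by simp
  have "Re (l2inner (\<lambda>x. f x + g x) (\<lambda>x. f x + g x)) = (l2norm f)^2 + 2 * Re (l2inner f g) + (l2norm g)^2"
    unfolding 1 using l2inner_self[OF assms(1)] l2inner_self[OF assms(2)] l2inner_commute[of f g]
    by simp
  then show ?thesis using l2inner_self[OF fg] by simp
qed

lemma l2norm_tail_tendsto_0:
  assumes "l2 f"
  shows "((\<lambda>A. l2norm (\<lambda>x. if x \<in> A then 0 else f x)) \<longlongrightarrow> 0) (finite_subsets_at_top UNIV)"
proof -
  let ?q = "\<lambda>x. (cmod (f x))^2"
  have s: "?q summable_on UNIV" using assms by (simp add: l2_def)
  have "(sum ?q \<longlongrightarrow> infsum ?q UNIV) (finite_subsets_at_top UNIV)"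
    using s by (rule infsum_tendsto)
  then have "((\<lambda>A. sqrt (infsum ?q UNIV - sum ?q A)) \<longlongrightarrow> sqrt (infsum ?q UNIV - infsum ?q UNIV)) (finite_subsets_at_top UNIV)"
    by (intro tendsto_intros)
  moreover have "\<forall>\<^sub>F A in finite_subsets_at_top UNIV.
      sqrt (infsum ?q UNIV - sum ?q A) = l2norm (\<lambda>x. if x \<in> A then 0 else f x)"
  proof (rule eventually_finite_subsets_at_top_weakI)
    fix A :: "'a set" assume A: "finite A"
    have "infsum ?q UNIV = infsum ?q A + infsum ?q (-A)"
      using infsum_Un_disjoint[of ?q A "-A"] A summable_on_subset_banach[OF s, of "-A"] by auto
    moreover have "infsum ?q (-A) = infsum (\<lambda>x. (cmod (if x \<in> A then 0 else f x))\<^sup>2) UNIV"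
      by (rule infsum_cong_neutral) auto
    ultimately show "sqrt (infsum ?q UNIV - sum ?q A) = l2norm (\<lambda>x. if x \<in> A then 0 else f x)"
      using A by (simp add: l2norm_def)
  qed
  ultimately show ?thesis using tendsto_cong by force
qed

subsection \<open>Orthonormal families\<close>

definition orthonormal :: "('k \<Rightarrow> 'j \<Rightarrow> complex) \<Rightarrow> bool" where
  "orthonormal w \<longleftrightarrow> (\<forall>k. l2 (w k)) \<and> (\<forall>k k'. l2inner (w k) (w k') = (if k = k' then 1 else 0))"

text \<open>The expansion with coefficients \<open>f\<close>, summed coordinate by coordinate, so
  that it can be stated without a topology on l2 functions. Its isometry property is
  \<open>l2_synth\<close>.\<close>

definition synth :: "('k \<Rightarrow> 'j \<Rightarrow> complex) \<Rightarrow> ('k \<Rightarrow> complex) \<Rightarrow> 'j \<Rightarrow> complex" where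
  "synth w f j = infsum (\<lambda>k. f k * w k j) UNIV"

context
  fixes w :: "'k \<Rightarrow> 'j \<Rightarrow> complex"
  assumes w: "orthonormal w"
begin

lemma orthonormal_l2: "l2 (w k)"
  using w by (auto simp: orthonormal_def)

lemma orthonormal_inner: "l2inner (w k) (w k') = (if k = k' then 1 else 0)"
  using w by (auto simp: orthonormal_def)

lemma orthonormal_norm: "l2norm (w k) = 1"
proof -
  have "complex_of_real ((l2norm (w k))^2) = 1"
    using l2inner_self[OF orthonormal_l2[of k]] orthonormal_inner[of k k] by simp
  then have "(l2norm (w k))^2 = 1" using of_real_eq_1_iff by blast
  then show ?thesis
    using l2norm_nonneg[of "w k"] unfolding power2_eq_1_iff by linarith
qed

lemma inner_finite_synth:
  assumes "finite A"
  shows "l2inner (w k) (\<lambda>j. \<Sum>i\<in>A. f i * w i j) = (if k \<in> A then f k else 0)"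
  using assms by (simp add: l2inner_sum_right orthonormal_l2 l2_cmult l2inner_cmult_right
      orthonormal_inner if_distrib[of "\<lambda>x. _ * x"] cong: if_cong)

lemma l2_finite_synth: "l2 (\<lambda>j. \<Sum>k\<in>A. f k * w k j)"
  by (intro l2_sum l2_cmult orthonormal_l2)

lemma l2norm_finite_synth:
  assumes "finite A"
  shows "(l2norm (\<lambda>j. \<Sum>k\<in>A. f k * w k j))^2 = (\<Sum>k\<in>A. (cmod (f k))^2)"
proof -
  let ?s = "\<lambda>j. \<Sum>k\<in>A. f k * w k j"
  have l: "l2 ?s" by (rule l2_finite_synth)
  have "complex_of_real ((l2norm ?s)^2) = l2inner ?s ?s"
    using l2inner_self[OF l] by simp
  also have "\<dots> = (\<Sum>k\<in>A. f k * l2inner ?s (w k))"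
    using l by (simp add: l2inner_sum_right orthonormal_l2 l2_cmult l2inner_cmult_right)
  also have "\<dots> = (\<Sum>k\<in>A. complex_of_real ((cmod (f k))^2))"
  proof (rule sum.cong)
    fix k assume "k \<in> A"
    then have "l2inner ?s (w k) = cnj (f k)"
      using inner_finite_synth[OF assms, of k f] l2inner_commute[of ?s "w k"] by simp
    then show "f k * l2inner ?s (w k) = complex_of_real ((cmod (f k))^2)"
      by (simp only: complex_norm_square)
  qed simp
  finally have "complex_of_real ((l2norm ?s)^2) = complex_of_real (\<Sum>k\<in>A. (cmod (f k))^2)"
    by simp
  then show ?thesis using of_real_eq_iff by blast
qed

lemma Bessel_finite:
  assumes "l2 g" "finite A" shows "(\<Sum>k\<in>A. (cmod (l2inner (w k) g))^2) \<le> (l2norm g)^2"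
proof -
  let ?c = "\<lambda>k. l2inner (w k) g" and ?S = "\<Sum>k\<in>A. (cmod (l2inner (w k) g))^2"
  let ?s = "\<lambda>j. \<Sum>k\<in>A. ?c k * w k j"
  have l: "l2 ?s" by (rule l2_finite_synth)
  have n: "(l2norm ?s)^2 = ?S" by (rule l2norm_finite_synth[OF assms(2)])
  have "l2inner g ?s = (\<Sum>k\<in>A. ?c k * l2inner g (w k))"
    using assms by (simp add: l2inner_sum_right orthonormal_l2 l2_cmult l2inner_cmult_right)
  also have "\<dots> = (\<Sum>k\<in>A. complex_of_real ((cmod (?c k))^2))"
    by (intro sum.cong refl) (simp only: complex_norm_square l2inner_commute[of g])
  finally have "Re (l2inner g ?s) = ?S" by simp
  moreover have "(l2norm (\<lambda>j. g j + - 1 * ?s j))^2 = (l2norm g)^2 + 2 * Re (l2inner g (\<lambda>j. - 1 * ?s j)) + (l2norm (\<lambda>j. -1 * ?s j))^2"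
    by (intro l2norm_sq_add assms l2_cmult l)
  ultimately have "(l2norm (\<lambda>j. g j + - 1 * ?s j))^2 = (l2norm g)^2 - ?S"
    unfolding l2norm_cmult l2inner_cmult_right using n by simp
  then show ?thesis using zero_le_power2[of "l2norm (\<lambda>j. g j + - 1 * ?s j)"] by linarith
qed

lemma Bessel:
  assumes "l2 g" shows "l2 (\<lambda>k. l2inner (w k) g)" "l2norm (\<lambda>k. l2inner (w k) g) \<le> l2norm g"
  using l2_bounded_finite_sums[of "\<lambda>k. l2inner (w k) g" "l2norm g"] Bessel_finite[OF assms] by auto

text \<open>Bessel's inequality for the unit vector at \<open>j\<close>, whose coefficients are the
  conjugated entries of the column. This makes the coordinatewise sum in \<open>synth\<close>
  converge.\<close>

lemma orthonormal_column_l2: "l2 (\<lambda>k. w k j)"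
proof -
  let ?d = "\<lambda>i. if i = j then 1 else 0 :: complex"
  have "l2 ?d" by (rule l2_finite_support[of "{j}"]) auto
  moreover have "l2inner (w k) ?d = cnj (w k j)" for k
    by (subst l2inner_finite_support_right[of "{j}"]) auto
  ultimately have "l2 (\<lambda>k. cnj (w k j))" using Bessel(1)[of ?d] by simp
  then show ?thesis by simp
qed

lemma synth_summable:
  assumes "l2 f" shows "(\<lambda>k. f k * w k j) summable_on UNIV"
  by (rule l2_mult_summable[OF assms orthonormal_column_l2])

text \<open>By Pythagoras every finite truncation of the expansion has norm at most
  \<open>l2norm f\<close>; on finitely many coordinates the bound passes to the limit. Equality
  comes in \<open>l2_synth\<close>, from Bessel.\<close>

lemma l2_synth_aux:
  assumes "l2 f" shows "l2 (synth w f)" "l2norm (synth w f) \<le> l2norm f"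
proof -
  have "(\<Sum>j\<in>B. (cmod (synth w f j))^2) \<le> (l2norm f)^2" if B: "finite B" for B
  proof (rule tendsto_upperbound)
    show "((\<lambda>A. \<Sum>j\<in>B. (cmod (\<Sum>k\<in>A. f k * w k j))^2) \<longlongrightarrow> (\<Sum>j\<in>B. (cmod (synth w f j))^2)) (finite_subsets_at_top UNIV)"
      unfolding synth_def by (intro tendsto_intros infsum_tendsto synth_summable assms)
    show "\<forall>\<^sub>F A in finite_subsets_at_top UNIV. (\<Sum>j\<in>B. (cmod (\<Sum>k\<in>A. f k * w k j))^2) \<le> (l2norm f)^2"
    proof (rule eventually_finite_subsets_at_top_weakI)
      fix A :: "'k set" assume A: "finite A"
      have "(\<Sum>j\<in>B. (cmod (\<Sum>k\<in>A. f k * w k j))^2) \<le> (l2norm (\<lambda>j. \<Sum>k\<in>A. f k * w k j))^2"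
        by (rule finite_sum_le_l2norm_sq[OF l2_finite_synth B])
      also have "\<dots> \<le> (l2norm f)^2"
        unfolding l2norm_finite_synth[OF A] by (rule finite_sum_le_l2norm_sq[OF assms A])
      finally show "(\<Sum>j\<in>B. (cmod (\<Sum>k\<in>A. f k * w k j))^2) \<le> (l2norm f)^2" .
    qed
  qed simp
  then show "l2 (synth w f)" "l2norm (synth w f) \<le> l2norm f"
    using l2_bounded_finite_sums[of "synth w f" "l2norm f"] by auto
qed

lemma synth_add:
  assumes "l2 f" "l2 g" shows "synth w (\<lambda>k. f k + g k) j = synth w f j + synth w g j"
  unfolding synth_def distrib_right by (intro infsum_add synth_summable assms)

lemma synth_cmult: "synth w (\<lambda>k. c * f k) j = c * synth w f j"
  unfolding synth_def mult.assoc by (rule infsum_cmult_right')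

lemma synth_diff:
  assumes "l2 f" "l2 g" shows "synth w (\<lambda>k. f k - g k) j = synth w f j - synth w g j"
  using synth_add[OF assms(1) l2_cmult[OF assms(2), of "-1"], of j] synth_cmult[of "-1" g j] by simp

lemma synth_finite_support:
  assumes "finite A" "\<And>k. k \<notin> A \<Longrightarrow> f k = 0"
  shows "synth w f j = (\<Sum>k\<in>A. f k * w k j)"
proof -
  have "synth w f j = infsum (\<lambda>k. f k * w k j) A"
    unfolding synth_def using assms by (intro infsum_cong_neutral) auto
  then show ?thesis using assms by simp
qed

text \<open>Orthonormality settles the part of \<open>f\<close> on a finite set containing
  \<open>k\<close>; the remainder contributes at most the norm of the tail, which tends to
  0.\<close>

lemma inner_synth:
  assumes "l2 f" shows "l2inner (w k) (synth w f) = f k"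
proof -
  let ?t = "\<lambda>A i. if i \<in> A then 0 else f i"
  have tl: "l2 (?t A)" for A by (rule l2_dominated[OF assms]) auto
  have "cmod (l2inner (w k) (synth w f) - f k) \<le> l2norm (?t A)" if A: "finite A" "k \<in> A" for A
  proof -
    have fl: "l2 (\<lambda>i. if i \<in> A then f i else 0)" by (rule l2_dominated[OF assms]) auto
    have "synth w f j = (\<Sum>i\<in>A. f i * w i j) + synth w (?t A) j" for j
    proof -
      have "f = (\<lambda>i. (if i \<in> A then f i else 0) + ?t A i)" by auto
      then have "synth w f j = synth w (\<lambda>i. if i \<in> A then f i else 0) j + synth w (?t A) j"
        using synth_add[OF fl tl[of A], of j] by simp
      also have "synth w (\<lambda>i. if i \<in> A then f i else 0) j = (\<Sum>i\<in>A. f i * w i j)"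
        by (subst synth_finite_support[OF A(1)]) (auto intro: sum.cong)
      finally show ?thesis .
    qed
    then have "synth w f = (\<lambda>j. (\<Sum>i\<in>A. f i * w i j) + synth w (?t A) j)" by auto
    then have "l2inner (w k) (synth w f) = f k + l2inner (w k) (synth w (?t A))"
      using l2inner_add_right[OF orthonormal_l2[of k] l2_finite_synth[of f A] l2_synth_aux(1)[OF tl[of A]]]
        inner_finite_synth[OF A(1), of k f] A by simp
    then have "cmod (l2inner (w k) (synth w f) - f k) \<le> l2norm (w k) * l2norm (synth w (?t A))"
      using l2_Cauchy_Schwarz[OF orthonormal_l2 l2_synth_aux(1)[OF tl[of A]], of k] by simp
    then show ?thesis
      using orthonormal_norm[of k] l2_synth_aux(2)[OF tl[of A]] by simp
  qed
  then have "\<forall>\<^sub>F A in finite_subsets_at_top UNIV. cmod (l2inner (w k) (synth w f) - f k) \<le> l2norm (?t A)"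
    unfolding eventually_finite_subsets_at_top by (intro exI[of _ "{k}"]) auto
  then have "cmod (l2inner (w k) (synth w f) - f k) \<le> 0"
    using l2norm_tail_tendsto_0[OF assms] by (intro tendsto_lowerbound) auto
  then show ?thesis by simp
qed

lemma l2_synth:
  assumes "l2 f" shows "l2 (synth w f)" "l2norm (synth w f) = l2norm f"
  using l2_synth_aux[OF assms] Bessel[of "synth w f"] inner_synth[OF assms] by auto

end

subsection \<open>Unitary kernels\<close>

definition adjoint_kernel :: "('k \<Rightarrow> 'j \<Rightarrow> complex) \<Rightarrow> 'j \<Rightarrow> 'k \<Rightarrow> complex" where
  "adjoint_kernel u j k = cnj (u k j)"

text \<open>Orthonormal rows and orthonormal columns. In this symmetric form unitarity passes to
  tensor powers by applying one orthonormality lemma twice.\<close>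

definition unitary_kernel :: "('k \<Rightarrow> 'j \<Rightarrow> complex) \<Rightarrow> bool" where
  "unitary_kernel u \<longleftrightarrow> orthonormal u \<and> orthonormal (adjoint_kernel u)"

abbreviation hat :: "('j \<Rightarrow> 'k \<Rightarrow> complex) \<Rightarrow> ('k \<Rightarrow> complex) \<Rightarrow> 'j \<Rightarrow> complex" where
  "hat u f \<equiv> (\<lambda>j. l2inner (u j) f)"

lemma synth_adjoint_kernel: "synth (adjoint_kernel u) f = hat u f"
  by (auto simp: synth_def adjoint_kernel_def l2inner_def mult.commute)

lemma unitary_hat:
  assumes "unitary_kernel u" "l2 f"
  shows "l2 (hat u f)" "l2norm (hat u f) = l2norm f" "synth u (hat u f) = f"
proof -
  have o: "orthonormal u" "orthonormal (adjoint_kernel u)" using assms by (auto simp: unitary_kernel_def)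
  show "l2 (hat u f)" "l2norm (hat u f) = l2norm f"
    using l2_synth[OF o(2) assms(2)] by (auto simp: synth_adjoint_kernel)
  show "synth u (hat u f) = f"
  proof
    fix k
    have "l2inner (adjoint_kernel u k) (hat u f) = f k"
      using inner_synth[OF o(2) assms(2), of k] by (simp add: synth_adjoint_kernel)
    then show "synth u (hat u f) k = f k"
      by (simp add: l2inner_def adjoint_kernel_def synth_def mult.commute)
  qed
qed

text \<open>A unit vector minus its expansion is orthogonal to every row, hence zero by totality;
  reading off one coordinate gives the inner product of two columns.\<close>

lemma unitary_kernelI_total:
  assumes o: "orthonormal u" and total: "\<And>f. l2 f \<Longrightarrow> (\<And>j. l2inner (u j) f = 0) \<Longrightarrow> f = (\<lambda>_. 0)"
  shows "unitary_kernel u"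
proof -
  have "l2inner (adjoint_kernel u k) (adjoint_kernel u k') = (if k = k' then 1 else 0)" for k k'
  proof -
    let ?d = "\<lambda>i. if i = k' then 1 else 0 :: complex"
    have d: "l2 ?d" by (rule l2_finite_support[of "{k'}"]) auto
    have c: "hat u ?d = adjoint_kernel u k'"
      by (rule ext, subst l2inner_finite_support_right[of "{k'}"]) (auto simp: adjoint_kernel_def)
    have lc: "l2 (hat u ?d)" by (rule Bessel(1)[OF o d])
    have "(\<lambda>i. ?d i - synth u (hat u ?d) i) = (\<lambda>_. 0)"
      using orthonormal_l2[OF o] d l2_synth(1)[OF o lc] inner_synth[OF o lc]
      by (intro total l2_diff) (auto simp: l2inner_diff_right)
    then have "?d k - synth u (hat u ?d) k = 0" by (rule fun_cong)
    then have "?d k = synth u (hat u ?d) k" by simp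
    then show ?thesis
      unfolding c by (auto simp: synth_def l2inner_def adjoint_kernel_def mult.commute)
  qed
  moreover have "l2 (adjoint_kernel u k)" for k
    using orthonormal_column_l2[OF o, of k] by (simp add: adjoint_kernel_def[abs_def])
  ultimately show ?thesis using o by (simp add: unitary_kernel_def orthonormal_def)
qed

section \<open>Tensor products and Slater determinants\<close>

text \<open>Functions on lists of all lengths carry all particle numbers at once, with value 0 on a
  length mismatch. The recursion fits the head-tail splitting in \<open>infsum_Cons\<close>;
  \<open>tens_eq\<close> is the closed form.\<close>

fun tens :: "('a \<Rightarrow> 'b::comm_ring_1) list \<Rightarrow> 'a list \<Rightarrow> 'b" where
  "tens [] [] = 1"
| "tens (f # fs) (k # ks) = f k * tens fs ks"
| "tens _ _ = 0"

lemma tens_eq: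
  "tens fs ks = (if length ks = length fs then \<Prod>i<length fs. (fs ! i) (ks ! i) else 0)"
  by (induction fs ks rule: tens.induct) (auto simp: prod.lessThan_Suc_shift simp del: prod.lessThan_Suc)

lemma infsum_Cons:
  fixes f :: "'a list \<Rightarrow> 'b::banach"
  assumes "f [] = 0"
  shows "f summable_on UNIV \<longleftrightarrow> (\<lambda>(k, ks). f (k # ks)) summable_on UNIV"
    and "infsum f UNIV = infsum (\<lambda>(k, ks). f (k # ks)) UNIV"
proof -
  let ?c = "\<lambda>(k::'a, ks). k # ks"
  have inj: "inj ?c" by (auto simp: inj_on_def)
  have r: "f x = 0" if "x \<notin> range ?c" for x
    using that assms by (cases x) auto
  have "f summable_on UNIV \<longleftrightarrow> f summable_on (range ?c)"
    by (rule summable_on_cong_neutral) (use r in auto)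
  also have "\<dots> \<longleftrightarrow> (f \<circ> ?c) summable_on UNIV"
    using summable_on_reindex[OF inj] .
  finally show "f summable_on UNIV \<longleftrightarrow> (\<lambda>(k, ks). f (k # ks)) summable_on UNIV"
    by (simp add: o_def case_prod_unfold)
  have "infsum f UNIV = infsum f (range ?c)"
    by (rule infsum_cong_neutral) (use r in auto)
  also have "\<dots> = infsum (f \<circ> ?c) UNIV"
    using infsum_reindex[OF inj] .
  finally show "infsum f UNIV = infsum (\<lambda>(k, ks). f (k # ks)) UNIV"
    by (simp add: o_def case_prod_unfold)
qed

lemma infsum_product_complex:
  fixes f :: "'a \<Rightarrow> complex" and g :: "'b \<Rightarrow> complex"
  assumes "f summable_on UNIV" "g summable_on UNIV"
  shows "(\<lambda>(x, y). f x * g y) summable_on UNIV"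
    and "infsum (\<lambda>(x, y). f x * g y) UNIV = infsum f UNIV * infsum g UNIV"
proof -
  have f: "(\<lambda>x. norm (f x)) summable_on UNIV" and g: "(\<lambda>x. norm (g x)) summable_on UNIV"
    using assms summable_on_iff_abs_summable_on_complex by blast+
  have "(\<lambda>z. norm ((\<lambda>(x, y). f x * g y) z)) summable_on (UNIV \<times> UNIV)"
  proof (subst Infinite_Sum.abs_summable_on_Sigma_iff, intro conjI ballI)
    show "(\<lambda>y. norm ((\<lambda>(x, y). f x * g y) (x, y))) summable_on UNIV" for x
      using summable_on_cmult_right[OF g, of "norm (f x)"] by (simp add: norm_mult)
    show "(\<lambda>x. norm (\<Sum>\<^sub>\<infinity>y. norm ((\<lambda>(x, y). f x * g y) (x, y)))) summable_on UNIV"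
      using summable_on_cmult_left[OF f, of "infsum (\<lambda>x. norm (g x)) UNIV"]
      by (simp add: norm_mult infsum_cmult_right' infsum_nonneg abs_mult)
  qed
  then have s: "(\<lambda>(x, y). f x * g y) summable_on (UNIV \<times> UNIV)"
    by (rule abs_summable_summable)
  then show "(\<lambda>(x, y). f x * g y) summable_on UNIV" by simp
  have "infsum (\<lambda>(x, y). f x * g y) (UNIV \<times> UNIV) = infsum (\<lambda>x. infsum (\<lambda>y. f x * g y) UNIV) UNIV"
    using infsum_Sigma'_banach[OF s] by simp
  also have "\<dots> = infsum f UNIV * infsum g UNIV"
    by (simp add: infsum_cmult_right' infsum_cmult_left')
  finally show "infsum (\<lambda>(x, y). f x * g y) UNIV = infsum f UNIV * infsum g UNIV" by simp
qed

lemma infsum_tens: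
  fixes fs :: "('a \<Rightarrow> complex) list"
  assumes "\<And>f. f \<in> set fs \<Longrightarrow> f summable_on UNIV"
  shows "tens fs summable_on UNIV" "infsum (tens fs) UNIV = (\<Prod>i<length fs. infsum (fs ! i) UNIV)"
proof -
  have "tens fs summable_on UNIV \<and> infsum (tens fs) UNIV = (\<Prod>i<length fs. infsum (fs ! i) UNIV)"
    using assms
  proof (induction fs)
    case Nil
    have "infsum (tens ([] :: ('a \<Rightarrow> complex) list)) UNIV = infsum (tens ([] :: ('a \<Rightarrow> complex) list)) {[]}"
      by (rule infsum_cong_neutral) (auto simp: tens_eq)
    moreover have "tens ([] :: ('a \<Rightarrow> complex) list) summable_on UNIV"
      by (rule finite_nonzero_values_imp_summable_on) (auto intro!: finite_subset[of _ "{[]}"] simp: tens_eq)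
    ultimately show ?case by simp
  next
    case (Cons f fs)
    have z: "tens (f # fs) [] = 0" by simp
    show ?case
      using infsum_product_complex[of f "tens fs"] Cons by (simp add: infsum_Cons[of "tens (f # fs)", OF z] prod.lessThan_Suc_shift del: prod.lessThan_Suc)
  qed
  then show "tens fs summable_on UNIV" "infsum (tens fs) UNIV = (\<Prod>i<length fs. infsum (fs ! i) UNIV)" by auto
qed

lemma l2_tens:
  assumes "\<And>f. f \<in> set fs \<Longrightarrow> l2 f" shows "l2 (tens fs)"
proof -
  let ?qs = "map (\<lambda>f x. complex_of_real ((cmod (f x))^2)) fs"
  have "complex_of_real ((cmod (tens fs ks))^2) = tens ?qs ks" for ks
    by (simp add: tens_eq prod_norm[symmetric] prod_power_distrib[symmetric])
  moreover have "tens ?qs summable_on UNIV"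
  proof (rule infsum_tens)
    fix q assume "q \<in> set ?qs"
    then obtain f where "f \<in> set fs" "q = (\<lambda>x. complex_of_real ((cmod (f x))^2))" by auto
    then show "q summable_on UNIV"
      using summable_on_of_real[OF assms[of f, unfolded l2_def]] by simp
  qed
  ultimately have "(\<lambda>ks. complex_of_real ((cmod (tens fs ks))^2)) summable_on UNIV" by simp
  from summable_on_Re[OF this] show ?thesis by (simp add: l2_def)
qed

lemma l2inner_tens:
  assumes "\<And>f. f \<in> set fs \<Longrightarrow> l2 f" "\<And>g. g \<in> set gs \<Longrightarrow> l2 g"
  shows "l2inner (tens fs) (tens gs) =
    (if length fs = length gs then \<Prod>i<length fs. l2inner (fs ! i) (gs ! i) else 0)"
proof (cases "length fs = length gs")
  case True
  let ?ps = "map2 (\<lambda>f g x. cnj (f x) * g x) fs gs"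
  have "cnj (tens fs ks) * tens gs ks = tens ?ps ks" for ks
    using True by (simp add: tens_eq prod.distrib)
  then have "l2inner (tens fs) (tens gs) = infsum (tens ?ps) UNIV" by (simp add: l2inner_def)
  also have "\<dots> = (\<Prod>i<length ?ps. infsum (?ps ! i) UNIV)"
  proof (rule infsum_tens)
    fix p assume "p \<in> set ?ps"
    then obtain f g where "f \<in> set fs" "g \<in> set gs" "p = (\<lambda>x. cnj (f x) * g x)"
      by (auto dest: set_zip_leftD set_zip_rightD)
    then show "p summable_on UNIV" using assms by (auto intro: l2inner_summable)
  qed
  also have "\<dots> = (\<Prod>i<length fs. l2inner (fs ! i) (gs ! i))"
    using True by (simp add: l2inner_def)
  finally show ?thesis using True by simp
next
  case False
  then have z: "cnj (tens fs ks) * tens gs ks = 0" for ks by (simp add: tens_eq)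
  show ?thesis using False unfolding l2inner_def z by simp
qed

definition list_kernel :: "('j \<Rightarrow> 'k \<Rightarrow> complex) \<Rightarrow> 'j list \<Rightarrow> 'k list \<Rightarrow> complex" where
  "list_kernel u js = tens (map u js)"

lemma list_kernel_eq:
  "list_kernel u js ks = (if length ks = length js then \<Prod>i<length js. u (js ! i) (ks ! i) else 0)"
  by (simp add: list_kernel_def tens_eq)

lemma orthonormal_list_kernel:
  assumes "orthonormal u" shows "orthonormal (list_kernel u)"
proof -
  have l: "l2 (list_kernel u js)" for js
    unfolding list_kernel_def using orthonormal_l2[OF assms] by (intro l2_tens) auto
  moreover have "l2inner (list_kernel u js) (list_kernel u js') = (if js = js' then 1 else 0)" for js js'
  proof -
    have "l2inner (list_kernel u js) (list_kernel u js') =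
      (if length js = length js' then \<Prod>i<length js. l2inner (u (js ! i)) (u (js' ! i)) else 0)"
      unfolding list_kernel_def using orthonormal_l2[OF assms] by (subst l2inner_tens) auto
    moreover have "(\<Prod>i<length js. l2inner (u (js ! i)) (u (js' ! i))) = 0"
      if "length js = length js'" "js \<noteq> js'"
    proof -
      obtain i where "i < length js" "js ! i \<noteq> js' ! i" using \<open>js \<noteq> js'\<close> \<open>length js = length js'\<close> nth_equalityI by blast
      then show ?thesis by (intro prod_zero) (auto simp: orthonormal_inner[OF assms] intro!: bexI[of _ i])
    qed
    ultimately show ?thesis by (auto simp: orthonormal_inner[OF assms])
  qed
  ultimately show ?thesis by (simp add: orthonormal_def)
qed

text \<open>The adjoint of a product kernel is the product kernel of the adjoint, so orthonormality
  of products covers rows and columns alike.\<close>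

lemma unitary_list_kernel:
  assumes "unitary_kernel u" shows "unitary_kernel (list_kernel u)"
proof -
  have "adjoint_kernel (list_kernel u) = list_kernel (adjoint_kernel u)"
    by (intro ext) (auto simp: adjoint_kernel_def list_kernel_eq)
  then show ?thesis using assms orthonormal_list_kernel unfolding unitary_kernel_def by metis
qed

lemma slater_tens:
  "slater fs ks = (\<Sum>p | p permutes {..<length fs}. of_int (sign p) * tens fs (permute_list p ks))"
  by (auto simp: slater_def tens_eq permute_list_nth intro!: sum.cong prod.cong)

lemma tens_permute_list:
  assumes "p permutes {..<length fs}" "length ks = length fs"
  shows "tens (permute_list p fs) (permute_list p ks) = tens fs ks"
proof -
  have "(\<Prod>i<length fs. (fs ! p i) (ks ! p i)) = (\<Prod>i<length fs. (fs ! i) (ks ! i))"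
    using prod.permute[OF assms(1), of "\<lambda>i. (fs ! i) (ks ! i)"] by (simp add: o_def)
  then show ?thesis using assms by (simp add: tens_eq permute_list_nth)
qed

lemma permute_list_inverse:
  assumes "p permutes {..<length xs}"
  shows "permute_list (inv p) (permute_list p xs) = xs" "permute_list p (permute_list (inv p) xs) = xs"
  using permute_list_compose[of "inv p" xs p] permute_list_compose[of p xs "inv p"] permutes_inv[OF assms] assms
  by (auto simp: permutes_inv_o)

text \<open>Permuting the arguments by \<open>p\<close> amounts to permuting the factors by its
  inverse, and inversion preserves the sign. In this form the determinant is a finite combination of
  product functions.\<close>

lemma slater_tens':
  "slater fs ks = (\<Sum>p | p permutes {..<length fs}. of_int (sign p) * tens (permute_list p fs) ks)"
proof (cases "length ks = length fs")
  case True
  have "slater fs ks = (\<Sum>p | p permutes {..<length fs}. of_int (sign (inv p)) * tens fs (permute_list (inv p) ks))"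
    unfolding slater_tens by (rule sum_permutations_inverse)
  also have "\<dots> = (\<Sum>p | p permutes {..<length fs}. of_int (sign p) * tens (permute_list p fs) ks)"
  proof (intro sum.cong refl)
    fix p assume "p \<in> {p. p permutes {..<length fs}}"
    then have p: "p permutes {..<length fs}" by simp
    have "tens fs (permute_list (inv p) ks) = tens (permute_list p fs) ks"
      using tens_permute_list[OF p, of "permute_list (inv p) ks"] permute_list_inverse(2)[of p ks] True p by simp
    moreover have "permutation p" using p permutation_permutes by blast
    ultimately show "of_int (sign (inv p)) * tens fs (permute_list (inv p) ks) = of_int (sign p) * tens (permute_list p fs) ks"
      by (simp add: sign_inverse)
  qed
  finally show ?thesis .
next
  case False
  then show ?thesis by (simp add: slater_def tens_eq)
qed

lemma l2_slater:
  assumes "\<And>f. f \<in> set fs \<Longrightarrow> l2 f" shows "l2 (slater fs)"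
  unfolding slater_tens'[abs_def]
  by (intro l2_sum l2_cmult l2_tens) (use assms in \<open>auto simp: set_permute_list\<close>)

text \<open>A change of one-particle basis acts factor by factor on product functions and commutes
  with antisymmetrisation: coefficients of a determinant form the determinant of the
  coefficients.\<close>

lemma hat_slater:
  assumes u: "\<And>j. l2 (u j)" and fs: "\<And>f. f \<in> set fs \<Longrightarrow> l2 f"
  shows "hat (list_kernel u) (slater fs) js = slater (map (hat u) fs) js"
proof -
  let ?P = "{p. p permutes {..<length fs}}"
  have "hat (list_kernel u) (slater fs) js = (\<Sum>p\<in>?P. of_int (sign p) * l2inner (list_kernel u js) (tens (permute_list p fs)))"
    unfolding slater_tens'[abs_def]
  proof (subst l2inner_sum_right)
    show "l2 (list_kernel u js)" unfolding list_kernel_def by (rule l2_tens) (auto intro: u)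
    show "l2 (\<lambda>ks. of_int (sign p) * tens (permute_list p fs) ks)" if "p \<in> ?P" for p
      using that by (intro l2_cmult l2_tens fs) auto
  qed (simp add: l2inner_cmult_right)
  also have "\<dots> = (\<Sum>p\<in>?P. of_int (sign p) * tens (permute_list p (map (hat u) fs)) js)"
  proof (intro sum.cong refl)
    fix p assume "p \<in> ?P"
    then have p: "p permutes {..<length fs}" by simp
    have "l2inner (list_kernel u js) (tens (permute_list p fs)) =
        (if length js = length fs then \<Prod>i<length js. l2inner (u (js ! i)) (fs ! p i) else 0)"
      unfolding list_kernel_def
      by (subst l2inner_tens) (use p u fs in \<open>auto simp: set_permute_list permute_list_nth\<close>)
    also have "\<dots> = tens (permute_list p (map (hat u) fs)) js"
      using p permutes_in_image[OF p] by (auto simp: tens_eq permute_list_nth intro!: prod.cong)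
    finally show "of_int (sign p) * l2inner (list_kernel u js) (tens (permute_list p fs))
      = of_int (sign p) * tens (permute_list p (map (hat u) fs)) js" by simp
  qed
  also have "\<dots> = slater (map (hat u) fs) js" by (simp add: slater_tens')
  finally show ?thesis .
qed

lemma sum_permutes_const:
  fixes l :: "'a \<Rightarrow> 'b::comm_monoid_add"
  assumes "p permutes {..<length ks}"
  shows "(\<Sum>i<length ks. l (ks ! p i)) = (\<Sum>k\<leftarrow>ks. l k)"
  using sum.permute[OF assms, of "\<lambda>i. l (ks ! i)"] by (simp add: o_def sum_list_sum_nth atLeast0LessThan)

text \<open>Multiplying the slots in turn by \<open>l\<close> produces, for each permutation, the
  sum of \<open>l\<close> over the same entries in another order. This symmetric factor leaves the
  determinant, which is why second quantization of a diagonal operator is diagonal.\<close>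

lemma sum_slater_update:
  assumes "length ks = length fs" "length gs = length fs"
    and g: "\<And>i k. i < length fs \<Longrightarrow> (gs ! i) k = l k * (fs ! i) k"
  shows "(\<Sum>i<length fs. slater (fs[i := gs ! i]) ks) = (\<Sum>k\<leftarrow>ks. l k) * slater fs ks"
proof -
  let ?n = "length fs"
  have "(\<Prod>r<?n. (fs[i := gs ! i] ! r) (ks ! p r)) = l (ks ! p i) * (\<Prod>r<?n. (fs ! r) (ks ! p r))" if "i < ?n" for p i
  proof -
    have "(\<Prod>r<?n. (fs[i := gs ! i] ! r) (ks ! p r)) = (\<Prod>r<?n. (if r = i then l (ks ! p i) else 1) * (fs ! r) (ks ! p r))"
      using g by (intro prod.cong) auto
    then show ?thesis using that by (simp add: prod.distrib)
  qed
  then have "(\<Sum>i<?n. slater (fs[i := gs ! i]) ks) =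
     (\<Sum>i<?n. \<Sum>p | p permutes {..<?n}. of_int (sign p) * (l (ks ! p i) * (\<Prod>r<?n. (fs ! r) (ks ! p r))))"
    using assms by (simp add: slater_def)
  also have "\<dots> = (\<Sum>p | p permutes {..<?n}. of_int (sign p) * ((\<Sum>i<?n. l (ks ! p i)) * (\<Prod>r<?n. (fs ! r) (ks ! p r))))"
    by (subst sum.swap) (simp add: sum_distrib_left sum_distrib_right)
  also have "\<dots> = (\<Sum>p | p permutes {..<?n}. of_int (sign p) * ((\<Sum>k\<leftarrow>ks. l k) * (\<Prod>r<?n. (fs ! r) (ks ! p r))))"
    using sum_permutes_const[of _ ks l] assms(1) by (intro sum.cong refl) auto
  also have "\<dots> = (\<Sum>k\<leftarrow>ks. l k) * slater fs ks"
    using assms by (simp add: slater_def sum_distrib_left algebra_simps)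
  finally show ?thesis .
qed

text \<open>The exclusion principle: composing with the transposition of two equal entries changes
  every sign and no product, so the sum equals its negative.\<close>

lemma slater_not_distinct:
  assumes "\<not> distinct ks" shows "slater fs ks = 0"
proof (cases "length ks = length fs")
  case True
  let ?n = "length fs"
  obtain a b where ab: "a < ?n" "b < ?n" "a \<noteq> b" "ks ! a = ks ! b"
    using assms True by (auto simp: distinct_conv_nth)
  let ?t = "Transposition.transpose a b"
  have t: "?t permutes {..<?n}" using ab by (intro permutes_swap_id) auto
  let ?f = "\<lambda>p. of_int (sign p) * (\<Prod>i<?n. (fs ! i) (ks ! p i))"
  have "sum ?f {p. p permutes {..<?n}} = sum (\<lambda>p. ?f (?t \<circ> p)) {p. p permutes {..<?n}}"
    by (rule setum_permutations_compose_left[OF t])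
  also have "\<dots> = sum (\<lambda>p. - ?f p) {p. p permutes {..<?n}}"
  proof (intro sum.cong refl)
    fix p assume "p \<in> {p. p permutes {..<?n}}"
    then have "permutation p" using permutation_permutes by blast
    moreover have "ks ! ?t i = ks ! i" for i using ab by (auto simp: Transposition.transpose_def)
    ultimately show "?f (?t \<circ> p) = - ?f p"
      using ab by (simp add: sign_compose permutation_swap_id sign_swap_id)
  qed
  finally have "slater fs ks = - slater fs ks"
    using True by (simp add: slater_def sum_negf)
  then show ?thesis by simp
qed (simp add: slater_def)

subsection \<open>Antisymmetric functions\<close>

lemma permute_list_transpose:
  assumes "a < length ks" "b < length ks"
  shows "permute_list (Transposition.transpose a b) ks = ks[a := ks ! b, b := ks ! a]"
  using assms by (intro nth_equalityI) (auto simp: permute_list_def Transposition.transpose_def nth_list_update)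

lemma antisymmetric_permute_list:
  fixes c :: "'a list \<Rightarrow> complex"
  assumes anti: "\<And>ks i j. i < length ks \<Longrightarrow> j < length ks \<Longrightarrow> i \<noteq> j \<Longrightarrow> c (ks[i := ks ! j, j := ks ! i]) = - c ks"
    and "p permutes {..<n}" "length ks = n"
  shows "c (permute_list p ks) = of_int (sign p) * c ks"
  using assms(2) finite_lessThan assms(3)
proof (induction arbitrary: ks rule: permutes_induct)
  case id
  then show ?case by simp
next
  case (swap a b p)
  let ?t = "Transposition.transpose a b"
  have "permute_list (?t \<circ> p) ks = permute_list p (permute_list ?t ks)"
    using swap by (intro permute_list_compose) auto
  moreover have "c (permute_list ?t ks) = of_int (sign ?t) * c ks"
    using swap anti[of a ks b] by (cases "a = b") (auto simp: permute_list_transpose sign_swap_id)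
  moreover have "permutation p" using swap permutation_permutes by blast
  ultimately show ?case
    using swap.IH[of "permute_list ?t ks"] swap.prems
    by (simp only: sign_compose permutation_swap_id length_permute_list of_int_mult mult_ac)
qed

lemma antisymmetric_not_distinct:
  fixes c :: "'a list \<Rightarrow> complex"
  assumes anti: "\<And>ks i j. i < length ks \<Longrightarrow> j < length ks \<Longrightarrow> i \<noteq> j \<Longrightarrow> c (ks[i := ks ! j, j := ks ! i]) = - c ks"
    and "\<not> distinct ks"
  shows "c ks = 0"
proof -
  obtain a b where ab: "a < length ks" "b < length ks" "a \<noteq> b" "ks ! a = ks ! b"
    using assms(2) by (auto simp: distinct_conv_nth)
  then have "ks[a := ks ! b, b := ks ! a] = ks" by (metis list_update_id)
  then show ?thesis using anti[OF ab(1-3)] by simp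
qed

text \<open>Swapping the same two positions in the index list and in the argument list leaves the
  product kernel invariant; reindexing the sum moves the swap onto \<open>y\<close>.\<close>

lemma hat_antisymmetric:
  fixes u :: "'j \<Rightarrow> 'k \<Rightarrow> complex"
  assumes y: "fermion_space N y" and ij: "i < length js" "j < length js" "i \<noteq> j"
  shows "hat (list_kernel u) y (js[i := js ! j, j := js ! i]) = - hat (list_kernel u) y js"
proof -
  define s :: "'k list \<Rightarrow> 'k list" where "s ks = permute_list (Transposition.transpose i j) ks" for ks
  let ?S = "{ks :: 'k list. length ks = length js}"
  have t: "Transposition.transpose i j permutes {..<length js}" using ij by (intro permutes_swap_id) auto
  have sb: "bij_betw s ?S ?S"
  proof (intro bij_betwI[where g = s])
    show "s (s ks) = ks" if "ks \<in> ?S" for ks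
      using permute_list_inverse(1)[of "Transposition.transpose i j" ks] t that by (simp add: s_def)
    then show "s (s ks) = ks" if "ks \<in> ?S" for ks using that .
  qed (auto simp: s_def)
  have sy: "y (s ks) = - y ks" if "ks \<in> ?S" for ks
    using y that ij by (auto simp: fermion_space_def s_def permute_list_transpose)
  have sk: "list_kernel u (js[i := js ! j, j := js ! i]) (s ks) = list_kernel u js ks" if "ks \<in> ?S" for ks
  proof -
    have "js[i := js ! j, j := js ! i] = permute_list (Transposition.transpose i j) js"
      using ij by (simp add: permute_list_transpose)
    then show ?thesis
      unfolding list_kernel_def s_def
      using tens_permute_list[of "Transposition.transpose i j" "map u js" ks] t that
      by (simp add: permute_list_map)
  qed
  have *: "hat (list_kernel u) y xs = infsum (\<lambda>ks. cnj (list_kernel u xs ks) * y ks) ?S" if "length xs = length js" for xs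
    unfolding l2inner_def using that by (intro infsum_cong_neutral) (auto simp: list_kernel_eq)
  have "hat (list_kernel u) y (js[i := js ! j, j := js ! i]) =
     infsum (\<lambda>ks. cnj (list_kernel u (js[i := js ! j, j := js ! i]) (s ks)) * y (s ks)) ?S"
    using infsum_reindex_bij_betw[OF sb, of "\<lambda>ks. cnj (list_kernel u (js[i := js ! j, j := js ! i]) ks) * y ks"]
    by (simp add: *)
  also have "\<dots> = infsum (\<lambda>ks. - (cnj (list_kernel u js ks) * y ks)) ?S"
    by (intro infsum_cong) (use sk sy in auto)
  also have "\<dots> = - hat (list_kernel u) y js"
    by (simp add: infsum_uminus *)
  finally show ?thesis .
qed

section \<open>Second quantization of an operator with an eigenbasis\<close>

text \<open>Elements of \<open>A - B\<close> are exchanged one for one against elements of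
  \<open>B - A\<close>, none of which lowers the sum. It says that filling the lowest levels
  minimises the energy.\<close>

lemma sum_le_sum_exchange:
  fixes f :: "'a \<Rightarrow> real"
  assumes "finite A" "finite B" "card A = card B" "\<And>i j. i \<in> A \<Longrightarrow> j \<notin> A \<Longrightarrow> f i \<le> f j"
  shows "sum f A \<le> sum f B"
proof -
  have "card (A - B) = card (B - A)"
    using assms(1-3) by (metis card_Diff_subset_Int finite_Int inf_commute)
  then obtain h where h: "bij_betw h (A - B) (B - A)"
    using finite_same_card_bij assms by (metis finite_Diff)
  have "sum f (A - B) \<le> (\<Sum>i\<in>A - B. f (h i))"
    using h assms(4) by (intro sum_mono) (auto simp: bij_betw_def)
  also have "\<dots> = sum f (B - A)" by (rule sum.reindex_bij_betw[OF h])
  finally have "sum f (A - B) \<le> sum f (B - A)" .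
  moreover have "sum f A = sum f (A - B) + sum f (A \<inter> B)" "sum f B = sum f (B - A) + sum f (A \<inter> B)"
    using assms by (auto simp: sum.Int_Diff[of A f B] sum.Int_Diff[of B f A] Int_commute)
  ultimately show ?thesis by simp
qed

lemma slater_update_scale:
  assumes "i < length fs"
  shows "slater (fs[i := (\<lambda>k. a * (fs ! i) k)]) ks = a * slater fs ks"
proof -
  let ?n = "length fs"
  have "(\<Prod>r<?n. (fs[i := (\<lambda>k. a * (fs ! i) k)] ! r) (ks ! p r)) = a * (\<Prod>r<?n. (fs ! r) (ks ! p r))" for p
  proof -
    have "(\<Prod>r<?n. (fs[i := (\<lambda>k. a * (fs ! i) k)] ! r) (ks ! p r)) = (\<Prod>r<?n. (if r = i then a else 1) * (fs ! r) (ks ! p r))"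
      by (intro prod.cong) auto
    then show ?thesis using assms by (simp add: prod.distrib)
  qed
  then show ?thesis by (simp add: slater_def sum_distrib_left algebra_simps)
qed

lemma pre_dGamma_sum:
  assumes "finite S" "\<And>i. i \<in> S \<Longrightarrow> P i \<in> elem_pairs G N"
  shows "((\<lambda>ks. \<Sum>i\<in>S. c i * fst (P i) ks), (\<lambda>ks. \<Sum>i\<in>S. c i * snd (P i) ks)) \<in> pre_dGamma G N"
proof -
  obtain h where h: "bij_betw h {..<card S} S"
    using ex_bij_betw_nat_finite[OF assms(1)] by (auto simp: atLeast0LessThan)
  have "(\<Sum>i\<in>S. c i * fst (P i) ks) = (\<Sum>j<card S. c (h j) * fst (P (h j)) ks)"
    "(\<Sum>i\<in>S. c i * snd (P i) ks) = (\<Sum>j<card S. c (h j) * snd (P (h j)) ks)" for ks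
    using sum.reindex_bij_betw[OF h, of "\<lambda>i. c i * fst (P i) ks"]
      sum.reindex_bij_betw[OF h, of "\<lambda>i. c i * snd (P i) ks"] by auto
  then show ?thesis
    unfolding pre_dGamma_def using h assms(2)
    by (intro CollectI exI[of _ "card S"] exI[of _ "c \<circ> h"] exI[of _ "P \<circ> h"]) (auto dest: bij_betwE)
qed

text \<open>The lists over \<open>A\<close> are closed under permutation and the coefficients absorb
  the sign, so each of the N! terms of a determinant contributes the same sum. Truncated product
  expansions of antisymmetric vectors are thereby combinations of determinants, as
  \<open>pre_dGamma\<close> requires.\<close>

lemma sum_antisymmetric_slater:
  fixes c :: "'j list \<Rightarrow> complex"
  assumes "finite A"
    and c: "\<And>p js. p permutes {..<N} \<Longrightarrow> length js = N \<Longrightarrow> c (permute_list p js) = of_int (sign p) * c js"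
  shows "(\<Sum>js | set js \<subseteq> A \<and> length js = N. c js / fact N * slater (map u js) ks) =
    (\<Sum>js | set js \<subseteq> A \<and> length js = N. c js * list_kernel u js ks)"
proof -
  let ?L = "{js. set js \<subseteq> A \<and> length js = N}" and ?P = "{p. p permutes {..<N}}"
  have "(\<Sum>js\<in>?L. c js * slater (map u js) ks) =
      (\<Sum>js\<in>?L. \<Sum>p\<in>?P. of_int (sign p) * c js * list_kernel u (permute_list p js) ks)"
    by (intro sum.cong refl)
      (auto simp: slater_tens' list_kernel_def permute_list_map sum_distrib_left algebra_simps intro!: sum.cong)
  also have "\<dots> = (\<Sum>p\<in>?P. \<Sum>js\<in>?L. of_int (sign p) * c js * list_kernel u (permute_list p js) ks)"
    by (rule sum.swap)
  also have "\<dots> = (\<Sum>p\<in>?P. \<Sum>js\<in>?L. c js * list_kernel u js ks)"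
  proof (rule sum.cong[OF refl])
    fix p assume "p \<in> ?P"
    then have p: "p permutes {..<N}" by simp
    have b: "bij_betw (permute_list p) ?L ?L"
    proof (rule bij_betwI[where g = "permute_list (inv p)"])
      show "permute_list p \<in> ?L \<rightarrow> ?L" using p by auto
      show "permute_list (inv p) \<in> ?L \<rightarrow> ?L" using permutes_inv[OF p] by auto
    qed (use permute_list_inverse[of p] p in auto)
    have "(\<Sum>js\<in>?L. of_int (sign p) * c js * list_kernel u (permute_list p js) ks) =
        (\<Sum>js\<in>?L. c (permute_list p js) * list_kernel u (permute_list p js) ks)"
      using c[OF p] by (intro sum.cong) auto
    also have "\<dots> = (\<Sum>js\<in>?L. c js * list_kernel u js ks)"
      by (rule sum.reindex_bij_betw[OF b])
    finally show "(\<Sum>js\<in>?L. of_int (sign p) * c js * list_kernel u (permute_list p js) ks) =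
        (\<Sum>js\<in>?L. c js * list_kernel u js ks)" .
  qed
  also have "\<dots> = fact N * (\<Sum>js\<in>?L. c js * list_kernel u js ks)"
    by (simp add: card_permutations)
  finally have "(\<Sum>js\<in>?L. c js * slater (map u js) ks) = fact N * (\<Sum>js\<in>?L. c js * list_kernel u js ks)" .
  moreover have "(\<Sum>js\<in>?L. c js / fact N * slater (map u js) ks) = (\<Sum>js\<in>?L. c js * slater (map u js) ks) / fact N"
    by (simp add: sum_divide_distrib)
  ultimately show ?thesis by simp
qed

text \<open>\<open>eigenpair\<close> puts the basis vectors into the domain, and
  \<open>graph_hat\<close> makes every pair of the graph diagonal on coefficients. Countability of
  the index type supplies the exhaustion by finite sets used to reach the closure.\<close>

locale eigenbasis =
  fixes u :: "'j::countable \<Rightarrow> 'k \<Rightarrow> complex" and ev :: "'j \<Rightarrow> real"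
    and G :: "(('k \<Rightarrow> complex) \<times> ('k \<Rightarrow> complex)) set"
  assumes unitary: "unitary_kernel u"
    and eigenpair: "(u j, \<lambda>k. complex_of_real (ev j) * u j k) \<in> G"
    and graph_l2: "(a, b) \<in> G \<Longrightarrow> l2 a \<and> l2 b"
    and graph_hat: "(a, b) \<in> G \<Longrightarrow> hat u b j = ev j * hat u a j"
begin

section \<open>Diagonal action of the second-quantized graph and its closure\<close>

abbreviation K :: "'j list \<Rightarrow> 'k list \<Rightarrow> complex" where "K \<equiv> list_kernel u"

definition energy :: "'j list \<Rightarrow> real" where "energy js = (\<Sum>j\<leftarrow>js. ev j)"

lemma orthonormal_u: "orthonormal u" and orthonormal_K: "orthonormal K" and unitary_K: "unitary_kernel K"
  using unitary unitary_list_kernel[OF unitary] by (auto simp: unitary_kernel_def)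

lemma l2_u: "l2 (u j)" and l2_K: "l2 (K js)"
  using orthonormal_l2[OF orthonormal_u] orthonormal_l2[OF orthonormal_K] by auto

lemma elem_pairs_hat:
  assumes "(x, w) \<in> elem_pairs G N"
  shows "l2 x" "l2 w" "hat K w js = energy js * hat K x js"
    "\<not> (length js = N \<and> distinct js) \<Longrightarrow> hat K x js = 0"
proof -
  obtain ps where x: "x = slater (map fst ps)"
    and w: "w = (\<lambda>ks. \<Sum>i<N. slater ((map fst ps)[i := snd (ps ! i)]) ks)"
    and N: "length ps = N" and ps: "set ps \<subseteq> G"
    using assms by (auto simp: elem_pairs_def)
  have fst_l2: "l2 f" if "f \<in> set (map fst ps)" for f
    using that ps graph_l2 by force
  have snd_l2: "l2 (snd (ps ! i))" if "i < N" for i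
    using that N subsetD[OF ps nth_mem[of i ps]] graph_l2[of "fst (ps ! i)" "snd (ps ! i)"] by auto
  have upd_l2: "l2 f" if "f \<in> set ((map fst ps)[i := snd (ps ! i)])" "i < N" for f i
    using that fst_l2 snd_l2 set_update_subset_insert[of "map fst ps" i "snd (ps ! i)"] by blast
  show "l2 x" unfolding x by (rule l2_slater[OF fst_l2])
  show "l2 w" unfolding w by (intro l2_sum l2_slater) (use upd_l2 in auto)
  let ?fs = "map (hat u) (map fst ps)" and ?gs = "map (hat u) (map snd ps)"
  have hx: "hat K x js = slater ?fs js"
    unfolding x by (rule hat_slater[OF l2_u fst_l2])
  have "hat K w js = (\<Sum>i<N. hat K (slater ((map fst ps)[i := snd (ps ! i)])) js)"
    unfolding w by (intro l2inner_sum_right l2_K l2_slater) (use upd_l2 in auto)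
  also have "\<dots> = (\<Sum>i<N. slater (?fs[i := ?gs ! i]) js)"
  proof (intro sum.cong refl)
    fix i assume i: "i \<in> {..<N}"
    have "hat K (slater ((map fst ps)[i := snd (ps ! i)])) js =
      slater (map (hat u) ((map fst ps)[i := snd (ps ! i)])) js"
      by (rule hat_slater[OF l2_u upd_l2]) (use i in auto)
    then show "hat K (slater ((map fst ps)[i := snd (ps ! i)])) js = slater (?fs[i := ?gs ! i]) js"
      using i N by (simp add: map_update)
  qed
  also have "\<dots> = energy js * slater ?fs js"
  proof (cases "length js = N")
    case True
    have "(\<Sum>i<length ?fs. slater (?fs[i := ?gs ! i]) js) = (\<Sum>j\<leftarrow>js. complex_of_real (ev j)) * slater ?fs js"
    proof (rule sum_slater_update)
      fix i k assume "i < length ?fs"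
      then show "(?gs ! i) k = complex_of_real (ev k) * (?fs ! i) k"
        using subsetD[OF ps nth_mem[of i ps]] graph_hat[of "fst (ps ! i)" "snd (ps ! i)" k] by auto
    qed (use True N in auto)
    moreover have "(\<Sum>j\<leftarrow>js. complex_of_real (ev j)) = energy js"
      unfolding energy_def by (induction js) auto
    ultimately show ?thesis using N by simp
  next
    case False
    then show ?thesis using N by (simp add: slater_def)
  qed
  finally show "hat K w js = energy js * hat K x js" using hx by simp
  show "hat K x js = 0" if "\<not> (length js = N \<and> distinct js)"
    using that slater_not_distinct[of js ?fs] N unfolding hx by (auto simp: slater_def)
qed

lemma pre_dGamma_hat:
  assumes "(x, w) \<in> pre_dGamma G N"
  shows "l2 x" "l2 w" "hat K w js = energy js * hat K x js"
    "\<not> (length js = N \<and> distinct js) \<Longrightarrow> hat K x js = 0"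
proof -
  obtain m c P where x: "x = (\<lambda>ks. \<Sum>j<(m::nat). c j * fst (P j) ks)"
    and w: "w = (\<lambda>ks. \<Sum>j<m. c j * snd (P j) ks)" and P: "\<forall>j<m. P j \<in> elem_pairs G N"
    using assms by (auto simp: pre_dGamma_def)
  note e = elem_pairs_hat[of "fst (P j)" "snd (P j)" N for j, simplified]
  show lx: "l2 x" unfolding x by (intro l2_sum l2_cmult) (use e P in auto)
  show lw: "l2 w" unfolding w by (intro l2_sum l2_cmult) (use e P in auto)
  have hx: "hat K x js = (\<Sum>j<m. c j * hat K (fst (P j)) js)"
    unfolding x by (subst l2inner_sum_right) (use e P in \<open>auto intro!: l2_K l2_cmult simp: l2inner_cmult_right\<close>)
  have hw: "hat K w js = (\<Sum>j<m. c j * hat K (snd (P j)) js)"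
    unfolding w by (subst l2inner_sum_right) (use e P in \<open>auto intro!: l2_K l2_cmult simp: l2inner_cmult_right\<close>)
  show "hat K w js = energy js * hat K x js"
    unfolding hx hw sum_distrib_left by (intro sum.cong refl) (use e(3) P in auto)
  show "hat K x js = 0" if "\<not> (length js = N \<and> distinct js)"
    unfolding hx by (intro sum.neutral ballI) (use e(4) that P in auto)
qed

lemma hat_tendsto:
  assumes "l2 x" "\<And>n. l2 (X n)" "(\<lambda>n. l2norm (\<lambda>ks. X n ks - x ks)) \<longlonglongrightarrow> 0"
  shows "(\<lambda>n. hat K (X n) js) \<longlonglongrightarrow> hat K x js"
proof -
  have "cmod (hat K (X n) js - hat K x js) \<le> l2norm (\<lambda>ks. X n ks - x ks)" for n
    using l2_Cauchy_Schwarz[OF l2_K[of js] l2_diff[OF assms(2)[of n] assms(1)]]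
      l2inner_diff_right[OF l2_K[of js] assms(2)[of n] assms(1)] orthonormal_norm[OF orthonormal_K, of js] by simp
  then have "(\<lambda>n. hat K (X n) js - hat K x js) \<longlonglongrightarrow> 0"
    by (intro Lim_null_comparison[OF _ assms(3)]) auto
  then show ?thesis by (rule LIM_zero_cancel)
qed

text \<open>Coefficients are continuous in norm, so the diagonal relation and the vanishing on
  inadmissible lists survive the closure.\<close>

lemma dGamma_hat:
  assumes "(x, w) \<in> dGamma G N"
  shows "l2 x" "l2 w" "hat K w js = energy js * hat K x js"
    "\<not> (length js = N \<and> distinct js) \<Longrightarrow> hat K x js = 0"
proof -
  obtain X Y where XY: "\<And>n. (X n, Y n) \<in> pre_dGamma G N"
    and X: "(\<lambda>n. l2norm (\<lambda>ks. X n ks - x ks)) \<longlonglongrightarrow> 0" and Y: "(\<lambda>n. l2norm (\<lambda>ks. Y n ks - w ks)) \<longlonglongrightarrow> 0"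
    using assms by (auto simp: dGamma_def)
  show lx: "l2 x" and lw: "l2 w" using assms by (auto simp: dGamma_def)
  have hX: "(\<lambda>n. hat K (X n) js) \<longlonglongrightarrow> hat K x js"
    by (rule hat_tendsto[OF lx pre_dGamma_hat(1)[OF XY] X])
  have hY: "(\<lambda>n. hat K (Y n) js) \<longlonglongrightarrow> hat K w js"
    by (rule hat_tendsto[OF lw pre_dGamma_hat(2)[OF XY] Y])
  have "(\<lambda>n. hat K (Y n) js) \<longlonglongrightarrow> energy js * hat K x js"
    unfolding pre_dGamma_hat(3)[OF XY] by (intro tendsto_intros hX)
  then show "hat K w js = energy js * hat K x js"
    using hY LIMSEQ_unique by blast
  show "hat K x js = 0" if "\<not> (length js = N \<and> distinct js)"
    using hX unfolding pre_dGamma_hat(4)[OF XY that] by (metis LIMSEQ_const_iff)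
qed

lemma elem_pairs_eigen:
  assumes "length js = N"
  shows "(slater (map u js), \<lambda>ks. energy js * slater (map u js) ks) \<in> elem_pairs G N"
proof -
  let ?ps = "map (\<lambda>j. (u j, \<lambda>k. complex_of_real (ev j) * u j k)) js"
  have f: "map fst ?ps = map u js" by simp
  have "(\<Sum>i<N. slater ((map fst ?ps)[i := snd (?ps ! i)]) ks) = energy js * slater (map u js) ks" for ks
  proof -
    have "(\<Sum>i<N. slater ((map fst ?ps)[i := snd (?ps ! i)]) ks) =
      (\<Sum>i<N. complex_of_real (ev (js ! i)) * slater (map u js) ks)"
      using slater_update_scale[of _ "map u js" _ ks] assms unfolding f by (intro sum.cong refl) auto
    also have "\<dots> = (\<Sum>i<N. complex_of_real (ev (js ! i))) * slater (map u js) ks"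
      by (simp add: sum_distrib_right)
    also have "(\<Sum>i<N. complex_of_real (ev (js ! i))) = energy js"
      using assms by (simp add: energy_def sum_list_sum_nth atLeast0LessThan)
    finally show ?thesis .
  qed
  then show ?thesis
    unfolding elem_pairs_def using assms eigenpair
    by (intro CollectI exI[of _ ?ps]) (auto simp: f o_def)
qed

text \<open>The determinant built from \<open>J\<close> is an eigenvector at the claimed minimum.
  For smaller \<open>e\<close> every admissible energy stays at a fixed distance from
  \<open>e\<close>, so the resolvent equation is solved coefficient by coefficient, and the solution
  is approximated within the algebraic domain.\<close>

theorem Inf_spectrum_dGamma:
  assumes J: "finite J" "card J = N" and gap: "\<And>i j. i \<in> J \<Longrightarrow> j \<notin> J \<Longrightarrow> ev i \<le> ev j"
  shows "Inf {e::real. complex_of_real e \<in> op_spectrum (fermion_space N) (dGamma G N)} = sum ev J"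
proof (rule cInf_eq_minimum)
  obtain js where js: "set js = J" "distinct js" using finite_distinct_list[OF J(1)] by blast
  then have len: "length js = N" using J distinct_card by metis
  have ejs: "energy js = sum ev J"
    using js by (simp add: energy_def sum_list_distinct_conv_sum_set)
  let ?x = "slater (map u js)"
  have lx: "l2 ?x" by (rule l2_slater) (auto intro: l2_u)
  have pair: "(?x, \<lambda>ks. energy js * ?x ks) \<in> dGamma G N"
  proof -
    have "((\<lambda>ks. \<Sum>i\<in>{()}. 1 * fst (?x, \<lambda>ks. energy js * ?x ks) ks),
        (\<lambda>ks. \<Sum>i\<in>{()}. 1 * snd (?x, \<lambda>ks. energy js * ?x ks) ks)) \<in> pre_dGamma G N"
      by (rule pre_dGamma_sum) (use elem_pairs_eigen[OF len] in auto)
    then have "(?x, \<lambda>ks. energy js * ?x ks) \<in> pre_dGamma G N" by simp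
    then show ?thesis
      unfolding dGamma_def using lx l2_cmult[OF lx, of "energy js"]
      by (intro CollectI case_prodI conjI exI[of _ "\<lambda>_. ?x"] exI[of _ "\<lambda>_ ks. energy js * ?x ks"]) auto
  qed
  \<comment> \<open>As \<open>js\<close> has distinct entries, only the identity survives in this
    determinant of Kronecker deltas; the coefficient 1 shows that the eigenvector is not
    zero.\<close>
  have "hat K ?x js = slater (map (hat u) (map u js)) js"
    by (rule hat_slater[OF l2_u]) (auto intro: l2_u)
  also have "\<dots> = (\<Sum>p | p permutes {..<N}. of_int (sign p) * (\<Prod>i<N. if js ! p i = js ! i then 1 else 0))"
    using len by (simp add: slater_def orthonormal_inner[OF orthonormal_u])
  also have "\<dots> = (\<Sum>p | p permutes {..<N}. if p = id then 1 else 0)"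
  proof (intro sum.cong refl)
    fix p assume "p \<in> {p. p permutes {..<N}}"
    then have p: "p permutes {..<N}" by simp
    have "\<exists>i<N. js ! p i \<noteq> js ! i" if "p \<noteq> id"
    proof -
      obtain i where "p i \<noteq> i" using \<open>p \<noteq> id\<close> by (auto simp: fun_eq_iff)
      moreover from this have "i < N" using p by (auto simp: permutes_def)
      moreover from this have "p i < N" using permutes_in_image[OF p, of i] by simp
      ultimately show ?thesis using js(2) len nth_eq_iff_index_eq by metis
    qed
    then show "of_int (sign p) * (\<Prod>i<N. if js ! p i = js ! i then 1 else 0) = (if p = id then 1 else (0::complex))"
      by (auto intro!: prod_zero)
  qed
  also have "\<dots> = 1" using finite_permutations[of "{..<N}"] by (simp add: permutes_id)
  finally have "hat K ?x js = 1" .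
  then have "?x \<noteq> (\<lambda>_. 0)" by auto
  then have nx: "l2norm ?x > 0"
    using l2norm_eq_0D[OF lx] l2norm_nonneg[of ?x] by (auto simp: less_le fun_eq_iff)
  have "\<not> (\<exists>C. \<forall>(x, w)\<in>dGamma G N. l2norm x \<le> C * l2norm (\<lambda>k. w k - complex_of_real (sum ev J) * x k))"
  proof
    assume "\<exists>C. \<forall>(x, w)\<in>dGamma G N. l2norm x \<le> C * l2norm (\<lambda>k. w k - complex_of_real (sum ev J) * x k)"
    then obtain C where "\<forall>(x, w)\<in>dGamma G N. l2norm x \<le> C * l2norm (\<lambda>k. w k - complex_of_real (sum ev J) * x k)" ..
    from bspec[OF this pair] show False using nx ejs by simp
  qed
  then show "sum ev J \<in> {e::real. complex_of_real e \<in> op_spectrum (fermion_space N) (dGamma G N)}"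
    by (auto simp: op_spectrum_def)
next
  fix e :: real assume "e \<in> {e. complex_of_real e \<in> op_spectrum (fermion_space N) (dGamma G N)}"
  then have spec: "complex_of_real e \<in> op_spectrum (fermion_space N) (dGamma G N)" by simp
  show "sum ev J \<le> e"
  proof (rule ccontr)
    assume "\<not> sum ev J \<le> e"
    then have d: "sum ev J - e > 0" by simp
    have ge: "energy js \<ge> sum ev J" if "length js = N" "distinct js" for js
      using sum_le_sum_exchange[of J "set js" ev] that J gap
      by (simp add: energy_def sum_list_distinct_conv_sum_set distinct_card)
    have "l2norm x \<le> (1 / (sum ev J - e)) * l2norm (\<lambda>k. w k - complex_of_real e * x k)"
      if xw: "(x, w) \<in> dGamma G N" for x w
    proof -
      note h = dGamma_hat[OF xw]
      have lw: "l2 (\<lambda>k. w k - complex_of_real e * x k)" by (intro l2_diff l2_cmult h)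
      have hw: "hat K (\<lambda>k. w k - complex_of_real e * x k) js = complex_of_real (energy js - e) * hat K x js" for js
        using l2inner_diff_right[OF l2_K h(2) l2_cmult[OF h(1)], of js "complex_of_real e"] h(3)[of js]
        by (simp add: l2inner_cmult_right algebra_simps)
      have "(sum ev J - e) * l2norm x = l2norm (\<lambda>js. complex_of_real (sum ev J - e) * hat K x js)"
        using d unitary_hat(2)[OF unitary_K h(1)] by (simp add: l2norm_cmult del: of_real_diff of_real_sum)
      also have "\<dots> \<le> l2norm (hat K (\<lambda>k. w k - complex_of_real e * x k))"
      proof (rule l2norm_mono)
        show "l2 (hat K (\<lambda>k. w k - complex_of_real e * x k))"
          by (rule unitary_hat(1)[OF unitary_K lw])
        fix js
        show "cmod (complex_of_real (sum ev J - e) * hat K x js) \<le> cmod (hat K (\<lambda>k. w k - complex_of_real e * x k) js)"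
        proof (cases "length js = N \<and> distinct js")
          case True
          then have "\<bar>sum ev J - e\<bar> \<le> \<bar>energy js - e\<bar>" using ge[of js] d by auto
          then show ?thesis unfolding hw norm_mult norm_of_real by (rule mult_right_mono) simp
        next
          case False
          then show ?thesis using h(4) by simp
        qed
      qed
      also have "\<dots> = l2norm (\<lambda>k. w k - complex_of_real e * x k)"
        by (rule unitary_hat(2)[OF unitary_K lw])
      finally show ?thesis using d by (simp add: field_simps)
    qed
    then have bdd: "\<exists>C. \<forall>(x, w)\<in>dGamma G N. l2norm x \<le> C * l2norm (\<lambda>k. w k - complex_of_real e * x k)"
      by (intro exI[of _ "1 / (sum ev J - e)"]) auto
    have "\<exists>x. (x, \<lambda>k. y k + complex_of_real e * x k) \<in> dGamma G N" if y: "fermion_space N y" for y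
    proof -
      have ly: "l2 y" and y0: "\<And>ks. length ks \<noteq> N \<Longrightarrow> y ks = 0" using y by (auto simp: fermion_space_def)
      let ?y = "hat K y"
      have lhy: "l2 ?y" by (rule unitary_hat(1)[OF unitary_K ly])
      have anti: "?y (js[i := js ! j, j := js ! i]) = - ?y js" if "i < length js" "j < length js" "i \<noteq> j" for js i j
        by (rule hat_antisymmetric[OF y that])
      have len0: "?y js = 0" if "length js \<noteq> N" for js
      proof -
        have z: "cnj (K js ks) * y ks = 0" for ks
          using y0[of ks] that by (auto simp: list_kernel_eq)
        show ?thesis unfolding l2inner_def z by simp
      qed
      have y_zero: "?y js = 0" if "\<not> (length js = N \<and> distinct js)" for js
        using that len0 antisymmetric_not_distinct[of ?y js] anti by blast
      \<comment> \<open>On lists that are too short, too long or repetitive \<open>?y\<close>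
        vanishes, so \<open>c\<close> is 0 there even if the denominator is 0, and \<open>yc\<close>
        holds for every list.\<close>
      define c where "c js = ?y js / complex_of_real (energy js - e)" for js
      have yc: "?y js = complex_of_real (energy js - e) * c js" for js
        using y_zero[of js] ge[of js] d by (cases "length js = N \<and> distinct js") (auto simp: c_def)
      have lc: "l2 c"
      proof (rule l2_dominated[OF l2_cmult[OF lhy, of "complex_of_real (1 / (sum ev J - e))"]])
        fix js
        show "cmod (c js) \<le> cmod (complex_of_real (1 / (sum ev J - e)) * ?y js)"
        proof (cases "length js = N \<and> distinct js")
          case True
          then have "sum ev J - e \<le> energy js - e" using ge[of js] by simp
          then have "cmod (?y js) / (energy js - e) \<le> cmod (?y js) / (sum ev J - e)"
            using d by (intro divide_left_mono) auto
          then show ?thesis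
            using d \<open>sum ev J - e \<le> energy js - e\<close>
            by (simp add: c_def norm_divide norm_mult abs_of_pos del: of_real_diff of_real_divide of_real_sum)
        next
          case False
          then show ?thesis using y_zero by (simp add: c_def)
        qed
      qed
      have cperm: "c (permute_list p js) = of_int (sign p) * c js"
        and eperm: "energy (permute_list p js) = energy js"
        if "p permutes {..<N}" "length js = N" for p js
      proof -
        have "mset (permute_list p js) = mset js" using that by simp
        then have "sum_mset (image_mset ev (mset (permute_list p js))) = sum_mset (image_mset ev (mset js))" by simp
        then show e: "energy (permute_list p js) = energy js"
          unfolding energy_def by (simp only: sum_mset_sum_list[symmetric] mset_map)
        show "c (permute_list p js) = of_int (sign p) * c js"
          unfolding c_def e using antisymmetric_permute_list[of ?y p N js] anti that by simp
      qed
      define x where "x = synth K c"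
      have lx: "l2 x" unfolding x_def by (rule l2_synth(1)[OF orthonormal_K lc])
      have yx: "(\<lambda>k. y k + complex_of_real e * x k) = synth K (\<lambda>js. complex_of_real (energy js) * c js)"
      proof
        fix k
        have "(\<lambda>js. complex_of_real (energy js) * c js) = (\<lambda>js. ?y js + complex_of_real e * c js)"
          by (auto simp: yc algebra_simps)
        then have "synth K (\<lambda>js. complex_of_real (energy js) * c js) k = synth K ?y k + synth K (\<lambda>js. complex_of_real e * c js) k"
          using synth_add[OF orthonormal_K lhy l2_cmult[OF lc, of "complex_of_real e"], of k] by simp
        then show "y k + complex_of_real e * x k = synth K (\<lambda>js. complex_of_real (energy js) * c js) k"
          using unitary_hat(3)[OF unitary_K ly] synth_cmult[of K "complex_of_real e" c k] orthonormal_K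
          by (simp add: x_def)
      qed
      define b where "b js = complex_of_real (energy js) * c js" for js
      \<comment> \<open>The energies may be unbounded, but their product with \<open>c\<close> is
        the sum of two l2 families.\<close>
      have "b = (\<lambda>js. ?y js + complex_of_real e * c js)"
        by (auto simp: b_def yc algebra_simps)
      then have lb: "l2 b" using l2_add[OF lhy l2_cmult[OF lc]] by simp
      define A where "A n = {j::'j. to_nat j < n}" for n
      have finA: "finite (A n)" for n
        by (rule finite_imageD[of to_nat]) (auto simp: A_def intro: finite_subset[of _ "{..<n}"] inj_on_subset[OF inj_to_nat])
      \<comment> \<open>\<open>S\<close> indexes the truncations, all of length \<open>N\<close>,
        whereas the larger \<open>B\<close> exhausts all lists, as the limit along
        \<open>finite_subsets_at_top\<close> demands. They agree on families supported on length
        \<open>N\<close>; the bound \<open>n + N\<close> keeps \<open>B n\<close> finite and above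
        \<open>S n\<close>.\<close>
      define S where "S n = {js. set js \<subseteq> A n \<and> length js = N}" for n
      define B where "B n = {js. set js \<subseteq> A n \<and> length js \<le> n + N}" for n
      have finS: "finite (S n)" and finB: "finite (B n)" for n
        unfolding S_def B_def using finite_lists_length_eq[OF finA] finite_lists_length_le[OF finA] by auto
      have flim: "filterlim B (finite_subsets_at_top UNIV) sequentially"
        unfolding filterlim_finite_subsets_at_top
      proof (intro allI impI)
        fix T :: "'j list set" assume T: "finite T \<and> T \<subseteq> UNIV"
        have "\<forall>\<^sub>F n in sequentially. js \<in> B n" for js
        proof -
          have "finite (to_nat ` set js)" by simp
          then obtain m where m: "\<forall>i\<in>to_nat ` set js. i < m" using finite_nat_set_iff_bounded by blast
          have "js \<in> B n" if n: "max m (length js) \<le> n" for n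
          proof -
            have "to_nat j < n" if "j \<in> set js" for j using m that n by fastforce
            then show ?thesis using n by (auto simp: B_def A_def)
          qed
          then show ?thesis by (rule eventually_sequentiallyI)
        qed
        then have "\<forall>\<^sub>F n in sequentially. \<forall>js\<in>T. js \<in> B n"
          using T by (intro eventually_ball_finite) auto
        then show "\<forall>\<^sub>F n in sequentially. finite (B n) \<and> T \<subseteq> B n \<and> B n \<subseteq> UNIV"
          by eventually_elim (use finB in auto)
      qed
      have conv: "(\<lambda>n. l2norm (\<lambda>ks. (\<Sum>js\<in>S n. f js * K js ks) - synth K f ks)) \<longlonglongrightarrow> 0"
        if lf: "l2 f" and f0: "\<And>js. length js \<noteq> N \<Longrightarrow> f js = 0" for f
      proof -
        have "l2norm (\<lambda>ks. (\<Sum>js\<in>S n. f js * K js ks) - synth K f ks) = l2norm (\<lambda>js. if js \<in> B n then 0 else f js)" for n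
        proof -
          let ?t = "\<lambda>js. if js \<in> B n then 0 else f js" and ?s = "\<lambda>js. if js \<in> S n then f js else 0"
          have lt: "l2 ?t" and ls: "l2 ?s" by (auto intro: l2_dominated[OF lf])
          have "(\<Sum>js\<in>S n. f js * K js ks) = synth K ?s ks" for ks
            by (subst synth_finite_support[OF orthonormal_K finS[of n]]) (auto intro: sum.cong)
          then have "(\<Sum>js\<in>S n. f js * K js ks) - synth K f ks = synth K (\<lambda>js. ?s js - f js) ks" for ks
            using synth_diff[OF orthonormal_K ls lf, of ks] by simp
          moreover have "(\<lambda>js. ?s js - f js) = (\<lambda>js. (-1) * ?t js)"
            using f0 by (auto simp: S_def B_def)
          ultimately have "(\<lambda>ks. (\<Sum>js\<in>S n. f js * K js ks) - synth K f ks) = synth K (\<lambda>js. (-1) * ?t js)" by auto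
          then show ?thesis
            using l2_synth(2)[OF orthonormal_K l2_cmult[OF lt, of "-1"]] l2norm_cmult[of "-1" ?t] by simp
        qed
        then show ?thesis
          using filterlim_compose[OF l2norm_tail_tendsto_0[OF lf] flim] by simp
      qed
      have c0: "c js = 0" "b js = 0" if "length js \<noteq> N" for js
        using y_zero that by (auto simp: c_def b_def)
      let ?X = "\<lambda>n ks. \<Sum>js\<in>S n. c js / fact N * fst (slater (map u js), \<lambda>ks. energy js * slater (map u js) ks) ks"
      let ?Y = "\<lambda>n ks. \<Sum>js\<in>S n. c js / fact N * snd (slater (map u js), \<lambda>ks. energy js * slater (map u js) ks) ks"
      have XY: "(?X n, ?Y n) \<in> pre_dGamma G N" for n
        by (rule pre_dGamma_sum[OF finS]) (use elem_pairs_eigen in \<open>auto simp: S_def\<close>)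
      have X: "?X n ks = (\<Sum>js\<in>S n. c js * K js ks)" for n ks
        using sum_antisymmetric_slater[OF finA[of n], of N c u ks] cperm by (simp add: S_def)
      have Y: "?Y n ks = (\<Sum>js\<in>S n. b js * K js ks)" for n ks
        using sum_antisymmetric_slater[OF finA[of n], of N b u ks] cperm eperm
        by (simp add: S_def b_def mult_ac)
      have Xlim: "(\<lambda>n. l2norm (\<lambda>ks. ?X n ks - x ks)) \<longlonglongrightarrow> 0"
        unfolding X x_def by (rule conv[OF lc c0(1)])
      have Ylim: "(\<lambda>n. l2norm (\<lambda>ks. ?Y n ks - synth K b ks)) \<longlonglongrightarrow> 0"
        unfolding Y by (rule conv[OF lb c0(2)])
      have "\<exists>X Y. (\<forall>n. (X n, Y n) \<in> pre_dGamma G N)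
          \<and> (\<lambda>n. l2norm (\<lambda>ks. X n ks - x ks)) \<longlonglongrightarrow> 0
          \<and> (\<lambda>n. l2norm (\<lambda>ks. Y n ks - synth K b ks)) \<longlonglongrightarrow> 0"
        by (rule exI[of _ ?X], rule exI[of _ ?Y]) (intro conjI allI XY Xlim Ylim)
      then have "(x, synth K b) \<in> dGamma G N"
        unfolding dGamma_def using lx l2_synth(1)[OF orthonormal_K lb] by blast
      then show ?thesis using yx by (intro exI[of _ x]) (simp add: b_def[abs_def])
    qed
    with bdd have "complex_of_real e \<notin> op_spectrum (fermion_space N) (dGamma G N)"
      by (auto simp: op_spectrum_def)
    with spec show False by simp
  qed
qed

end

section \<open>The momentum lattice\<close>

lemma ksq_nonneg [simp]: "0 \<le> ksq L n"
  by (simp add: ksq_def)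

lemma ksq_zero [simp]: "ksq L (0, 0) = 0"
  by (simp add: ksq_def)

lemma summable_on_int_inverse_quadratic: "(\<lambda>a::int. 1 / (1 + (of_int a)^2 :: real)) summable_on UNIV"
proof -
  let ?f = "\<lambda>a::int. 1 / (1 + (of_int a)^2 :: real)"
  have "summable (\<lambda>n. 1 / (1 + (real n)^2))"
  proof (rule summable_comparison_test_ev)
    show "summable (\<lambda>n. 1 / (real n)^2)"
      using inverse_power_summable[of 2, where 'a = real] by (simp add: inverse_eq_divide)
    show "\<forall>\<^sub>F n in sequentially. norm (1 / (1 + (real n)\<^sup>2)) \<le> 1 / (real n)^2"
      using eventually_gt_at_top[of 0] by eventually_elim (auto intro!: frac_le simp: add_nonneg_nonneg)
  qed
  then have n: "(\<lambda>n. 1 / (1 + (real n)^2)) summable_on UNIV"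
    by (intro summable_nonneg_imp_summable_on) auto
  have p: "?f summable_on (range int)"
    using n summable_on_reindex[of int UNIV ?f] by (simp add: o_def inj_on_def)
  have m: "?f summable_on (range (\<lambda>n. - int n))"
    using n summable_on_reindex[of "\<lambda>n. - int n" UNIV ?f] by (simp add: o_def inj_on_def)
  have "(UNIV :: int set) = range int \<union> range (\<lambda>n. - int n)"
    by (auto simp: image_iff) (metis int_cases2)
  then show ?thesis using summable_on_union[OF p m] by simp
qed

text \<open>The square of 1 + x^2 + y^2 dominates (1 + x^2)(1 + y^2), which reduces the claim to a
  product of one-dimensional sums.\<close>

lemma summable_on_lattice: "(\<lambda>n. 1 / (1 + ((of_int (fst n))^2 + (of_int (snd n))^2 :: real))^2) summable_on (UNIV :: (int \<times> int) set)"
proof -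
  let ?f = "\<lambda>a::int. 1 / (1 + (of_int a)^2 :: real)"
  have "(\<lambda>n. ?f (fst n) * ?f (snd n)) summable_on (UNIV \<times> UNIV :: (int \<times> int) set)"
  proof (rule summable_on_SigmaI)
    show "((\<lambda>b. ?f (fst (a, b)) * ?f (snd (a, b))) has_sum (?f a * infsum ?f UNIV)) UNIV" for a
      using has_sum_cmult_right[OF has_sum_infsum[OF summable_on_int_inverse_quadratic], of "?f a"] by simp
    show "(\<lambda>a. ?f a * infsum ?f UNIV) summable_on UNIV"
      by (rule summable_on_cmult_left[OF summable_on_int_inverse_quadratic])
  qed auto
  then have s: "(\<lambda>n. ?f (fst n) * ?f (snd n)) summable_on (UNIV :: (int \<times> int) set)" by simp
  have bd: "1 / (1 + (x^2 + y^2))^2 \<le> 1 / (1 + x^2) * (1 / (1 + y^2))" for x y :: real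
  proof -
    have "(1 + x^2) * (1 + y^2) \<le> (1 + (x^2 + y^2)) * (1 + (x^2 + y^2))"
      by (intro mult_mono) auto
    moreover have "0 < (1 + x^2) * (1 + y^2)" by (intro mult_pos_pos) (auto intro: add_pos_nonneg)
    ultimately show ?thesis by (simp add: power2_eq_square[of "1 + (_ + _)"] frac_le)
  qed
  show ?thesis
    by (rule summable_on_comparison_test[OF s]) (use bd in auto)
qed

lemma finite_lattice_disc: "finite {n :: int \<times> int. (of_int (fst n))^2 + (of_int (snd n))^2 \<le> (t::real)}"
proof (rule finite_subset)
  show "{n. (of_int (fst n))^2 + (of_int (snd n))^2 \<le> (t::real)} \<subseteq> {-\<lceil>t\<rceil>..\<lceil>t\<rceil>} \<times> {-\<lceil>t\<rceil>..\<lceil>t\<rceil>}"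
  proof (clarify, goal_cases)
    case (1 a b)
    have ab: "\<bar>x\<bar> \<le> \<lceil>t\<rceil>" if "(of_int x)^2 \<le> (t::real)" for x :: int
    proof -
      have "\<bar>x\<bar> * 1 \<le> \<bar>x\<bar> * \<bar>x\<bar>"
      proof (cases "x = 0")
        case False
        then show ?thesis by (intro mult_left_mono) linarith+
      qed simp
      then have "real_of_int \<bar>x\<bar> \<le> real_of_int (\<bar>x\<bar> * \<bar>x\<bar>)" by linarith
      also have "\<dots> = (of_int x)^2" by (simp add: power2_eq_square abs_mult[symmetric])
      finally show ?thesis using that by linarith
    qed
    have "(of_int a)^2 \<le> t" "(of_int b)^2 \<le> t"
      using 1 zero_le_power2[of "real_of_int a"] zero_le_power2[of "real_of_int b"] unfolding fst_conv snd_conv by linarith+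
    from ab[OF this(1)] ab[OF this(2)] show ?case by auto
  qed
qed simp

locale point_interaction =
  fixes L EB :: real
  assumes L_pos: "L > 0" and EB_neg: "EB < 0"
begin

abbreviation e :: "int \<times> int \<Rightarrow> real" where "e \<equiv> ksq L"

section \<open>Finiteness of sublevel sets and decay of the resolvent kernel\<close>

lemma finite_sublevel: "finite {n. e n \<le> t}"
proof -
  have "e n \<le> t \<longleftrightarrow> (of_int (fst n))^2 + (of_int (snd n))^2 \<le> t / (2 * pi / L)^2" for n
    using L_pos by (simp add: ksq_def field_simps)
  then show ?thesis using finite_lattice_disc by simp
qed

lemma finite_level: "finite {n. e n = s}"
  by (rule finite_subset[OF _ finite_sublevel[of s]]) auto

lemma finite_levels_le: "finite {s \<in> range e. s \<le> t}"
  by (rule finite_subset[OF _ finite_imageI[OF finite_sublevel[of t], of e]]) auto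

lemma ex_large: "\<exists>n. e n > t"
proof -
  have "\<not> finite (UNIV :: (int \<times> int) set)" by (simp add: finite_prod)
  then have "{n. e n \<le> t} \<noteq> UNIV" using finite_sublevel[of t] by auto
  then obtain n where "\<not> e n \<le> t" by blast
  then show ?thesis by (intro exI[of _ n]) simp
qed

lemma summable_base: "(\<lambda>n. 1 / (1 + e n)^2) summable_on UNIV"
proof -
  define c where "c = min 1 ((2 * pi / L)^2)"
  have c: "0 < c" "c \<le> 1" "c \<le> (2 * pi / L)^2" using L_pos by (auto simp: c_def)
  have s: "(\<lambda>n. 1 / c^2 * (1 / (1 + ((of_int (fst n))^2 + (of_int (snd n))^2 :: real))^2)) summable_on (UNIV :: (int \<times> int) set)"
    by (rule summable_on_cmult_right[OF summable_on_lattice])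
  show ?thesis
  proof (rule summable_on_comparison_test[OF s])
    fix n :: "int \<times> int"
    let ?q = "(of_int (fst n))^2 + (of_int (snd n))^2 :: real"
    have q: "0 \<le> ?q" by simp
    have "c * ?q \<le> e n" unfolding ksq_def by (rule mult_right_mono[OF c(3) q])
    then have "c * (1 + ?q) \<le> 1 + e n"
      unfolding distrib_left[of c 1] using c by linarith
    then have "(c * (1 + ?q))^2 \<le> (1 + e n)^2" using c q by (intro power_mono) auto
    moreover have "0 < (c * (1 + ?q))^2" using c q by (intro zero_less_power mult_pos_pos) linarith+
    ultimately have "1 / (1 + e n)^2 \<le> 1 / (c * (1 + ?q))^2" by (intro frac_le) auto
    then show "1 / (1 + e n)^2 \<le> 1 / c^2 * (1 / (1 + ?q)^2)" by (simp add: power_mult_distrib)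
  qed auto
qed

text \<open>Beyond 2|z| + 1 the distance from a level to z is at least half of 1 + e; the finitely
  many other modes go into the constant. If z is itself a level, the entries there are 1/0 = 0, so
  no z is excluded.\<close>

lemma gam_bound: "\<exists>C. \<forall>n. cmod (gam L z n) \<le> C / (1 + e n)"
proof -
  define A where "A = {n. e n \<le> 2 * cmod z + 1}"
  define C where "C = 2 + (\<Sum>n\<in>A. cmod (gam L z n) * (1 + e n))"
  have fA: "finite A" using finite_sublevel by (simp add: A_def)
  have "cmod (gam L z n) * (1 + e n) \<le> C" for n
  proof (cases "n \<in> A")
    case True
    then have "cmod (gam L z n) * (1 + e n) \<le> (\<Sum>n\<in>A. cmod (gam L z n) * (1 + e n))"
      by (intro member_le_sum) (use fA in \<open>auto simp: add_nonneg_nonneg\<close>)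
    then show ?thesis by (simp add: C_def)
  next
    case False
    then have n: "e n > 2 * cmod z + 1" by (simp add: A_def)
    have "e n - cmod z \<le> cmod (complex_of_real (e n) - z)"
      using norm_triangle_ineq2[of "complex_of_real (e n)" z] by simp
    then have d: "(1 + e n) / 2 \<le> cmod (complex_of_real (e n) - z)" using n by simp
    have e0: "0 < 1 + e n" using ksq_nonneg[of L n] by linarith
    have "cmod (gam L z n) * (1 + e n) = (1 + e n) / cmod (complex_of_real (e n) - z)"
      by (simp add: gam_def norm_divide)
    also have "\<dots> \<le> (1 + e n) / ((1 + e n) / 2)"
      using d e0 by (intro divide_left_mono mult_pos_pos) auto
    also have "\<dots> = 2" using e0 by (simp add: field_simps)
    also have "\<dots> \<le> C" unfolding C_def by (simp add: sum_nonneg add_nonneg_nonneg)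
    finally show ?thesis .
  qed
  then show ?thesis using ksq_nonneg[of L]
    by (intro exI[of _ C]) (auto simp: pos_le_divide_eq add_pos_nonneg)
qed

lemma l2_gam: "l2 (gam L z)"
proof -
  obtain C where C: "\<And>n. cmod (gam L z n) \<le> C / (1 + e n)" using gam_bound by blast
  show ?thesis unfolding l2_def
  proof (rule summable_on_comparison_test[OF summable_on_cmult_right[OF summable_base, of "C^2"]])
    fix n
    have "(cmod (gam L z n))^2 \<le> (C / (1 + e n))^2" using C[of n] by (intro power_mono) auto
    then show "(cmod (gam L z n))^2 \<le> C^2 * (1 / (1 + e n)^2)" by (simp add: power_divide)
  qed auto
qed

definition r :: "real \<Rightarrow> int \<times> int \<Rightarrow> real" where "r x n = 1 / (e n - x)"

lemma gam_real: "gam L (complex_of_real x) n = complex_of_real (r x n)"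
  by (simp add: gam_def r_def)

lemma summable_r_prod: "(\<lambda>n. r x n * r y n) summable_on A"
proof -
  have "(\<lambda>n. gam L (complex_of_real x) n * gam L (complex_of_real y) n) summable_on UNIV"
    by (rule l2_mult_summable[OF l2_gam l2_gam])
  then have "(\<lambda>n. Re (gam L (complex_of_real x) n * gam L (complex_of_real y) n)) summable_on UNIV"
    by (rule summable_on_Re)
  then have "(\<lambda>n. r x n * r y n) summable_on UNIV" by (simp add: gam_real)
  then show ?thesis using summable_on_subset_banach by blast
qed

lemma r_diff: "e n \<noteq> x \<Longrightarrow> e n \<noteq> y \<Longrightarrow> r x n - r y n = (x - y) * (r x n * r y n)"
  by (simp add: r_def divide_simps)

text \<open>The denominator of the resolvent and its two pieces: \<open>P\<close> collects the modes below \<open>t\<close>,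
  while \<open>g t x / L\<^sup>2\<close> is the function \<open>G\<close> of the polaron equation at \<open>-x\<close>.\<close>

definition F :: "real \<Rightarrow> real" where
  "F x = infsum (\<lambda>n. r EB n - r x n) UNIV"

definition g :: "real \<Rightarrow> real \<Rightarrow> real" where
  "g t x = infsum (\<lambda>n. r EB n - (if e n > t then r x n else 0)) UNIV"

definition P :: "real \<Rightarrow> real \<Rightarrow> real" where
  "P t x = (\<Sum>n | e n \<le> t. r x n)"

lemma e_neq_EB: "e n \<noteq> EB"
  using ksq_nonneg[of L n] EB_neg by linarith

text \<open>Outside a finite set the resolvent identity turns the difference into a multiple of a
  product of two l2 families. In two dimensions each of the two sums alone would diverge
  logarithmically.\<close>

lemma summable_tail_diff:
  "(\<lambda>n. r EB n - (if e n > t then r x n else 0)) summable_on UNIV"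
proof -
  define A where "A = {n. e n \<le> max t x}"
  have fA: "finite A" using finite_sublevel by (simp add: A_def)
  have "(\<lambda>n. (EB - x) * (r EB n * r x n)) summable_on (-A)"
    by (intro summable_on_cmult_right summable_r_prod)
  moreover have "(EB - x) * (r EB n * r x n) = r EB n - (if e n > t then r x n else 0)" if "n \<in> -A" for n
    using that r_diff[OF e_neq_EB, of n x] by (auto simp: A_def)
  ultimately have "(\<lambda>n. r EB n - (if e n > t then r x n else 0)) summable_on (-A)"
    by (subst (asm) summable_on_cong) assumption+
  then have "(\<lambda>n. r EB n - (if e n > t then r x n else 0)) summable_on (A \<union> -A)"
    by (rule summable_on_union[OF summable_on_finite[OF fA]])
  then show ?thesis by simp
qed

lemma summable_diff: "(\<lambda>n. r EB n - r x n) summable_on UNIV"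
  using summable_tail_diff[of "-1" x] ksq_nonneg[of L]
  by (simp add: less_le_trans[of "-1" 0])

lemma has_sum_P: "((\<lambda>n. if e n \<le> t then r x n else 0) has_sum P t x) UNIV"
proof -
  have "((\<lambda>n. r x n) has_sum P t x) {n. e n \<le> t}"
    unfolding P_def by (rule has_sum_finite[OF finite_sublevel])
  then show ?thesis
    by (subst (asm) has_sum_cong_neutral[where T = UNIV and g = "\<lambda>n. if e n \<le> t then r x n else 0"]) auto
qed

lemma F_eq: "F x = g t x - P t x"
proof -
  have "((\<lambda>n. (r EB n - (if e n > t then r x n else 0)) + - (if e n \<le> t then r x n else 0)) has_sum (g t x + - P t x)) UNIV"
    unfolding g_def by (intro has_sum_add has_sum_uminusI has_sum_P has_sum_infsum summable_tail_diff)
  moreover have "(\<lambda>n. (r EB n - (if e n > t then r x n else 0)) + - (if e n \<le> t then r x n else 0)) = (\<lambda>n. r EB n - r x n)"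
    by auto
  ultimately show ?thesis unfolding F_def using infsumI by fastforce
qed

lemma g_diff:
  assumes "x \<le> t" "y \<le> t"
  shows "g t x - g t y = (y - x) * infsum (\<lambda>n. r x n * r y n) {n. e n > t}"
proof -
  have "((\<lambda>n. (r EB n - (if e n > t then r x n else 0)) + - (r EB n - (if e n > t then r y n else 0))) has_sum (g t x + - g t y)) UNIV"
    unfolding g_def by (intro has_sum_add has_sum_uminusI has_sum_infsum summable_tail_diff)
  moreover have "((\<lambda>n. (y - x) * (r x n * r y n)) has_sum ((y - x) * infsum (\<lambda>n. r x n * r y n) {n. e n > t})) {n. e n > t}"
    by (intro has_sum_cmult_right has_sum_infsum summable_r_prod)
  moreover have "((\<lambda>n. (y - x) * (r x n * r y n)) has_sum S) {n. e n > t} \<longleftrightarrow>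
     ((\<lambda>n. (r EB n - (if e n > t then r x n else 0)) + - (r EB n - (if e n > t then r y n else 0))) has_sum S) UNIV" for S
    by (rule has_sum_cong_neutral) (use assms r_diff[of _ y x] in \<open>auto simp: mult.commute\<close>)
  ultimately show ?thesis using has_sum_unique by fastforce
qed

lemma r_pos: "x < e n \<Longrightarrow> 0 < r x n"
  by (simp add: r_def)

lemma g_antimono:
  assumes "x \<le> y" "y \<le> t" shows "g t y \<le> g t x"
proof -
  have "0 \<le> infsum (\<lambda>n. r x n * r y n) {n. e n > t}"
    using assms by (intro infsum_nonneg mult_nonneg_nonneg less_imp_le[OF r_pos]) auto
  then have "0 \<le> (y - x) * infsum (\<lambda>n. r x n * r y n) {n. e n > t}"
    using assms by (intro mult_nonneg_nonneg) auto
  then show ?thesis using g_diff[of x t y] assms by linarith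
qed

text \<open>Only modes strictly above \<open>t\<close> depend on the argument, so the Lipschitz
  constant, the sum of their squared resolvent entries at \<open>t\<close>, is finite and continuity
  includes the endpoint.\<close>

lemma continuous_g: "continuous_on {..t} (g t)"
proof -
  define M where "M = infsum (\<lambda>n. r t n * r t n) {n. e n > t}"
  have "dist (g t x) (g t y) \<le> M * dist x y" if "x \<le> t" "y \<le> t" for x y
  proof -
    have "\<bar>infsum (\<lambda>n. r x n * r y n) {n. e n > t}\<bar> \<le> M"
    proof -
      have "0 \<le> infsum (\<lambda>n. r x n * r y n) {n. e n > t}"
        using that by (intro infsum_nonneg mult_nonneg_nonneg less_imp_le[OF r_pos]) auto
      moreover have "infsum (\<lambda>n. r x n * r y n) {n. e n > t} \<le> M"
        unfolding M_def using that
        by (intro infsum_mono summable_r_prod mult_mono) (auto simp: r_def intro!: frac_le)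
      ultimately show ?thesis by simp
    qed
    then show ?thesis
      unfolding dist_real_def g_diff[OF that] abs_mult abs_minus_commute[of x y]
      by (subst mult.commute) (rule mult_right_mono, simp_all)
  qed
  then have "M-lipschitz_on {..t} (g t)"
    by (intro lipschitz_onI) (auto simp: M_def intro!: infsum_nonneg)
  then show ?thesis by (rule lipschitz_on_continuous_on)
qed

lemma Gmu_eq: "Gmu L EB \<mu> \<tau> = g \<mu> (- \<tau>) / L^2"
proof -
  have "1 / (ksq L n - EB) - (if \<mu> < ksq L n then 1 / (ksq L n + \<tau>) else 0) = r EB n - (if e n > \<mu> then r (- \<tau>) n else 0)" for n
    by (simp add: r_def)
  then show ?thesis by (simp add: Gmu_def g_def)
qed

lemma zero_level: "0 \<in> range e"
  by (rule range_eqI[of _ _ "(0, 0)"]) simp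

lemma level_nonneg: "s \<in> range e \<Longrightarrow> 0 \<le> s"
  by auto

subsection \<open>Roots between consecutive levels\<close>

text \<open>For a level \<open>s\<close>, the open interval between the preceding level and
  \<open>s\<close>, described without naming the former; for \<open>s = 0\<close> it is the negative
  half-line.\<close>

definition gap :: "real \<Rightarrow> real \<Rightarrow> bool" where
  "gap s x \<longleftrightarrow> x < s \<and> (\<forall>n. e n < s \<longrightarrow> e n < x)"

lemma gapD: assumes "gap s x" shows "x < s" "e n < s \<Longrightarrow> e n < x" "\<not> e n < s \<Longrightarrow> x < e n"
  using assms less_le_trans[of x s "e n"] unfolding gap_def not_less by blast+

lemma gap_not_level: "gap s x \<Longrightarrow> e n \<noteq> x"
  using gapD(2)[of s x n] gapD(3)[of s x n] by fastforce

lemma gap_convex: "gap s x \<Longrightarrow> gap s y \<Longrightarrow> x \<le> w \<Longrightarrow> w \<le> y \<Longrightarrow> gap s w"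
  unfolding gap_def by (meson le_less_trans less_le_trans)

text \<open>Inside a gap no pole is crossed, and on either side of its pole each term increases with
  the spectral parameter.\<close>

lemma r_mono_gap:
  assumes "gap s x" "gap s y" "x \<le> y" shows "r x n \<le> r y n"
proof (cases "e n < s")
  case True
  then have "e n < x" "e n < y" using assms(1,2)[THEN gapD(2)] by auto
  then have "1 / (y - e n) \<le> 1 / (x - e n)" using assms by (intro frac_le) auto
  moreover have "r z n = - (1 / (z - e n))" for z
    unfolding r_def using minus_divide_right[of 1 "z - e n"] by simp
  ultimately show ?thesis by simp
next
  case False
  then have "x < e n" "y < e n" using assms(1,2)[THEN gapD(3)] by auto
  then show ?thesis using assms by (auto simp: r_def intro!: frac_le)
qed

lemma r_strict_mono_gap:
  assumes "gap s x" "gap s y" "x < y" shows "r x n < r y n"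
proof -
  have "r x n \<noteq> r y n"
    using gap_not_level[OF assms(1), of n] gap_not_level[OF assms(2), of n] assms(3) by (auto simp: r_def)
  then show ?thesis using r_mono_gap[OF assms(1,2), of n] assms(3) by simp
qed

lemma P_strict_mono:
  assumes "gap s x" "gap s y" "x < y" "0 \<le> t" shows "P t x < P t y"
  unfolding P_def
proof (rule sum_strict_mono[OF finite_sublevel])
  have "(0, 0) \<in> {n. e n \<le> t}" using assms(4) by simp
  then show "{n. e n \<le> t} \<noteq> {}" by blast
qed (rule r_strict_mono_gap[OF assms(1-3)])

lemma F_strict_antimono:
  assumes "gap s x" "gap s y" "x < y" shows "F y < F x"
proof -
  define t where "t = max s 0"
  have "x \<le> t" "y \<le> t" using assms by (auto simp: gap_def t_def)
  then show ?thesis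
    using F_eq[of x t] F_eq[of y t] g_antimono[of x y t] P_strict_mono[OF assms, of t] assms by (auto simp: t_def)
qed

lemma continuous_r:
  assumes "\<And>x. x \<in> S \<Longrightarrow> e n \<noteq> x" shows "continuous_on S (\<lambda>x. r x n)"
  unfolding r_def using assms by (intro continuous_intros) auto

lemma continuous_P: "continuous_on {x. gap s x} (P t)"
  unfolding P_def by (intro continuous_on_sum continuous_r) (use gap_not_level in auto)

lemma eventually_gap_left: 
  assumes "s \<in> range e" shows "\<forall>\<^sub>F x in at_left s. gap s x"
proof -
  have "finite {n. e n < s}" by (rule finite_subset[OF _ finite_sublevel[of s]]) auto
  then have "\<forall>\<^sub>F x in at_left s. \<forall>n\<in>{n. e n < s}. e n < x"
    by (intro eventually_ball_finite ballI) (auto simp: eventually_at_left_field)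
  moreover have "\<forall>\<^sub>F x in at_left s. x < s"
    by (simp add: eventually_at_filter)
  ultimately show ?thesis by eventually_elim (auto simp: gap_def)
qed

lemma P_at_left:
  assumes "s \<in> range e" "s \<le> t" shows "filterlim (P t) at_top (at_left s)"
proof -
  let ?A = "{n. e n \<le> t \<and> e n \<noteq> s}" and ?B = "{n. e n = s}"
  have fin: "finite ?A" "finite ?B" using finite_subset[OF _ finite_sublevel[of t], of ?A] finite_level by auto
  have split: "P t x = (\<Sum>n\<in>?A. r x n) + (\<Sum>n\<in>?B. r x n)" for x
  proof -
    have "{n. e n \<le> t} = ?A \<union> ?B" using assms by auto
    then show ?thesis unfolding P_def using fin by (simp add: sum.union_disjoint disjoint_iff)
  qed
  have "((\<lambda>x. \<Sum>n\<in>?A. r x n) \<longlongrightarrow> (\<Sum>n\<in>?A. r s n)) (at_left s)"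
    unfolding r_def by (intro tendsto_intros) auto
  moreover have "filterlim (\<lambda>x. \<Sum>n\<in>?B. r x n) at_top (at_left s)"
  proof -
    have c: "card ?B > 0" using assms fin by (auto simp: card_gt_0_iff)
    have "filterlim (\<lambda>x. inverse (s - x)) at_top (at_left s)"
      by (intro filterlim_inverse_at_top) (auto intro!: tendsto_eq_intros simp: eventually_at_filter)
    then have "filterlim (\<lambda>x. real (card ?B) * inverse (s - x)) at_top (at_left s)"
      by (intro filterlim_tendsto_pos_mult_at_top[OF tendsto_const]) (use c in auto)
    moreover have "(\<Sum>n\<in>?B. r x n) = real (card ?B) * inverse (s - x)" for x
      by (simp add: r_def inverse_eq_divide)
    ultimately show ?thesis by simp
  qed
  ultimately show ?thesis unfolding split by (intro filterlim_tendsto_add_at_top)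
qed

lemma P_at_right:
  assumes "s \<in> range e" "s \<le> t" shows "filterlim (P t) at_bot (at_right s)"
proof -
  let ?A = "{n. e n \<le> t \<and> e n \<noteq> s}" and ?B = "{n. e n = s}"
  have fin: "finite ?A" "finite ?B" using finite_subset[OF _ finite_sublevel[of t], of ?A] finite_level by auto
  have split: "- P t x = (\<Sum>n\<in>?A. - r x n) + (\<Sum>n\<in>?B. - r x n)" for x
  proof -
    have "{n. e n \<le> t} = ?A \<union> ?B" using assms by auto
    then show ?thesis unfolding P_def using fin by (simp add: sum.union_disjoint disjoint_iff sum_negf)
  qed
  have "((\<lambda>x. \<Sum>n\<in>?A. - r x n) \<longlongrightarrow> (\<Sum>n\<in>?A. - r s n)) (at_right s)"
    unfolding r_def by (intro tendsto_intros) auto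
  moreover have "filterlim (\<lambda>x. \<Sum>n\<in>?B. - r x n) at_top (at_right s)"
  proof -
    have c: "card ?B > 0" using assms fin by (auto simp: card_gt_0_iff)
    have "filterlim (\<lambda>x. inverse (x - s)) at_top (at_right s)"
      by (intro filterlim_inverse_at_top) (auto intro!: tendsto_eq_intros simp: eventually_at_filter)
    then have "filterlim (\<lambda>x. real (card ?B) * inverse (x - s)) at_top (at_right s)"
      by (intro filterlim_tendsto_pos_mult_at_top[OF tendsto_const]) (use c in auto)
    moreover have "(\<Sum>n\<in>?B. - r x n) = real (card ?B) * inverse (x - s)" for x
      by (simp add: r_def inverse_eq_divide minus_divide_right)
    ultimately show ?thesis by simp
  qed
  ultimately have "filterlim (\<lambda>x. - P t x) at_top (at_right s)"
    unfolding split by (intro filterlim_tendsto_add_at_top)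
  then show ?thesis by (simp add: filterlim_uminus_at_top)
qed

text \<open>\<open>P\<close> rises from below \<open>H\<close> to infinity at the pole
  \<open>s\<close>, while \<open>H\<close> is bounded and decreasing, so they meet. It is used with
  \<open>H = g\<close> for the eigenvalues and with constant \<open>H\<close> for the comparison
  roots.\<close>

lemma root_exists:
  assumes s: "s \<in> range e" "s \<le> t"
    and H: "continuous_on {x. gap s x} H" "\<And>x. gap s x \<Longrightarrow> H x \<le> M"
      "\<And>x y. gap s x \<Longrightarrow> gap s y \<Longrightarrow> x \<le> y \<Longrightarrow> H y \<le> H x"
    and low: "\<exists>x. gap s x \<and> P t x < H x"
  shows "\<exists>x. gap s x \<and> P t x = H x"
proof -
  obtain x0 where x0: "gap s x0" "P t x0 < H x0" using low by blast
  have "\<forall>\<^sub>F x in at_left s. M < P t x"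
    using P_at_left[OF s] by (simp add: filterlim_at_top_dense)
  then have "\<forall>\<^sub>F x in at_left s. gap s x \<and> M < P t x"
    using eventually_gap_left[OF s(1)] by eventually_elim auto
  then obtain x1 where x1: "gap s x1" "M < P t x1"
    using eventually_happens[of _ "at_left s"] trivial_limit_at_left_real[of s] by auto
  have t0: "0 \<le> t" using s ksq_nonneg order_trans by blast
  have lt: "x0 \<le> x1"
  proof (rule ccontr)
    assume "\<not> x0 \<le> x1"
    then have "P t x1 < P t x0" "H x0 \<le> H x1"
      using P_strict_mono[OF x1(1) x0(1) _ t0] H(3)[OF x1(1) x0(1)] by auto
    then show False using x0 x1 H(2)[OF x1(1)] by linarith
  qed
  have sub: "{x0..x1} \<subseteq> {x. gap s x}" using gap_convex[OF x0(1) x1(1)] by auto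
  have "\<exists>x\<ge>x0. x \<le> x1 \<and> P t x - H x = 0"
    by (rule IVT') (use x0 x1 lt H(2)[OF x1(1)] in \<open>auto intro!: continuous_intros
        continuous_on_subset[OF continuous_P sub] continuous_on_subset[OF H(1) sub]\<close>)
  then show ?thesis using gap_convex[OF x0(1) x1(1)] by auto
qed

text \<open>A positive level has a predecessor \<open>p\<close>, and just to the right of its pole
  \<open>P\<close> is arbitrarily negative.\<close>

lemma lower_point:
  assumes s: "s \<in> range e" "s > 0" "s \<le> t" shows "\<exists>x. gap s x \<and> P t x < m"
proof -
  define p where "p = Max {y \<in> range e. y < s}"
  have fin: "finite {y \<in> range e. y < s}"
    by (rule finite_subset[OF _ finite_levels_le[of s]]) auto
  have ne: "{y \<in> range e. y < s} \<noteq> {}"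
    using s(2) zero_level by blast
  have p: "p \<in> range e" "p < s" using Max_in[OF fin ne] by (auto simp: p_def)
  have pm: "e n \<le> p" if "e n < s" for n using Max_ge[OF fin, of "e n"] that by (auto simp: p_def)
  have "\<forall>\<^sub>F x in at_right p. P t x < m"
    using P_at_right[OF p(1), of t] p s by (simp add: filterlim_at_bot_dense)
  moreover have "\<forall>\<^sub>F x in at_right p. p < x \<and> x < s"
    using p by (auto simp: eventually_at_right_field)
  ultimately have "\<forall>\<^sub>F x in at_right p. gap s x \<and> P t x < m"
    by eventually_elim (use pm le_less_trans in \<open>unfold gap_def, blast\<close>)
  then show ?thesis using eventually_happens[of _ "at_right p"] trivial_limit_at_right_real[of p] by auto
qed

lemma gap_unique_root: "gap s x \<Longrightarrow> gap s y \<Longrightarrow> F x = 0 \<Longrightarrow> F y = 0 \<Longrightarrow> x = y"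
  using F_strict_antimono[of s x y] F_strict_antimono[of s y x] by (cases x y rule: linorder_cases) auto

definition lam :: "real \<Rightarrow> real" where "lam s = (SOME x. gap s x \<and> F x = 0)"

lemma gap_zero: "gap 0 x \<longleftrightarrow> x < 0"
  unfolding gap_def using ksq_nonneg[of L] by (meson not_less)

lemma F_EB: "F EB = 0"
  by (simp add: F_def)

lemma lam:
  assumes "s \<in> range e" shows "gap s (lam s)" "F (lam s) = 0"
proof -
  have "\<exists>x. gap s x \<and> F x = 0"
  proof (cases "s = 0")
    case True
    then show ?thesis using F_EB EB_neg gap_zero by (intro exI[of _ EB]) simp
  next
    case False
    then have s0: "s > 0" using level_nonneg[OF assms] by simp
    have sub: "{x. gap s x} \<subseteq> {..s}" using gapD(1) by fastforce
    obtain x0 where x0: "gap s x0" "P s x0 < g s s" using lower_point[OF assms s0, of s] by blast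
    \<comment> \<open>Cutting at \<open>t = s\<close> leaves in \<open>g\<close> only modes above
      \<open>s\<close>, so \<open>g\<close> has no pole up to \<open>s\<close>. As the gap of a
      positive level lies above the zero mode, \<open>g s 0\<close> bounds it.\<close>
    have "\<exists>x. gap s x \<and> P s x = g s x"
    proof (rule root_exists[OF assms order_refl continuous_on_subset[OF continuous_g sub]])
      show "g s x \<le> g s 0" if "gap s x" for x
        using that s0 gapD(1)[OF that] gapD(2)[OF that, of "(0, 0)"] by (intro g_antimono) auto
      show "g s y \<le> g s x" if "gap s x" "gap s y" "x \<le> y" for x y
        using that gapD(1)[of s y] by (intro g_antimono) auto
      show "\<exists>x. gap s x \<and> P s x < g s x"
        using x0 g_antimono[of x0 s s] gapD(1)[OF x0(1)] by (intro exI[of _ x0]) auto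
    qed
    then obtain x where "gap s x" "P s x = g s x" by blast
    then show ?thesis using F_eq[of x s] by (intro exI[of _ x]) simp
  qed
  then have "gap s (lam s) \<and> F (lam s) = 0" unfolding lam_def by (rule someI_ex)
  then show "gap s (lam s)" "F (lam s) = 0" by auto
qed

lemma lam_zero: "lam 0 = EB"
  using gap_unique_root[of 0 "lam 0" EB] lam[OF zero_level] F_EB EB_neg gap_zero by simp

lemma EB_le_lam:
  assumes "s \<in> range e" shows "EB \<le> lam s"
proof (cases "s = 0")
  case False
  then have "0 < s" using level_nonneg[OF assms] by simp
  then have "0 < lam s" using gapD(2)[OF lam(1)[OF assms], of "(0, 0)"] by simp
  then show ?thesis using EB_neg by simp
qed (simp add: lam_zero)

lemma root_is_lam:
  assumes "F x = 0" "x \<notin> range e" shows "\<exists>s\<in>range e. x = lam s"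
proof -
  obtain n where n: "e n > x" using ex_large by blast
  let ?S = "{s \<in> range e. x < s \<and> s \<le> e n}"
  have fin: "finite ?S" by (rule finite_subset[OF _ finite_levels_le[of "e n"]]) auto
  have ne: "?S \<noteq> {}" using n by auto
  define s where "s = Min ?S"
  have s: "s \<in> range e" "x < s" "s \<le> e n" using Min_in[OF fin ne] by (auto simp: s_def)
  have "e m < x" if "e m < s" for m
  proof (rule ccontr)
    assume "\<not> e m < x"
    then have "x < e m" using assms(2) rangeI[of e m] by (cases "e m" x rule: linorder_cases) auto
    then have "e m \<in> ?S" using that s by auto
    then show False using Min_le[OF fin, of "e m"] that by (simp add: s_def)
  qed
  then have "gap s x" using s by (auto simp: gap_def)
  then show ?thesis using gap_unique_root[of s x "lam s"] lam[OF s(1)] assms(1) s(1) by blast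
qed

end

section \<open>Eigenvectors by weak compactness\<close>

text \<open>Stated through finite partial sums, each a condition on finitely many coordinates, so
  that the ball is visibly closed in the product topology.\<close>

definition l2_ball :: "('k \<Rightarrow> complex) set" where
  "l2_ball = {f. \<forall>A. finite A \<longrightarrow> (\<Sum>n\<in>A. (cmod (f n))^2) \<le> 1}"

lemma l2_ball_iff: "f \<in> l2_ball \<longleftrightarrow> l2 f \<and> l2norm f \<le> 1"
proof
  assume "f \<in> l2_ball"
  then show "l2 f \<and> l2norm f \<le> 1"
    using l2_bounded_finite_sums[of f 1] by (auto simp: l2_ball_def)
next
  assume f: "l2 f \<and> l2norm f \<le> 1"
  then have "(l2norm f)^2 \<le> 1" by (simp add: power_le_one)
  then show "f \<in> l2_ball"
    unfolding l2_ball_def using finite_sum_le_l2norm_sq[of f] f order_trans by blast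
qed

lemma l2_ball_norm_le_1: "f \<in> l2_ball \<Longrightarrow> cmod (f n) \<le> 1"
  unfolding l2_ball_def using power2_le_imp_le[of "cmod (f n)" 1] by (auto dest!: spec[of _ "{n}"])

lemma closed_l2_ball: "closed (l2_ball :: ('k \<Rightarrow> complex) set)"
proof -
  have eq: "l2_ball = (\<Inter>A\<in>{A :: 'k set. finite A}. {f. (\<Sum>n\<in>A. (cmod (f n))^2) \<le> 1})"
    by (auto simp: l2_ball_def)
  have "closed {f :: 'k \<Rightarrow> complex. (\<Sum>n\<in>A. (cmod (f n))^2) \<le> 1}" for A
    by (intro closed_Collect_le continuous_intros continuous_on_product_coordinates)
  then show ?thesis unfolding eq by (intro closed_INT ballI)
qed

text \<open>Tychonoff: the ball is a closed subset of a product of closed discs. This is the weak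
  compactness of the unit ball.\<close>

lemma compact_l2_ball: "compact (l2_ball :: ('k \<Rightarrow> complex) set)"
proof -
  have "compactin (product_topology (\<lambda>_. euclidean) UNIV) (PiE (UNIV :: 'k set) (\<lambda>_. cball (0 :: complex) 1))"
    by (subst compactin_PiE) auto
  then have "compact (PiE (UNIV :: 'k set) (\<lambda>_. cball (0 :: complex) 1))"
    by (simp add: euclidean_product_topology)
  then have "compact (PiE (UNIV :: 'k set) (\<lambda>_. cball (0 :: complex) 1) \<inter> l2_ball)"
    using closed_l2_ball by (rule compact_Int_closed)
  moreover have "PiE (UNIV :: 'k set) (\<lambda>_. cball (0 :: complex) 1) \<inter> l2_ball = l2_ball"
    using l2_ball_norm_le_1 by (auto simp: PiE_def)
  ultimately show ?thesis by simp
qed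

text \<open>Truncating \<open>a\<close> to finitely many coordinates gives a continuous functional,
  and by Cauchy-Schwarz the error is at most the tail norm of \<open>a\<close>, uniformly on the
  ball.\<close>

lemma continuous_l2inner_ball:
  assumes "l2 a" shows "continuous_on l2_ball (l2inner a)"
proof (rule uniform_limit_theorem)
  show "\<forall>\<^sub>F A in finite_subsets_at_top UNIV. continuous_on l2_ball (\<lambda>f. \<Sum>n\<in>A. cnj (a n) * f n)"
    by (intro always_eventually allI continuous_intros continuous_on_subset[OF continuous_on_product_coordinates]) auto
  let ?t = "\<lambda>A n. if n \<in> A then 0 else a n"
  have lt: "l2 (?t A)" for A by (rule l2_dominated[OF assms]) auto
  show "uniform_limit l2_ball (\<lambda>A f. \<Sum>n\<in>A. cnj (a n) * f n) (l2inner a) (finite_subsets_at_top UNIV)"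
  proof (rule uniform_limitI)
    fix d :: real assume d: "0 < d"
    have "\<forall>\<^sub>F A in finite_subsets_at_top UNIV. l2norm (?t A) < d"
      using l2norm_tail_tendsto_0[OF assms] d by (rule order_tendstoD)
    moreover have "\<forall>\<^sub>F A in finite_subsets_at_top UNIV. finite (A :: 'a set)"
      by (rule eventually_finite_subsets_at_top_weakI)
    ultimately show "\<forall>\<^sub>F A in finite_subsets_at_top UNIV. \<forall>f\<in>l2_ball. dist (\<Sum>n\<in>A. cnj (a n) * f n) (l2inner a f) < d"
    proof eventually_elim
      case (elim A)
      show ?case
      proof
        fix f :: "'a \<Rightarrow> complex" assume "f \<in> l2_ball"
        then have f: "l2 f" "l2norm f \<le> 1" by (auto simp: l2_ball_iff)
        let ?s = "\<lambda>n. if n \<in> A then a n else 0"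
        have ls: "l2 ?s" by (rule l2_dominated[OF assms]) auto
        have "l2inner f a = l2inner f ?s + l2inner f (?t A)"
          using l2inner_add_right[OF f(1) ls lt[of A]] by (simp add: if_distrib cong: if_cong)
        then have "l2inner a f = cnj (l2inner f ?s) + l2inner (?t A) f"
          using l2inner_commute[of a f] l2inner_commute[of "?t A" f] by simp
        moreover have "l2inner f ?s = (\<Sum>n\<in>A. cnj (f n) * a n)"
          by (subst l2inner_finite_support_right[OF elim(2)]) (auto intro: sum.cong)
        ultimately have "dist (\<Sum>n\<in>A. cnj (a n) * f n) (l2inner a f) = cmod (l2inner (?t A) f)"
          by (simp add: dist_norm norm_minus_commute mult.commute)
        also have "\<dots> \<le> l2norm (?t A) * l2norm f" by (rule l2_Cauchy_Schwarz[OF lt f(1)])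
        also have "\<dots> \<le> l2norm (?t A)" using f by (simp add: mult_left_le)
        finally show "dist (\<Sum>n\<in>A. cnj (a n) * f n) (l2inner a f) < d" using elim by simp
      qed
    qed
  qed
qed simp

text \<open>A maximiser of the quadratic form on the unit ball of an invariant subspace is an eigenvector.\<close>

lemma rank_one_perturbation_eigenvector:
  fixes a :: "'k \<Rightarrow> real" and c :: real and b :: "'k \<Rightarrow> complex" and u :: "'j \<Rightarrow> 'k \<Rightarrow> complex"
  defines "T \<equiv> \<lambda>f n. complex_of_real (a n) * f n + complex_of_real c * l2inner b f * b n"
  defines "V \<equiv> {f. l2 f \<and> (\<forall>j. l2inner (u j) f = 0)}"
  assumes a: "l2 (\<lambda>n. complex_of_real (a n))" "\<And>n. 0 < a n" "\<And>n. a n \<le> C" and b: "l2 b" and c: "0 \<le> c"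
    and u: "\<And>j. l2 (u j)" and inv: "\<And>f. f \<in> V \<Longrightarrow> T f \<in> V"
    and ne: "f0 \<in> V" "f0 \<noteq> (\<lambda>_. 0)"
  shows "\<exists>f M. f \<in> V \<and> f \<noteq> (\<lambda>_. 0) \<and> M > 0 \<and> T f = (\<lambda>n. complex_of_real M * f n)"
proof -
  \<comment> \<open>Written as an inner product of \<open>a\<close> with the squared moduli of
    \<open>f\<close>, the diagonal part is continuous on the ball: squaring moduli maps the ball
    continuously into itself and \<open>a\<close> is in l2. The Hilbert-Schmidt property of the
    diagonal thus enters here.\<close>
  define q where "q f = Re (l2inner (\<lambda>n. complex_of_real (a n)) (\<lambda>n. complex_of_real ((cmod (f n))^2))) + c * (cmod (l2inner b f))^2" for f
  have la: "l2 (\<lambda>n. complex_of_real (a n) * f n)" if "l2 f" for f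
  proof (rule l2_dominated[OF l2_cmult[OF that, of "complex_of_real C"]])
    show "cmod (complex_of_real (a n) * f n) \<le> cmod (complex_of_real C * f n)" for n
      using a(2)[of n] a(3)[of n] by (auto simp: norm_mult intro!: mult_right_mono)
  qed
  have lT: "l2 (T f)" if "l2 f" for f
    unfolding T_def by (intro l2_add l2_cmult la b that)
  have inner_T: "l2inner f (T h) = l2inner f (\<lambda>n. complex_of_real (a n) * h n) + complex_of_real c * l2inner b h * l2inner f b"
    if "l2 f" "l2 h" for f h
    unfolding T_def using l2inner_add_right[OF that(1) la[OF that(2)] l2_cmult[OF b]] by (simp add: l2inner_cmult_right)
  have sym: "l2inner f (T h) = cnj (l2inner h (T f))" if "l2 f" "l2 h" for f h
  proof -
    have "l2inner f (\<lambda>n. complex_of_real (a n) * h n) = cnj (l2inner h (\<lambda>n. complex_of_real (a n) * f n))"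
      unfolding l2inner_def infsum_cnj[symmetric] by (intro infsum_cong) (simp add: mult_ac)
    then show ?thesis
      using inner_T[OF that] inner_T[OF that(2,1)] l2inner_commute[of f b] l2inner_commute[of h b] by simp
  qed
  have q_T: "Re (l2inner f (T f)) = q f" if "l2 f" for f
  proof -
    have "l2inner f (\<lambda>n. complex_of_real (a n) * f n) = l2inner (\<lambda>n. complex_of_real (a n)) (\<lambda>n. complex_of_real ((cmod (f n))^2))"
      unfolding l2inner_def complex_norm_square by (intro infsum_cong) (simp add: mult_ac)
    moreover have "complex_of_real c * l2inner b f * l2inner f b = complex_of_real (c * (cmod (l2inner b f))^2)"
      unfolding of_real_mult complex_norm_square l2inner_commute[of f b] by (simp add: mult.assoc)
    ultimately show ?thesis
      unfolding q_def inner_T[OF that that] by (simp only: plus_complex.sel Re_complex_of_real)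
  qed
  have q_scale: "q (\<lambda>n. complex_of_real x * f n) = x^2 * q f" if "l2 f" for x f
    unfolding q_def l2inner_cmult_right norm_mult power_mult_distrib of_real_mult
    by (simp add: l2inner_cmult_right algebra_simps)
  have q_pos: "0 < q f" if f: "l2 f" "f \<noteq> (\<lambda>_. 0)" for f
  proof -
    obtain n where n: "f n \<noteq> 0" using f by (auto simp: fun_eq_iff)
    have s: "(\<lambda>n. cnj (f n) * (complex_of_real (a n) * f n)) summable_on UNIV"
      by (rule l2inner_summable[OF f(1) la[OF f(1)]])
    have t: "cnj (f n) * (complex_of_real (a n) * f n) = complex_of_real (a n * (cmod (f n))^2)" for n
      unfolding of_real_mult complex_norm_square by (simp add: mult_ac)
    have s': "(\<lambda>n. a n * (cmod (f n))^2) summable_on UNIV"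
      using summable_on_Re[OF s] unfolding t by simp
    have "((\<lambda>n. complex_of_real (a n * (cmod (f n))^2)) has_sum complex_of_real (infsum (\<lambda>n. a n * (cmod (f n))^2) UNIV)) UNIV"
      by (rule has_sum_of_real[OF has_sum_infsum[OF s']])
    from infsumI[OF this]
    have "Re (l2inner (\<lambda>n. complex_of_real (a n)) (\<lambda>n. complex_of_real ((cmod (f n))^2))) = infsum (\<lambda>n. a n * (cmod (f n))^2) UNIV"
      unfolding l2inner_def by simp
    moreover have "0 < a n * (cmod (f n))^2" using a(2)[of n] n by simp
    moreover have "a n * (cmod (f n))^2 \<le> infsum (\<lambda>n. a n * (cmod (f n))^2) UNIV"
      using finite_sum_le_infsum[OF s', of "{n}"] a(2) by (simp add: less_imp_le)
    ultimately show ?thesis unfolding q_def using c by (simp add: add_pos_nonneg)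
  qed
  define S where "S = l2_ball \<inter> (\<Inter>j. {f \<in> l2_ball. l2inner (u j) f = 0})"
  have S_iff: "f \<in> S \<longleftrightarrow> f \<in> V \<and> l2norm f \<le> 1" for f
    by (auto simp: S_def V_def l2_ball_iff)
  have "closed {f \<in> l2_ball. l2inner (u j) f = 0}" for j
    by (rule continuous_closed_preimage_constant[OF continuous_l2inner_ball[OF u] closed_l2_ball])
  then have "compact S" unfolding S_def by (intro compact_Int_closed compact_l2_ball closed_INT) auto
  moreover have "S \<noteq> {}"
  proof -
    have "(\<lambda>_. 0) \<in> S" by (simp add: S_iff V_def)
    then show ?thesis by blast
  qed
  moreover have "continuous_on S q"
  proof -
    have sq: "continuous_on l2_ball (\<lambda>f n. complex_of_real ((cmod (f n :: complex))^2))"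
      by (intro continuous_on_coordinatewise_then_product continuous_intros continuous_on_subset[OF continuous_on_product_coordinates]) auto
    have sub: "(\<lambda>f n. complex_of_real ((cmod (f n :: complex))^2)) ` l2_ball \<subseteq> (l2_ball :: ('k \<Rightarrow> complex) set)"
    proof clarify
      fix f :: "'k \<Rightarrow> complex" assume f: "f \<in> l2_ball"
      have "(cmod (complex_of_real ((cmod (f n))^2)))^2 \<le> (cmod (f n))^2" for n
      proof -
        have "(cmod (f n))^2 * (cmod (f n))^2 \<le> 1 * (cmod (f n))^2"
          using l2_ball_norm_le_1[OF f, of n] by (intro mult_right_mono) (auto simp: power_le_one)
        then show ?thesis by (simp add: power2_eq_square norm_mult)
      qed
      then have "(\<Sum>n\<in>A. (cmod (complex_of_real ((cmod (f n))^2)))^2) \<le> (\<Sum>n\<in>A. (cmod (f n))^2)" for A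
        by (rule sum_mono)
      then show "(\<lambda>n. complex_of_real ((cmod (f n))^2)) \<in> l2_ball"
        using f unfolding l2_ball_def by (blast intro: order_trans)
    qed
    have "continuous_on l2_ball (\<lambda>f. l2inner (\<lambda>n. complex_of_real (a n)) (\<lambda>n. complex_of_real ((cmod (f n))^2)))"
      by (rule continuous_on_compose2[OF continuous_l2inner_ball[OF a(1)] sq sub])
    then have "continuous_on l2_ball q"
      unfolding q_def by (intro continuous_intros continuous_l2inner_ball b)
    then show ?thesis by (rule continuous_on_subset) (auto simp: S_def)
  qed
  ultimately obtain f where f: "f \<in> S" and fmax: "\<And>h. h \<in> S \<Longrightarrow> q h \<le> q f"
    using continuous_attains_sup[of S q] by blast
  define M where "M = q f"
  have fV: "f \<in> V" and lf: "l2 f" and nf: "l2norm f \<le> 1" using f by (auto simp: S_iff V_def)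
  have bound: "q h \<le> M * (l2norm h)^2" if h: "h \<in> V" for h
  proof (cases "l2norm h = 0")
    case True
    have lh: "l2 h" using h by (simp add: V_def)
    have "h = (\<lambda>_. 0)" using l2norm_eq_0D[OF lh True] by auto
    then show ?thesis by (simp add: q_def)
  next
    case False
    have lh: "l2 h" using h by (simp add: V_def)
    let ?h = "\<lambda>n. complex_of_real (1 / l2norm h) * h n"
    have "?h \<in> S"
      using h False l2norm_cmult[of "complex_of_real (1 / l2norm h)" h] l2_cmult[OF lh]
      by (auto simp: S_iff V_def l2inner_cmult_right simp del: of_real_divide)
    then have "(1 / l2norm h)^2 * q h \<le> M" using fmax[of ?h] q_scale[OF lh, of "1 / l2norm h"] by (simp add: M_def)
    then show ?thesis using False by (simp add: field_simps)
  qed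
  have Mpos: "M > 0"
  proof -
    have lf0: "l2 f0" using ne by (simp add: V_def)
    have "0 < M * (l2norm f0)^2" using q_pos[OF lf0 ne(2)] bound[OF ne(1)] by linarith
    then show ?thesis by (simp add: zero_less_mult_iff)
  qed
  have f0: "f \<noteq> (\<lambda>_. 0)" using Mpos unfolding M_def by (auto simp: q_def)
  \<comment> \<open>A positive maximum is attained on the unit sphere; this identity cancels the
    zeroth-order terms of the variation below.\<close>
  have qf: "M * (l2norm f)^2 = M"
  proof -
    have "M * (l2norm f)^2 \<le> M * 1" using Mpos nf by (intro mult_left_mono) (auto simp: power_le_one)
    then show ?thesis using bound[OF fV] by (simp add: M_def)
  qed
  define w where "w = (\<lambda>n. T f n - complex_of_real M * f n)"
  have lTf: "l2 (T f)" by (rule lT[OF lf])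
  have lw: "l2 w" unfolding w_def by (intro l2_diff l2_cmult lTf lf)
  have wV: "w \<in> V"
    using inv[OF fV] fV lw u l2inner_diff_right[OF u lTf l2_cmult[OF lf], of _ "complex_of_real M"]
    by (simp add: V_def w_def l2inner_cmult_right)
  have "l2inner w w = l2inner w (T f) - complex_of_real M * l2inner w f"
    using l2inner_diff_right[OF lw lTf l2_cmult[OF lf], of "complex_of_real M"]
    unfolding w_def[symmetric] l2inner_cmult_right .
  then have "Re (l2inner w w) = Re (l2inner w (T f)) - M * Re (l2inner w f)" by simp
  then have Re_w: "Re (l2inner w (T f)) - M * Re (l2inner w f) = (l2norm w)^2"
    unfolding l2inner_self[OF lw] by simp
  \<comment> \<open>Vary the maximiser in the direction of the residual
    \<open>w = T f - M f\<close>, which lies in \<open>V\<close> by invariance; the first-order term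
    is twice the squared norm of \<open>w\<close>.\<close>
  have key: "2 * t * (l2norm w)^2 + t^2 * (q w - M * (l2norm w)^2) \<le> 0" for t :: real
  proof -
    let ?w = "\<lambda>n. complex_of_real t * w n"
    let ?h = "\<lambda>n. f n + ?w n"
    have l: "l2 ?w" "l2 ?h" by (intro l2_add l2_cmult lf lw)+
    have "?h \<in> V"
      using fV wV l u l2inner_add_right[OF u lf l(1)] by (simp add: V_def l2inner_cmult_right)
    then have "q ?h \<le> M * (l2norm ?h)^2" by (rule bound)
    moreover have "(l2norm ?h)^2 = (l2norm f)^2 + 2 * t * Re (l2inner w f) + t^2 * (l2norm w)^2"
      using l2norm_sq_add[OF lf l(1)] l2inner_commute[of w f] by (simp add: l2inner_cmult_right l2norm_cmult power_mult_distrib)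
    moreover have "q ?h = q f + 2 * t * Re (l2inner w (T f)) + t^2 * q w"
    proof -
      have "T ?h = (\<lambda>n. T f n + complex_of_real t * T w n)"
        using l2inner_add_right[OF b lf l(1)] by (auto simp: T_def l2inner_cmult_right algebra_simps)
      then have "l2inner ?h (T ?h) = l2inner ?h (T f) + complex_of_real t * l2inner ?h (T w)"
        using l2inner_add_right[OF l(2) lTf l2_cmult[OF lT[OF lw]]] by (simp add: l2inner_cmult_right)
      moreover have "l2inner ?h y = l2inner f y + complex_of_real t * l2inner w y" if "l2 y" for y
        using l2inner_add_right[OF that lf l(1)] l2inner_commute[of ?h y] l2inner_commute[of f y] l2inner_commute[of w y]
        by (simp add: l2inner_cmult_right)
      ultimately have "l2inner ?h (T ?h) = l2inner f (T f) + complex_of_real t * l2inner w (T f)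
          + complex_of_real t * (cnj (l2inner w (T f)) + complex_of_real t * l2inner w (T w))"
        using lTf lT[OF lw] sym[OF lf lw] by simp
      then have "Re (l2inner ?h (T ?h)) = Re (l2inner f (T f)) + 2 * t * Re (l2inner w (T f)) + t^2 * Re (l2inner w (T w))"
        by (simp add: power2_eq_square algebra_simps)
      then show ?thesis using q_T[OF l(2)] q_T[OF lf] q_T[OF lw] by simp
    qed
    ultimately have "q f + 2 * t * Re (l2inner w (T f)) + t^2 * q w \<le> M * ((l2norm f)^2 + 2 * t * Re (l2inner w f) + t^2 * (l2norm w)^2)"
      by simp
    then have "2 * t * (Re (l2inner w (T f)) - M * Re (l2inner w f)) + t^2 * (q w - M * (l2norm w)^2) \<le> 0"
      using qf by (simp add: M_def[symmetric] algebra_simps)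
    then show ?thesis unfolding Re_w .
  qed
  have "(l2norm w)^2 \<le> 0"
  proof (rule ccontr)
    assume "\<not> (l2norm w)^2 \<le> 0"
    then have W: "(l2norm w)^2 > 0" by simp
    \<comment> \<open>\<open>k\<close> dominates the second-order coefficient, so at
      \<open>t = (l2norm w)^2 / k\<close> the quadratic term cancels at most half of the linear
      one.\<close>
    define k where "k = \<bar>q w - M * (l2norm w)^2\<bar> + 1"
    define t where "t = (l2norm w)^2 / k"
    have k: "k > 0" by (simp add: k_def add_nonneg_pos)
    then have t: "t > 0" using W by (simp add: t_def)
    have "- k \<le> q w - M * (l2norm w)^2" unfolding k_def by linarith
    then have "t^2 * (- k) \<le> t^2 * (q w - M * (l2norm w)^2)" by (rule mult_left_mono) simp
    moreover have "t^2 * k = t * (l2norm w)^2" using k by (simp add: t_def power2_eq_square)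
    ultimately have "t * (l2norm w)^2 \<le> 0" using key[of t] by simp
    moreover have "0 < t * (l2norm w)^2" using t W by simp
    ultimately show False by linarith
  qed
  then have "l2norm w = 0" by simp
  then have "w n = 0" for n using l2norm_eq_0D[OF lw] by blast
  then have "T f = (\<lambda>n. complex_of_real M * f n)" by (auto simp: w_def)
  then show ?thesis using fV f0 Mpos by blast
qed

section \<open>The eigenbasis of the point interaction\<close>

lemma l2inner_finite_support_left:
  assumes "finite A" "\<And>x. x \<notin> A \<Longrightarrow> f x = 0"
  shows "l2inner f h = (\<Sum>x\<in>A. cnj (f x) * h x)"
proof -
  have "l2inner f h = infsum (\<lambda>x. cnj (f x) * h x) A"
    unfolding l2inner_def using assms by (intro infsum_cong_neutral) auto
  then show ?thesis using assms by simp
qed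

context point_interaction begin

section \<open>Resolvent identities for the rank-one perturbation\<close>

abbreviation nonlevel :: "complex \<Rightarrow> bool" where "nonlevel z \<equiv> \<forall>n. complex_of_real (e n) \<noteq> z"

text \<open>The scalar denominator of the resolvent. By \<open>has_sum_D\<close> it is a regularised
  sum, and by \<open>D_real\<close> it extends \<open>F\<close> to complex arguments.\<close>

definition D :: "complex \<Rightarrow> complex" where
  "D z = (complex_of_real EB - z) * l2inner (gam L (complex_of_real EB)) (gam L z)"

lemma cnj_gam: "cnj (gam L (cnj z) n) = gam L z n"
  by (simp add: gam_def)

lemma cnj_gam_real [simp]: "cnj (gam L (complex_of_real x) n) = gam L (complex_of_real x) n"
  by (simp add: gam_def)

lemma gam_diff: "nonlevel z \<Longrightarrow> nonlevel w \<Longrightarrow> gam L w n - gam L z n = (w - z) * (gam L z n * gam L w n)"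
proof -
  assume "nonlevel z" "nonlevel w"
  then have "complex_of_real (e n) \<noteq> z" "complex_of_real (e n) \<noteq> w" by blast+
  then show ?thesis by (simp add: gam_def divide_simps)
qed

lemma nonlevel_EB: "nonlevel (complex_of_real EB)"
  using e_neq_EB by simp

lemma has_sum_D:
  assumes "nonlevel z"
  shows "((\<lambda>n. gam L (complex_of_real EB) n - gam L z n) has_sum D z) UNIV"
proof -
  have "((\<lambda>n. (complex_of_real EB - z) * (cnj (gam L (complex_of_real EB) n) * gam L z n)) has_sum D z) UNIV"
    unfolding D_def l2inner_def
    by (intro has_sum_cmult_right has_sum_infsum l2inner_summable l2_gam)
  moreover have "gam L (complex_of_real EB) n - gam L z n = (complex_of_real EB - z) * (cnj (gam L (complex_of_real EB) n) * gam L z n)" for n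
    using gam_diff[OF assms nonlevel_EB, of n] by (simp add: mult.commute)
  ultimately show ?thesis by simp
qed

text \<open>The resolvent identity summed over the lattice. It makes the vectors \<open>gam\<close>
  at two different real zeros of \<open>D\<close> orthogonal, and it evaluates the rank-one term of
  the resolvent on such a vector.\<close>

lemma infsum_gam_gam:
  assumes "nonlevel z" "nonlevel w"
  shows "(w - z) * infsum (\<lambda>n. gam L z n * gam L w n) UNIV = D z - D w"
proof -
  have "((\<lambda>n. (gam L (complex_of_real EB) n - gam L z n) + - (gam L (complex_of_real EB) n - gam L w n)) has_sum (D z + - D w)) UNIV"
    by (intro has_sum_add has_sum_uminusI has_sum_D assms)
  moreover have "((\<lambda>n. (w - z) * (gam L z n * gam L w n)) has_sum ((w - z) * infsum (\<lambda>n. gam L z n * gam L w n) UNIV)) UNIV"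
    by (intro has_sum_cmult_right has_sum_infsum l2_mult_summable l2_gam)
  moreover have "(\<lambda>n. (w - z) * (gam L z n * gam L w n)) = (\<lambda>n. (gam L (complex_of_real EB) n - gam L z n) + - (gam L (complex_of_real EB) n - gam L w n))"
    using gam_diff[OF assms] by auto
  ultimately show ?thesis using has_sum_unique by fastforce
qed

lemma D_real:
  assumes "x \<notin> range e" shows "D (complex_of_real x) = complex_of_real (F x)"
proof -
  have "((\<lambda>n. complex_of_real (r EB n - r x n)) has_sum complex_of_real (F x)) UNIV"
    unfolding F_def by (intro has_sum_of_real has_sum_infsum summable_diff)
  moreover have "nonlevel (complex_of_real x)" using assms by auto
  from has_sum_D[OF this] have "((\<lambda>n. complex_of_real (r EB n - r x n)) has_sum D (complex_of_real x)) UNIV"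
    by (simp add: gam_real)
  ultimately show ?thesis using has_sum_unique by blast
qed

text \<open>A zero at i would by conjugation be accompanied by one at -i, and
  \<open>infsum_gam_gam\<close> would give \<open>gam L \<i>\<close> norm 0. Hence the graph of h is
  defined by a genuine quotient.\<close>

lemma D_i: "nonlevel \<i>" "D \<i> \<noteq> 0"
proof -
  show nl: "nonlevel \<i>" by (simp add: complex_eq_iff)
  have nl': "nonlevel (- \<i>)" by (simp add: complex_eq_iff)
  show "D \<i> \<noteq> 0"
  proof
    assume "D \<i> = 0"
    have "gam L (- \<i>) n = cnj (gam L \<i> n)" for n by (simp add: gam_def)
    then have "D (- \<i>) = cnj (D \<i>)"
      unfolding D_def l2inner_def by (simp flip: infsum_cnj)
    then have "(- \<i> - \<i>) * infsum (\<lambda>n. gam L \<i> n * gam L (- \<i>) n) UNIV = 0"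
      using infsum_gam_gam[OF nl nl'] \<open>D \<i> = 0\<close> by simp
    then have "infsum (\<lambda>n. gam L \<i> n * gam L (- \<i>) n) UNIV = 0" by (simp add: complex_eq_iff)
    moreover have "gam L \<i> n * gam L (- \<i>) n = cnj (gam L \<i> n) * gam L \<i> n" for n
      by (simp add: gam_def)
    ultimately have "l2inner (gam L \<i>) (gam L \<i>) = 0" by (simp add: l2inner_def)
    then have "l2norm (gam L \<i>) = 0" using l2inner_self[OF l2_gam, of \<i>] by simp
    then have "gam L \<i> (0, 0) = 0" by (rule l2norm_eq_0D[OF l2_gam])
    then show False by (simp add: gam_def)
  qed
qed

lemma resolv_eq:
  "resolv L EB z f n = gam L z n * f n + (infsum (\<lambda>n. gam L z n * f n) UNIV / D z) * gam L z n"
  by (simp add: resolv_def D_def l2inner_def cnj_gam) (simp add: gam_def)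

lemma l2_gam_mult:
  assumes "l2 f" shows "l2 (\<lambda>n. gam L z n * f n)"
proof -
  obtain C where C: "\<And>n. cmod (gam L z n) \<le> C / (1 + e n)" using gam_bound by blast
  have "cmod (gam L z n) \<le> C" for n
  proof -
    have e: "1 \<le> 1 + e n" by simp
    have "0 \<le> C / (1 + e n)" using C[of n] norm_ge_zero order_trans by blast
    then have "0 \<le> C" using e by (simp add: zero_le_divide_iff)
    then have "C / (1 + e n) \<le> C / 1" using e by (intro divide_left_mono) (auto simp: add_pos_nonneg)
    then have "C / (1 + e n) \<le> C" by simp
    then show ?thesis using C[of n] by linarith
  qed
  then show ?thesis
    by (intro l2_dominated[OF l2_cmult[OF assms, of "complex_of_real C"]])
      (auto simp: norm_mult intro!: mult_right_mono intro: order_trans[OF _ abs_ge_self])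
qed

lemma l2_resolv: "l2 f \<Longrightarrow> l2 (resolv L EB z f)"
  unfolding resolv_eq[abs_def] by (intro l2_add l2_cmult l2_gam l2_gam_mult)

subsection \<open>Orthonormal eigenvectors\<close>

text \<open>Eigenvectors are indexed by the momenta themselves: the representative of a level
  carries the eigenvalue pushed down from it, and the other momenta of the level carry the
  eigenvalue that stays.\<close>

definition rep :: "real \<Rightarrow> int \<times> int" where "rep s = (SOME n. e n = s)"

definition isrep :: "int \<times> int \<Rightarrow> bool" where "isrep k \<longleftrightarrow> k = rep (e k)"

definition degen :: "int \<times> int \<Rightarrow> real" where "degen k = real (card {n. e n = e k})"

lemma e_rep: "s \<in> range e \<Longrightarrow> e (rep s) = s"
  unfolding rep_def by (rule someI_ex) auto

lemma isrep_rep: "s \<in> range e \<Longrightarrow> isrep (rep s)"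
  by (simp add: isrep_def e_rep)

lemma degen_gt_1:
  assumes "\<not> isrep k" shows "degen k > 1"
proof -
  have "{k, rep (e k)} \<subseteq> {n. e n = e k}" using e_rep[of "e k"] by auto
  then have "card {k, rep (e k)} \<le> card {n. e n = e k}" by (intro card_mono finite_level)
  then show ?thesis using assms by (auto simp: isrep_def degen_def)
qed

text \<open>The rows, other than the one at \<open>rep s\<close>, of the Householder reflection that maps the
  unit vector at \<open>rep s\<close> to the normalised constant function on the level \<open>s\<close>.\<close>

definition hh :: "int \<times> int \<Rightarrow> int \<times> int \<Rightarrow> real" where
  "hh k n = (if e n = e k then (if n = k then 1 else 0)
     + (if n = rep (e k) then 1 / sqrt (degen k) else - 1 / (degen k - sqrt (degen k))) else 0)"

lemma sum_hh:
  fixes \<phi> :: "int \<times> int \<Rightarrow> 'a::real_algebra_1"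
  assumes "\<not> isrep k"
  shows "(\<Sum>n | e n = e k. of_real (hh k n) * \<phi> n) = \<phi> k + of_real (1 / sqrt (degen k)) * \<phi> (rep (e k))
     - of_real (1 / (degen k - sqrt (degen k))) * (\<Sum>n\<in>{n. e n = e k} - {rep (e k)}. \<phi> n)"
proof -
  let ?A = "{n. e n = e k}" and ?a = "rep (e k)"
  have fin: "finite ?A" by (rule finite_level)
  have a: "?a \<in> ?A" using e_rep[of "e k"] by simp
  have ka: "k \<in> ?A - {?a}" using assms by (auto simp: isrep_def)
  have "(\<Sum>n\<in>?A. of_real (hh k n) * \<phi> n) = of_real (hh k ?a) * \<phi> ?a + (\<Sum>n\<in>?A - {?a}. of_real (hh k n) * \<phi> n)"
    by (rule sum.remove[OF fin a])
  also have "(\<Sum>n\<in>?A - {?a}. of_real (hh k n) * \<phi> n) =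
      (\<Sum>n\<in>?A - {?a}. (if n = k then \<phi> n else 0) - of_real (1 / (degen k - sqrt (degen k))) * \<phi> n)"
    by (intro sum.cong) (auto simp: hh_def algebra_simps)
  also have "\<dots> = \<phi> k - of_real (1 / (degen k - sqrt (degen k))) * (\<Sum>n\<in>?A - {?a}. \<phi> n)"
    using ka fin by (simp add: sum_subtractf sum_distrib_left)
  also have "hh k ?a = 1 / sqrt (degen k)" using a ka by (auto simp: hh_def)
  finally show ?thesis by simp
qed

lemma sqrt_degen:
  assumes "\<not> isrep k"
  obtains q where "q > 1" "sqrt (degen k) = q" "degen k = q * q"
proof
  show "sqrt (degen k) > 1" using degen_gt_1[OF assms] by simp
  show "degen k = sqrt (degen k) * sqrt (degen k)" using degen_gt_1[OF assms] by simp
qed simp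

text \<open>These rows are orthogonal to the constant row of the reflection. A function on one level
  with zero sum is a Laplace eigenfunction that vanishes at the origin, where the interaction does
  not see it.\<close>

lemma sum_hh_zero:
  assumes "\<not> isrep k" shows "(\<Sum>n | e n = e k. hh k n) = 0"
proof -
  obtain q where q: "q > 1" "sqrt (degen k) = q" "degen k = q * q" using sqrt_degen[OF assms] .
  have "real (card ({n. e n = e k} - {rep (e k)})) = degen k - 1"
    using finite_level[of "e k"] e_rep[of "e k"] degen_gt_1[OF assms]
    by (subst card_Diff_singleton) (auto simp: degen_def of_nat_diff)
  then have "(\<Sum>n | e n = e k. hh k n) = 1 + 1 / q - 1 / (q * q - q) * (q * q - 1)"
    using sum_hh[OF assms, of "\<lambda>_. 1 :: real"] q by simp
  also have "\<dots> = 1 + 1 / q - 1 / (q * (q - 1)) * ((q - 1) * (q + 1))" by (simp add: algebra_simps)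
  also have "\<dots> = 0" using q by (simp add: field_simps)
  finally show ?thesis .
qed

lemma hh_orthonormal:
  assumes "\<not> isrep k" "\<not> isrep j"
  shows "(\<Sum>n | e n = e k. hh k n * hh j n) = (if k = j then 1 else 0)"
proof (cases "e k = e j")
  case True
  obtain q where q: "q > 1" "sqrt (degen j) = q" "degen j = q * q" using sqrt_degen[OF assms(2)] .
  have m: "degen k = degen j" using True by (simp add: degen_def)
  let ?A = "{n. e n = e k}" and ?a = "rep (e k)"
  have a: "?a \<in> ?A" using e_rep[of "e k"] by simp
  have ha: "hh j ?a = 1 / q" using a assms True q by (auto simp: hh_def isrep_def)
  have hk: "hh j k = (if k = j then 1 else 0) - 1 / (q * q - q)"
    using assms True q by (auto simp: hh_def isrep_def)
  have "(\<Sum>n\<in>?A. hh j n) = 0" using sum_hh_zero[OF assms(2)] True by simp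
  then have s: "(\<Sum>n\<in>?A - {?a}. hh j n) = - (1 / q)"
    using sum.remove[OF finite_level a, of "hh j"] ha by simp
  have "(\<Sum>n\<in>?A. hh k n * hh j n) = hh j k + 1 / q * hh j ?a - 1 / (q * q - q) * (\<Sum>n\<in>?A - {?a}. hh j n)"
    using sum_hh[OF assms(1), of "hh j"] q m by simp
  also have "\<dots> = (if k = j then 1 else 0) + (1 / q * (1 / q) - 1 / (q * (q - 1)) + 1 / (q * (q - 1)) * (1 / q))"
    unfolding s ha hk by (simp add: algebra_simps)
  also have "1 / q * (1 / q) - 1 / (q * (q - 1)) + 1 / (q * (q - 1)) * (1 / q) = 0"
    using q by (simp add: field_simps)
  finally show ?thesis by simp
next
  case False
  then show ?thesis by (auto intro!: sum.neutral simp: hh_def)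
qed

lemma hh_support: "n \<notin> {n. e n = e k} \<Longrightarrow> hh k n = 0"
  by (auto simp: hh_def)

definition nrm :: "int \<times> int \<Rightarrow> real" where
  "nrm k = 1 / l2norm (gam L (complex_of_real (lam (e k))))"

definition psi :: "int \<times> int \<Rightarrow> int \<times> int \<Rightarrow> complex" where
  "psi k = (if isrep k then (\<lambda>n. complex_of_real (nrm k) * gam L (complex_of_real (lam (e k))) n)
     else (\<lambda>n. complex_of_real (hh k n)))"

definition ev :: "int \<times> int \<Rightarrow> real" where
  "ev k = (if isrep k then lam (e k) else e k)"

lemma l2_psi: "l2 (psi k)"
proof (cases "isrep k")
  case True
  then show ?thesis using l2_cmult[OF l2_gam] by (simp add: psi_def)
next
  case False
  then show ?thesis
    using hh_support by (intro l2_finite_support[OF finite_level[of "e k"]]) (simp add: psi_def)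
qed

lemma inner_psi_rep:
  "isrep k \<Longrightarrow> l2inner (psi k) f = complex_of_real (nrm k)
     * infsum (\<lambda>n. gam L (complex_of_real (lam (e k))) n * f n) UNIV"
  by (simp add: psi_def l2inner_cmult_left) (simp add: l2inner_def)

lemma inner_psi_nonrep:
  "\<not> isrep k \<Longrightarrow> l2inner (psi k) f = (\<Sum>n | e n = e k. complex_of_real (hh k n) * f n)"
  using hh_support by (subst l2inner_finite_support_left[OF finite_level[of "e k"]]) (auto simp: psi_def)

lemma lam_nonlevel: "s \<in> range e \<Longrightarrow> lam s \<notin> range e"
  using gap_not_level[OF lam(1)] by (metis imageE)

lemma nonlevel_lam: "s \<in> range e \<Longrightarrow> nonlevel (complex_of_real (lam s))"
  using gap_not_level[OF lam(1)] by simp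

lemma D_lam: "s \<in> range e \<Longrightarrow> D (complex_of_real (lam s)) = 0"
  using D_real[OF lam_nonlevel] lam(2) by simp

lemma lam_strict_mono:
  assumes "s \<in> range e" "t \<in> range e" "s < t" shows "lam s < lam t"
proof -
  obtain n where "s = e n" using assms by auto
  then have "s < lam t" using gapD(2)[OF lam(1)[OF assms(2)], of n] assms(3) by simp
  then show ?thesis using gapD(1)[OF lam(1)[OF assms(1)]] by simp
qed

lemma norm_gam_pos: "s \<in> range e \<Longrightarrow> l2norm (gam L (complex_of_real (lam s))) > 0"
proof -
  assume s: "s \<in> range e"
  have "gam L (complex_of_real (lam s)) (0, 0) \<noteq> 0"
    using gap_not_level[OF lam(1)[OF s], of "(0, 0)"] by (simp add: gam_def)
  then have "l2norm (gam L (complex_of_real (lam s))) \<noteq> 0" using l2norm_eq_0D[OF l2_gam] by blast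
  then show ?thesis using l2norm_nonneg[of "gam L (complex_of_real (lam s))"] by linarith
qed

text \<open>Two shifted vectors are orthogonal by \<open>infsum_gam_gam\<close>, both
  \<open>lam\<close> being zeros of \<open>D\<close>. A shifted vector is constant on each level and
  so orthogonal to the zero-sum vectors there; among these, orthonormality is that of the
  reflection.\<close>

lemma orthonormal_psi: "orthonormal psi"
proof -
  have rn: "l2inner (psi k) (psi j) = 0" if "isrep k" "\<not> isrep j" for k j
  proof -
    let ?x = "complex_of_real (lam (e k))"
    have "l2inner (psi j) (psi k) = (\<Sum>n | e n = e j. complex_of_real (hh j n) * (complex_of_real (nrm k) * gam L ?x n))"
      using that by (subst inner_psi_nonrep) (simp_all add: psi_def)
    also have "\<dots> = (\<Sum>n | e n = e j. complex_of_real (hh j n) * (complex_of_real (nrm k) * gam L ?x j))"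
      by (intro sum.cong) (auto simp: gam_def)
    also have "\<dots> = 0"
      unfolding sum_distrib_right[symmetric] of_real_sum[symmetric] using sum_hh_zero[OF that(2)] by simp
    finally show ?thesis using l2inner_commute[of "psi k" "psi j"] by simp
  qed
  have "l2inner (psi k) (psi j) = (if k = j then 1 else 0)" for k j
  proof -
    consider "isrep k" "isrep j" | "isrep k" "\<not> isrep j" | "\<not> isrep k" "isrep j" | "\<not> isrep k" "\<not> isrep j" by blast
    then show ?thesis
    proof cases
      case 1
      let ?x = "complex_of_real (lam (e k))" and ?y = "complex_of_real (lam (e j))"
      show ?thesis
      proof (cases "k = j")
        case True
        have "l2inner (gam L ?x) (gam L ?x) = complex_of_real ((l2norm (gam L ?x))^2)"
          by (rule l2inner_self[OF l2_gam])
        moreover have "psi k = (\<lambda>n. complex_of_real (nrm k) * gam L ?x n)"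
          using 1 by (simp add: psi_def)
        ultimately have "l2inner (psi k) (psi k) = complex_of_real (nrm k * nrm k * (l2norm (gam L ?x))^2)"
          by (simp only: l2inner_cmult_left l2inner_cmult_right complex_cnj_complex_of_real of_real_mult mult.assoc)
        then show ?thesis using True norm_gam_pos[of "e k"] by (simp add: power2_eq_square nrm_def)
      next
        case False
        then have "e k \<noteq> e j" using 1 by (auto simp: isrep_def)
        then have "lam (e k) \<noteq> lam (e j)"
          using lam_strict_mono[of "e k" "e j"] lam_strict_mono[of "e j" "e k"] by (cases "e k" "e j" rule: linorder_cases) auto
        then have "infsum (\<lambda>n. gam L ?x n * gam L ?y n) UNIV = 0"
          using infsum_gam_gam[OF nonlevel_lam nonlevel_lam, of "e k" "e j"] by (simp add: D_lam)
        then have "l2inner (gam L ?x) (gam L ?y) = 0" by (simp add: l2inner_def)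
        moreover have "psi k = (\<lambda>n. complex_of_real (nrm k) * gam L ?x n)"
          "psi j = (\<lambda>n. complex_of_real (nrm j) * gam L ?y n)"
          using 1 by (auto simp: psi_def)
        ultimately show ?thesis using False by (simp only: l2inner_cmult_left l2inner_cmult_right) simp
      qed
    next
      case 2
      then show ?thesis using rn by auto
    next
      case 3
      then show ?thesis using rn[of j k] l2inner_commute[of "psi k" "psi j"] by auto
    next
      case 4
      have "l2inner (psi k) (psi j) = complex_of_real (\<Sum>n | e n = e k. hh k n * hh j n)"
        unfolding inner_psi_nonrep[OF 4(1)] using 4 by (simp add: psi_def)
      then show ?thesis using hh_orthonormal[OF 4] by simp
    qed
  qed
  then show ?thesis by (simp add: orthonormal_def l2_psi)
qed

text \<open>For a representative, the resolvent identity and \<open>D (lam s) = 0\<close> make the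
  rank-one contribution complete the quotient; for other momenta the zero sum kills that
  contribution.\<close>

lemma hat_resolv:
  assumes z: "nonlevel z" "D z \<noteq> 0" "complex_of_real (ev k) \<noteq> z" and f: "l2 f"
  shows "l2inner (psi k) (resolv L EB z f) = l2inner (psi k) f / (complex_of_real (ev k) - z)"
proof (cases "isrep k")
  case True
  let ?x = "complex_of_real (lam (e k))" and ?S = "infsum (\<lambda>n. gam L z n * f n) UNIV"
  have xz: "?x \<noteq> z" using z(3) True by (simp add: ev_def)
  have nl: "nonlevel ?x" by (rule nonlevel_lam) simp
  have s1: "(\<lambda>n. gam L ?x n * (gam L z n * f n)) summable_on UNIV"
    by (rule l2_mult_summable[OF l2_gam l2_gam_mult[OF f]])
  have s2: "(\<lambda>n. ?S / D z * (gam L ?x n * gam L z n)) summable_on UNIV"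
    by (intro summable_on_cmult_right l2_mult_summable l2_gam)
  have "infsum (\<lambda>n. gam L ?x n * resolv L EB z f n) UNIV =
      infsum (\<lambda>n. gam L ?x n * (gam L z n * f n) + ?S / D z * (gam L ?x n * gam L z n)) UNIV"
    unfolding resolv_eq by (simp add: algebra_simps)
  also have "\<dots> = infsum (\<lambda>n. gam L ?x n * (gam L z n * f n)) UNIV + ?S / D z * infsum (\<lambda>n. gam L ?x n * gam L z n) UNIV"
    using infsum_add[OF s1 s2] unfolding infsum_cmult_right' .
  also have "infsum (\<lambda>n. gam L ?x n * gam L z n) UNIV = D z / (?x - z)"
    using infsum_gam_gam[OF nl z(1)] D_lam[of "e k"] xz by (simp add: field_simps)
  also have "?S / D z * (D z / (?x - z)) = ?S / (?x - z)" using z(2) by simp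
  also have "infsum (\<lambda>n. gam L ?x n * (gam L z n * f n)) UNIV = (infsum (\<lambda>n. gam L ?x n * f n) UNIV - ?S) / (?x - z)"
  proof -
    have "(?x - z) * infsum (\<lambda>n. gam L ?x n * (gam L z n * f n)) UNIV = infsum (\<lambda>n. (?x - z) * (gam L z n * gam L ?x n) * f n) UNIV"
      by (subst infsum_cmult_right'[symmetric]) (simp add: mult_ac)
    also have "\<dots> = infsum (\<lambda>n. gam L ?x n * f n + - (gam L z n * f n)) UNIV"
      unfolding gam_diff[OF z(1) nl, symmetric] by (simp add: algebra_simps)
    also have "\<dots> = infsum (\<lambda>n. gam L ?x n * f n) UNIV + - ?S"
      by (subst infsum_add) (auto intro!: l2_mult_summable l2_gam f simp: infsum_uminus summable_on_uminus)
    finally show ?thesis using xz by (simp add: field_simps)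
  qed
  also have "(infsum (\<lambda>n. gam L ?x n * f n) UNIV - ?S) / (?x - z) + ?S / (?x - z) = infsum (\<lambda>n. gam L ?x n * f n) UNIV / (?x - z)"
    by (simp add: diff_divide_distrib)
  finally show ?thesis
    unfolding inner_psi_rep[OF True] using True by (simp add: ev_def)
next
  case False
  let ?S = "infsum (\<lambda>n. gam L z n * f n) UNIV"
  have "l2inner (psi k) (resolv L EB z f) =
      (\<Sum>n | e n = e k. (complex_of_real (hh k n) * f n) / (complex_of_real (e k) - z) + complex_of_real (hh k n) * (?S / D z / (complex_of_real (e k) - z)))"
    unfolding inner_psi_nonrep[OF False] resolv_eq
    by (intro sum.cong) (auto simp: gam_def field_simps)
  also have "\<dots> = l2inner (psi k) f / (complex_of_real (e k) - z) + complex_of_real (\<Sum>n | e n = e k. hh k n) * (?S / D z / (complex_of_real (e k) - z))"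
    unfolding inner_psi_nonrep[OF False] by (simp add: sum.distrib sum_distrib_right sum_divide_distrib)
  finally show ?thesis using sum_hh_zero[OF False] False by (simp add: ev_def)
qed

lemma ev_ge_EB: "EB \<le> ev k"
  using EB_le_lam[of "e k"] EB_neg ksq_nonneg[of L k] by (auto simp: ev_def intro: order_trans[of _ 0])

text \<open>A nonzero orthogonal complement would be invariant under the resolvent and contain one
  of its eigenvectors. Every such eigenvector is either a zero-sum function on a level or a multiple
  of \<open>gam\<close> at a zero of \<open>F\<close>, hence already in the span of the
  \<open>psi\<close>.\<close>

lemma psi_total:
  assumes f0: "l2 f0" "\<And>k. l2inner (psi k) f0 = 0" shows "f0 = (\<lambda>_. 0)"
proof (rule ccontr)
  assume ne: "f0 \<noteq> (\<lambda>_. 0)"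
  \<comment> \<open>A real point below the spectrum makes both the diagonal entries and the rank-one
    coefficient \<open>1 / F z\<close> positive.\<close>
  define z where "z = EB - 1"
  let ?V = "{f. l2 f \<and> (\<forall>j. l2inner (psi j) f = 0)}"
  have z_lt: "z < e n" for n using ksq_nonneg[of L n] EB_neg unfolding z_def by linarith
  then have z_range: "z \<notin> range e" by force
  then have nl: "nonlevel (complex_of_real z)" by auto
  have Fz: "0 < F z" using F_strict_antimono[of 0 z EB] F_EB EB_neg by (simp add: gap_zero z_def)
  have Dz: "D (complex_of_real z) = complex_of_real (F z)" by (rule D_real[OF z_range])
  have evz: "complex_of_real (ev k) \<noteq> complex_of_real z" for k unfolding of_real_eq_iff using ev_ge_EB[of k] by (simp add: z_def)
  let ?T = "\<lambda>f n. complex_of_real (r z n) * f n + complex_of_real (1 / F z) * l2inner (gam L (complex_of_real z)) f * gam L (complex_of_real z) n"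
  have T: "?T f = resolv L EB (complex_of_real z) f" for f
    unfolding resolv_eq[abs_def] Dz by (auto simp: gam_real l2inner_def field_simps)
  have "\<exists>f M. f \<in> ?V \<and> f \<noteq> (\<lambda>_. 0) \<and> M > 0 \<and> ?T f = (\<lambda>n. complex_of_real M * f n)"
  proof (rule rank_one_perturbation_eigenvector[where C = "1 / (- z)"])
    show "l2 (\<lambda>n. complex_of_real (r z n))" using l2_gam[of "complex_of_real z"] by (simp add: gam_real[abs_def])
    show "0 < r z n" for n using z_lt by (rule r_pos)
    show "r z n \<le> 1 / (- z)" for n
      using EB_neg ksq_nonneg[of L n] by (auto simp: r_def z_def intro!: frac_le)
    show "l2 (gam L (complex_of_real z))" by (rule l2_gam)
    show "0 \<le> 1 / F z" using Fz by simp
    show "l2 (psi j)" for j by (rule l2_psi)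
    show "?T f \<in> ?V" if "f \<in> ?V" for f
      unfolding T using that l2_resolv hat_resolv[OF nl _ evz] Dz Fz by simp
    show "f0 \<in> ?V" using f0 by simp
    show "f0 \<noteq> (\<lambda>_. 0)" by (rule ne)
  qed
  then obtain f M where f: "l2 f" "\<And>j. l2inner (psi j) f = 0" "f \<noteq> (\<lambda>_. 0)" and M: "M > 0"
    and Tf: "?T f = (\<lambda>n. complex_of_real M * f n)" by blast
  define c where "c = complex_of_real (1 / F z) * l2inner (gam L (complex_of_real z)) f"
  \<comment> \<open>The eigenvalue of h that corresponds to the eigenvalue \<open>M\<close> of its
    resolvent at \<open>z\<close>.\<close>
  define x where "x = z + 1 / M"
  have eq: "complex_of_real M * (complex_of_real (e n) - complex_of_real x) * f n = c" for n
  proof -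
    have "complex_of_real (r z n) * f n + c * complex_of_real (r z n) = complex_of_real M * f n"
      using fun_cong[OF Tf, of n] by (simp add: c_def gam_real)
    then have "complex_of_real (e n - z) * (complex_of_real (r z n) * f n + c * complex_of_real (r z n)) = complex_of_real (e n - z) * (complex_of_real M * f n)"
      by simp
    moreover have "complex_of_real (e n - z) * complex_of_real (r z n) = 1"
      using z_lt[of n] by (simp add: r_def flip: of_real_mult)
    ultimately have "f n + c = complex_of_real (e n - z) * complex_of_real M * f n"
      by (simp add: algebra_simps)
    then have "c = (complex_of_real (e n - z) * complex_of_real M - 1) * f n"
      by (simp add: algebra_simps)
    moreover have "complex_of_real M * (complex_of_real (e n) - complex_of_real x) = complex_of_real (e n - z) * complex_of_real M - 1"
      using M by (simp add: x_def field_simps)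
    ultimately show ?thesis by simp
  qed
  have inner_c: "infsum (\<lambda>n. gam L (complex_of_real z) n * f n) UNIV = complex_of_real (F z) * c"
    using Fz by (simp add: c_def l2inner_def)
  show False
  proof (cases "x \<in> range e")
    case True
    then obtain m where m: "x = e m" by auto
    have c0: "c = 0" using eq[of m] m by simp
    have supp: "f n = 0" if "e n \<noteq> x" for n
      using eq[of n] c0 M that by simp
    have fin: "finite {n. e n = x}" by (rule finite_level)
    have "infsum (\<lambda>n. gam L (complex_of_real z) n * f n) UNIV = infsum (\<lambda>n. gam L (complex_of_real z) n * f n) {n. e n = x}"
      by (rule infsum_cong_neutral) (use supp in auto)
    also have "\<dots> = complex_of_real (1 / (x - z)) * (\<Sum>n | e n = x. f n)"
      using fin by (simp add: sum_distrib_left gam_real r_def)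
    finally have "(\<Sum>n | e n = x. f n) = 0"
      using inner_c c0 z_lt[of m] m by (simp del: of_real_divide)
    let ?a = "rep x"
    have a: "e ?a = x" "isrep ?a" using True e_rep isrep_rep by auto
    have sm: "f ?a + (\<Sum>n\<in>{n. e n = x} - {?a}. f n) = 0"
      using sum.remove[OF fin, of ?a f] a \<open>(\<Sum>n | e n = x. f n) = 0\<close> by simp
    \<comment> \<open>Orthogonality to the rows \<open>hh k\<close>, combined with zero sum, fixes
      every value on the level as \<open>- \<kappa>\<close> times the one at the representative.
      Zero sum then reads \<open>1 - (q * q - 1) * \<kappa> = - q\<close> times that value, which
      must vanish.\<close>
    define \<kappa> where "\<kappa> = 1 / sqrt (degen ?a) + 1 / (degen ?a - sqrt (degen ?a))"
    have fk: "f k = - complex_of_real \<kappa> * f ?a" if k: "e k = x" "k \<noteq> ?a" for k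
    proof -
      have nr: "\<not> isrep k" using k by (simp add: isrep_def)
      have mk: "degen k = degen ?a" using k a by (simp add: degen_def)
      have "0 = f k + complex_of_real (1 / sqrt (degen ?a)) * f ?a - complex_of_real (1 / (degen ?a - sqrt (degen ?a))) * (\<Sum>n\<in>{n. e n = x} - {?a}. f n)"
        using sum_hh[OF nr, of f] f(2)[of k] inner_psi_nonrep[OF nr, of f] k mk by simp
      also have "(\<Sum>n\<in>{n. e n = x} - {?a}. f n) = - f ?a" using sm by (simp add: eq_neg_iff_add_eq_0 add.commute)
      finally show ?thesis
        by (simp add: \<kappa>_def algebra_simps del: of_real_divide) (simp add: eq_neg_iff_add_eq_0 add.commute add.left_commute)
    qed
    have "f ?a = 0"
    proof (cases "{n. e n = x} - {?a} = {}")
      case True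
      then show ?thesis using sm by (metis add.right_neutral sum.empty)
    next
      case False
      then obtain k where "e k = x" "k \<noteq> ?a" by auto
      then have nr: "\<not> isrep k" and mk: "degen k = degen ?a" using a by (auto simp: isrep_def degen_def)
      obtain q where q: "q > 1" "sqrt (degen ?a) = q" "degen ?a = q * q" using sqrt_degen[OF nr] mk by metis
      have card: "real (card ({n. e n = x} - {?a})) = q * q - 1"
        using fin a degen_gt_1[OF nr] mk q(3)
        by (subst card_Diff_singleton) (auto simp: degen_def of_nat_diff)
      have "f ?a + (\<Sum>n\<in>{n. e n = x} - {?a}. - complex_of_real \<kappa> * f ?a) = 0"
        using sm fk by (subst (asm) sum.cong[OF refl, of _ f "\<lambda>_. - complex_of_real \<kappa> * f ?a"]) auto
      moreover have "(\<Sum>n\<in>{n. e n = x} - {?a}. - complex_of_real \<kappa> * f ?a) = complex_of_real (q * q - 1) * (- complex_of_real \<kappa> * f ?a)"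
        by (simp only: sum_constant card[symmetric] of_real_of_nat_eq)
      ultimately have "complex_of_real (1 - (q * q - 1) * \<kappa>) * f ?a = 0"
        by (simp add: algebra_simps)
      moreover have \<kappa>: "\<kappa> = 1 / (q - 1)"
        using q by (simp add: \<kappa>_def field_simps)
      have "1 - (q * q - 1) * \<kappa> = - q" unfolding \<kappa> using q(1) by (simp add: field_simps)
      ultimately show ?thesis using q by simp
    qed
    then have "f n = 0" for n using fk[of n] supp[of n] by (cases "n = ?a") auto
    then show False using f(3) by auto
  next
    case False
    then have nlx: "nonlevel (complex_of_real x)" by auto
    \<comment> \<open>Away from the levels the eigenvalue equation leaves only a multiple of
      \<open>gam\<close>; inserting it into the definition of \<open>c\<close> forces
      \<open>F x = 0\<close>.\<close>
    have fx: "f n = (c / complex_of_real M) * gam L (complex_of_real x) n" for n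
    proof -
      have "complex_of_real (e n) - complex_of_real x \<noteq> 0" using spec[OF nlx, of n] by simp
      then show ?thesis using eq[of n, symmetric] M by (simp add: gam_def)
    qed
    have c0: "c \<noteq> 0" using fx f(3) by auto
    have "infsum (\<lambda>n. gam L (complex_of_real z) n * f n) UNIV = (c / complex_of_real M) * infsum (\<lambda>n. gam L (complex_of_real z) n * gam L (complex_of_real x) n) UNIV"
      by (subst infsum_cmult_right'[symmetric]) (simp add: fx mult_ac)
    then have "complex_of_real (x - z) * (complex_of_real (F z) * c) = (c / complex_of_real M) *
        ((complex_of_real x - complex_of_real z) * infsum (\<lambda>n. gam L (complex_of_real z) n * gam L (complex_of_real x) n) UNIV)"
      unfolding inner_c by (simp add: mult_ac)
    then have "complex_of_real (x - z) * (complex_of_real (F z) * c) = (c / complex_of_real M) * (D (complex_of_real z) - D (complex_of_real x))"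
      unfolding infsum_gam_gam[OF nl nlx] .
    then have "complex_of_real (F z) * c = c * (complex_of_real (F z) - complex_of_real (F x))"
      using Dz D_real[OF False] M by (simp add: x_def)
    then have "F x = 0" using c0 by simp
    then obtain s where s: "s \<in> range e" "x = lam s" using root_is_lam False by blast
    have "l2inner (psi (rep s)) f = complex_of_real (nrm (rep s))
        * ((c / complex_of_real M) * infsum (\<lambda>n. gam L (complex_of_real x) n * gam L (complex_of_real x) n) UNIV)"
      using inner_psi_rep[OF isrep_rep[OF s(1)], of f] s e_rep[OF s(1)]
      by (simp add: infsum_cmult_right'[symmetric] fx mult_ac)
    also have "infsum (\<lambda>n. gam L (complex_of_real x) n * gam L (complex_of_real x) n) UNIV = complex_of_real ((l2norm (gam L (complex_of_real x)))^2)"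
      using l2inner_self[OF l2_gam, of "complex_of_real x"] by (simp add: l2inner_def)
    finally show False
      using f(2)[of "rep s"] c0 M norm_gam_pos[OF s(1)] s e_rep[OF s(1)] by (simp add: nrm_def)
  qed
qed

lemma unitary_psi: "unitary_kernel psi"
  by (rule unitary_kernelI_total[OF orthonormal_psi]) (use psi_total in blast)

lemma ev_i: "complex_of_real (ev k) \<noteq> \<i>"
  by (simp add: complex_eq_iff)

text \<open>Both sides have the same coefficients by \<open>hat_resolv\<close>, hence agree by
  totality. This exhibits \<open>psi k\<close> in the range of the resolvent, that is, in the domain
  of h.\<close>

lemma resolv_psi: "resolv L EB \<i> (\<lambda>n. (complex_of_real (ev k) - \<i>) * psi k n) = psi k"
proof -
  let ?f = "\<lambda>n. (complex_of_real (ev k) - \<i>) * psi k n"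
  have lf: "l2 ?f" by (intro l2_cmult l2_psi)
  have "(\<lambda>n. resolv L EB \<i> ?f n - psi k n) = (\<lambda>_. 0)"
  proof (rule psi_total)
    show "l2 (\<lambda>n. resolv L EB \<i> ?f n - psi k n)" by (intro l2_diff l2_resolv lf l2_psi)
    fix j
    have "l2inner (psi j) (resolv L EB \<i> ?f) = l2inner (psi j) (psi k)"
      using hat_resolv[OF D_i ev_i lf, of j] ev_i[of j] ev_i[of k] orthonormal_inner[OF orthonormal_psi, of j k]
      by (simp add: l2inner_cmult_right)
    then show "l2inner (psi j) (\<lambda>n. resolv L EB \<i> ?f n - psi k n) = 0"
      using l2inner_diff_right[OF l2_psi l2_resolv[OF lf] l2_psi, of j \<i> k] by simp
  qed
  then have "resolv L EB \<i> ?f n - psi k n = 0" for n by (rule fun_cong)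
  then show ?thesis by auto
qed

sublocale eigenbasis psi ev "hgraph L EB"
proof
  show "unitary_kernel psi" by (rule unitary_psi)
  fix k
  let ?f = "\<lambda>n. (complex_of_real (ev k) - \<i>) * psi k n"
  have "(\<lambda>n. complex_of_real (ev k) * psi k n) = (\<lambda>n. ?f n + \<i> * resolv L EB \<i> ?f n)"
    unfolding resolv_psi by (auto simp: algebra_simps)
  moreover have "(psi k, \<lambda>n. ?f n + \<i> * resolv L EB \<i> ?f n) \<in> hgraph L EB"
    unfolding hgraph_def using l2_cmult[OF l2_psi] resolv_psi[of k] by (intro CollectI exI[of _ ?f]) auto
  ultimately show "(psi k, \<lambda>n. complex_of_real (ev k) * psi k n) \<in> hgraph L EB" by simp
next
  fix a b :: "int \<times> int \<Rightarrow> complex" assume "(a, b) \<in> hgraph L EB"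
  then obtain f where f: "l2 f" and a: "a = resolv L EB \<i> f" and b: "b = (\<lambda>n. f n + \<i> * resolv L EB \<i> f n)"
    by (auto simp: hgraph_def)
  show "l2 a \<and> l2 b" unfolding a b using f l2_resolv by (auto intro!: l2_add l2_cmult)
  fix j
  have "l2inner (psi j) b = l2inner (psi j) f + \<i> * l2inner (psi j) a"
    unfolding a b using l2inner_add_right[OF l2_psi f l2_cmult[OF l2_resolv[OF f]]] by (simp add: l2inner_cmult_right)
  moreover have "l2inner (psi j) a = l2inner (psi j) f / (complex_of_real (ev j) - \<i>)"
    unfolding a by (rule hat_resolv[OF D_i ev_i f])
  then have "l2inner (psi j) f = (complex_of_real (ev j) - \<i>) * l2inner (psi j) a"
    using ev_i[of j] by simp
  ultimately show "l2inner (psi j) b = complex_of_real (ev j) * l2inner (psi j) a"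
    by (simp add: algebra_simps)
qed

text \<open>An eigenvalue never exceeds its level, and one pushed down from a level above
  \<open>\<mu>\<close> stays above all levels up to \<open>\<mu>\<close>. So these momenta index the
  lowest eigenvalues.\<close>

lemma Egs_eq: "Egs L EB \<mu> = (\<Sum>k | e k \<le> \<mu>. ev k)"
  unfolding Egs_def
proof (rule Inf_spectrum_dGamma)
  show "finite {k. e k \<le> \<mu>}" by (rule finite_sublevel)
  show "card {k. e k \<le> \<mu>} = Nmu L \<mu>" by (simp add: Nmu_def)
  fix i j assume i: "i \<in> {k. e k \<le> \<mu>}" and j: "j \<notin> {k. e k \<le> \<mu>}"
  have "ev i \<le> e i" using gapD(1)[OF lam(1), of "e i"] by (auto simp: ev_def)
  moreover have "e i \<le> ev j" using gapD(2)[OF lam(1), of "e j" i] i j by (auto simp: ev_def)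
  ultimately show "ev i \<le> ev j" by simp
qed

lemma Egs_minus_E0: "Egs L EB \<mu> - E0 L \<mu> = (\<Sum>s\<in>{s \<in> range e. s \<le> \<mu>}. lam s - s)"
proof -
  have "Egs L EB \<mu> - E0 L \<mu> = (\<Sum>k | e k \<le> \<mu>. ev k - e k)"
    by (simp add: Egs_eq E0_def sum_subtractf)
  also have "\<dots> = (\<Sum>k | e k \<le> \<mu> \<and> isrep k. lam (e k) - e k)"
    by (rule sum.mono_neutral_cong_right[OF finite_sublevel]) (auto simp: ev_def)
  also have "\<dots> = (\<Sum>s\<in>{s \<in> range e. s \<le> \<mu>}. lam s - s)"
    by (rule sum.reindex_bij_witness[where i = rep and j = e]) (auto simp: e_rep isrep_rep isrep_def)
  finally show ?thesis .
qed

end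

section \<open>Two-sided bounds on the ground state energy\<close>

lemma coeff_prod_linear:
  fixes f :: "'i \<Rightarrow> real"
  assumes "finite S"
  shows "coeff (\<Prod>i\<in>S. [:- f i, 1:]) (card S) = 1 \<and> (\<forall>k>card S. coeff (\<Prod>i\<in>S. [:- f i, 1:]) k = 0)
    \<and> (\<forall>n. card S = Suc n \<longrightarrow> coeff (\<Prod>i\<in>S. [:- f i, 1:]) n = - sum f S)"
  using assms
proof (induction S rule: finite_induct)
  case empty
  then show ?case by (auto simp: coeff_1)
next
  case (insert a S)
  let ?p = "\<Prod>i\<in>S. [:- f i, 1:]"
  have c: "coeff ([:- f a, 1:] * ?p) k = - f a * coeff ?p k + (case k of 0 \<Rightarrow> 0 | Suc j \<Rightarrow> coeff ?p j)" for k
    by (simp add: coeff_pCons)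
  have n: "coeff ?p n = - sum f S" if "card S = Suc n" for n using insert.IH that by blast
  show ?case
    unfolding prod.insert[OF insert.hyps(1,2)] card_insert_disjoint[OF insert.hyps(1,2)] sum.insert[OF insert.hyps(1,2)] c
  proof (intro conjI allI impI)
    show "- f a * coeff ?p (Suc (card S)) + (case Suc (card S) of 0 \<Rightarrow> 0 | Suc j \<Rightarrow> coeff ?p j) = 1"
      using insert.IH by simp
    show "- f a * coeff ?p k + (case k of 0 \<Rightarrow> 0 | Suc j \<Rightarrow> coeff ?p j) = 0" if "Suc (card S) < k" for k
      using insert.IH that by (cases k) auto
    show "- f a * coeff ?p k + (case k of 0 \<Rightarrow> 0 | Suc j \<Rightarrow> coeff ?p j) = - (f a + sum f S)" if "Suc (card S) = Suc k" for k
      using insert.IH that n by (cases k) (auto simp: card_eq_0_iff insert.hyps)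
  qed
qed

text \<open>Boole's identity: compare the two leading coefficients of the monic polynomial whose zeros are the \<open>\<rho> t\<close>.\<close>

lemma sum_shifts_secular_equation:
  fixes S :: "real set" and m \<rho> :: "real \<Rightarrow> real"
  assumes fin: "finite S" and inj: "inj_on \<rho> S" and notin: "\<And>t. t \<in> S \<Longrightarrow> \<rho> t \<notin> S"
    and eq: "\<And>t. t \<in> S \<Longrightarrow> \<kappa> * (\<Sum>s\<in>S. m s / (s - \<rho> t)) = 1"
  shows "(\<Sum>s\<in>S. s - \<rho> s) = \<kappa> * sum m S"
proof (cases "S = {}")
  case False
  then obtain n where n: "card S = Suc n" using fin by (metis card_0_eq not0_implies_Suc)
  let ?A = "\<Prod>s\<in>S. [:- s, 1:]" and ?C = "\<Prod>s\<in>S. [:- \<rho> s, 1:]"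
  let ?Q = "\<lambda>s. \<Prod>s'\<in>S - {s}. [:- s', 1:]"
  \<comment> \<open>\<open>B\<close> is the product of the linear factors times the function
    \<open>1 - \<kappa> * (\<Sum>s\<in>S. m s / (s - x))\<close>, with denominators cleared, so the
    \<open>\<rho> t\<close> are zeros of it.\<close>
  define B where "B = ?A + smult \<kappa> (\<Sum>s\<in>S. smult (m s) (?Q s))"
  have cQ: "card (S - {s}) = n" if "s \<in> S" for s using n fin that by simp
  have cA: "coeff ?A (Suc n) = 1" "\<And>k. k > Suc n \<Longrightarrow> coeff ?A k = 0" "coeff ?A n = - \<Sum>S"
    using coeff_prod_linear[OF fin, of "\<lambda>s. s"] n by auto
  have cC: "coeff ?C (Suc n) = 1" "\<And>k. k > Suc n \<Longrightarrow> coeff ?C k = 0" "coeff ?C n = - sum \<rho> S"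
    using coeff_prod_linear[OF fin, of \<rho>] n by auto
  have cQ': "coeff (?Q s) n = 1" "\<And>k. k > n \<Longrightarrow> coeff (?Q s) k = 0" if "s \<in> S" for s
    using coeff_prod_linear[of "S - {s}" "\<lambda>s. s"] cQ[OF that] fin by auto
  have cB: "coeff B k = coeff ?A k + \<kappa> * (\<Sum>s\<in>S. m s * coeff (?Q s) k)" for k
    by (simp add: B_def coeff_sum)
  have B0: "poly B (\<rho> t) = 0" if t: "t \<in> S" for t
  proof -
    have nz: "\<rho> t - s \<noteq> 0" if "s \<in> S" for s using notin[OF t] that by auto
    have "poly (?Q s) (\<rho> t) = poly ?A (\<rho> t) / (\<rho> t - s)" if "s \<in> S" for s
      using prod.remove[OF fin that, of "\<lambda>s. \<rho> t - s"] nz[OF that] by (simp add: poly_prod)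
    then have "poly B (\<rho> t) = poly ?A (\<rho> t) + \<kappa> * (\<Sum>s\<in>S. m s * (poly ?A (\<rho> t) / (\<rho> t - s)))"
      by (simp add: B_def poly_sum)
    also have "(\<Sum>s\<in>S. m s * (poly ?A (\<rho> t) / (\<rho> t - s))) = (\<Sum>s\<in>S. - poly ?A (\<rho> t) * (m s / (s - \<rho> t)))"
    proof (intro sum.cong refl)
      have "a * (b / (- d)) = - b * (a / d)" for a b d :: real by simp
      from this[of "m s" "poly ?A (\<rho> t)" "s - \<rho> t" for s]
      show "m s * (poly ?A (\<rho> t) / (\<rho> t - s)) = - poly ?A (\<rho> t) * (m s / (s - \<rho> t))" for s
        by (simp only: minus_diff_eq)
    qed
    also have "\<dots> = - poly ?A (\<rho> t) * (\<Sum>s\<in>S. m s / (s - \<rho> t))"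
      by (simp only: sum_distrib_left)
    also have "poly ?A (\<rho> t) + \<kappa> * (- poly ?A (\<rho> t) * (\<Sum>s\<in>S. m s / (s - \<rho> t))) =
        poly ?A (\<rho> t) * (1 - \<kappa> * (\<Sum>s\<in>S. m s / (s - \<rho> t)))"
      by (simp add: algebra_simps)
    also have "\<dots> = 0" using eq[OF t] by simp
    finally show ?thesis .
  qed
  \<comment> \<open>Both polynomials are monic of degree \<open>Suc n\<close>, so the difference has
    degree at most \<open>n\<close> but \<open>Suc n\<close> zeros.\<close>
  have "B - ?C = 0"
  proof (rule ccontr)
    assume nz: "B - ?C \<noteq> 0"
    have "degree (B - ?C) \<le> n"
    proof (rule degree_le, intro allI impI)
      fix k assume "n < k"
      then have "coeff B k = coeff ?C k"
        unfolding cB using cA cC cQ' by (cases "k = Suc n") auto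
      then show "coeff (B - ?C) k = 0" by simp
    qed
    moreover have "\<rho> ` S \<subseteq> {x. poly (B - ?C) x = 0}"
      using B0 fin by (auto simp: poly_prod intro!: prod_zero)
    then have "card (\<rho> ` S) \<le> card {x. poly (B - ?C) x = 0}"
      by (intro card_mono poly_roots_finite nz)
    then have "Suc n \<le> degree (B - ?C)"
      using card_poly_roots_bound[OF nz] card_image[OF inj] n by linarith
    ultimately show False by simp
  qed
  then have "coeff B n = coeff ?C n" by simp
  then have "- \<Sum>S + \<kappa> * sum m S = - sum \<rho> S"
    unfolding cB using cA cC cQ' by simp
  then show ?thesis by (simp add: sum_subtractf)
qed simp

text \<open>The interval of the largest element \<open>b\<close> starts at \<open>a b\<close>, and
  all the others must fit between \<open>y\<close> and that point.\<close>

lemma sum_disjoint_intervals_le: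
  fixes a :: "real \<Rightarrow> real"
  assumes "finite T" "y \<le> \<mu>" "\<And>s. s \<in> T \<Longrightarrow> y \<le> a s \<and> a s \<le> s \<and> s \<le> \<mu>"
    "\<And>s t. s \<in> T \<Longrightarrow> t \<in> T \<Longrightarrow> s < t \<Longrightarrow> s \<le> a t"
  shows "(\<Sum>s\<in>T. s - a s) \<le> \<mu> - y"
  using assms
proof (induction T arbitrary: \<mu> rule: finite_linorder_max_induct)
  case (insert b T)
  have b: "y \<le> a b" "a b \<le> b" "b \<le> \<mu>" using insert.prems by auto
  have "(\<Sum>s\<in>T. s - a s) \<le> a b - y"
  proof (rule insert.IH)
    show "y \<le> a s \<and> a s \<le> s \<and> s \<le> a b" if "s \<in> T" for s
      using insert.prems(2)[of s] insert.prems(3)[of s b] insert.hyps that by auto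
  qed (use insert.prems b in auto)
  then show ?case using insert.hyps b by (subst sum.insert) auto
qed simp

context point_interaction begin

section \<open>Comparison of the eigenvalues with the roots for a constant right-hand side\<close>

definition levels :: "real \<Rightarrow> real set" where "levels \<mu> = {s \<in> range e. s \<le> \<mu>}"

lemma finite_levels: "finite (levels \<mu>)"
  unfolding levels_def by (rule finite_levels_le)

lemma sum_levels:
  fixes \<phi> :: "real \<Rightarrow> real"
  shows "(\<Sum>n | e n \<le> \<mu>. \<phi> (e n)) = (\<Sum>s\<in>levels \<mu>. real (card {n. e n = s}) * \<phi> s)"
proof -
  have im: "e ` {n. e n \<le> \<mu>} = levels \<mu>" by (auto simp: levels_def)
  have "(\<Sum>n | e n \<le> \<mu>. \<phi> (e n)) = (\<Sum>s\<in>levels \<mu>. \<Sum>n\<in>{x \<in> {n. e n \<le> \<mu>}. e x = s}. \<phi> (e n))"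
    using sum.image_gen[OF finite_sublevel, of "\<lambda>n. \<phi> (e n)" \<mu> e] unfolding im .
  also have "\<dots> = (\<Sum>s\<in>levels \<mu>. real (card {n. e n = s}) * \<phi> s)"
  proof (intro sum.cong refl)
    fix s assume "s \<in> levels \<mu>"
    then have "{x \<in> {n. e n \<le> \<mu>}. e x = s} = {n. e n = s}" by (auto simp: levels_def)
    then show "(\<Sum>n\<in>{x \<in> {n. e n \<le> \<mu>}. e x = s}. \<phi> (e n)) = real (card {n. e n = s}) * \<phi> s" by simp
  qed
  finally show ?thesis .
qed

lemma ex_secular_root:
  assumes "0 < \<kappa>" "s \<in> levels \<mu>" shows "\<exists>x. gap s x \<and> P \<mu> x = 1 / \<kappa>"
proof (rule root_exists)
  show s: "s \<in> range e" and s\<mu>: "s \<le> \<mu>" using assms by (auto simp: levels_def)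
  show "\<exists>x. gap s x \<and> P \<mu> x < 1 / \<kappa>"
  proof (cases "s = 0")
    case False
    then show ?thesis using lower_point[OF s _ s\<mu>] level_nonneg[OF s] by simp
  next
    case True
    define N where "N = real (card {n. e n \<le> \<mu>})"
    \<comment> \<open>The level 0 has no predecessor, so a low value of \<open>P\<close> is found
      far to the left, where each of the \<open>N\<close> terms is at most
      \<open>1 / (- x)\<close>.\<close>
    define x where "x = - (N * \<kappa> + 1)"
    have N: "0 \<le> N" by (simp add: N_def)
    then have x: "x < 0" using mult_nonneg_nonneg[OF N less_imp_le[OF assms(1)]] unfolding x_def by linarith
    have "P \<mu> x \<le> (\<Sum>n | e n \<le> \<mu>. 1 / (- x))"
      unfolding P_def r_def using x ksq_nonneg[of L] by (intro sum_mono frac_le) auto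
    also have "\<dots> = N / (N * \<kappa> + 1)" by (simp add: N_def x_def)
    also have "\<dots> < 1 / \<kappa>"
      using assms(1) N x by (simp add: divide_simps x_def)
    finally show ?thesis using True x by (intro exI[of _ x]) (simp add: gap_zero)
  qed
qed auto

definition rho :: "real \<Rightarrow> real \<Rightarrow> real \<Rightarrow> real" where
  "rho \<mu> \<kappa> s = (SOME x. gap s x \<and> P \<mu> x = 1 / \<kappa>)"

lemma rho:
  assumes "0 < \<kappa>" "s \<in> levels \<mu>" shows "gap s (rho \<mu> \<kappa> s)" "P \<mu> (rho \<mu> \<kappa> s) = 1 / \<kappa>"
  using someI_ex[OF ex_secular_root[OF assms]] by (auto simp: rho_def)

text \<open>Interlacing with the levels makes the roots distinct and different from the levels, as
  \<open>sum_shifts_secular_equation\<close> requires; the multiplicities add up to the particle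
  number.\<close>

lemma sum_rho:
  assumes "0 < \<kappa>" shows "(\<Sum>s\<in>levels \<mu>. s - rho \<mu> \<kappa> s) = \<kappa> * real (Nmu L \<mu>)"
proof -
  let ?m = "\<lambda>s. real (card {n. e n = s})"
  have "(\<Sum>s\<in>levels \<mu>. s - rho \<mu> \<kappa> s) = \<kappa> * sum ?m (levels \<mu>)"
  proof (rule sum_shifts_secular_equation[OF finite_levels])
    show "inj_on (rho \<mu> \<kappa>) (levels \<mu>)"
    proof (rule strict_mono_on_imp_inj_on, rule strict_mono_onI)
      fix s t assume st: "s \<in> levels \<mu>" "t \<in> levels \<mu>" "s < t"
      then obtain n where "s = e n" by (auto simp: levels_def)
      then have "s < rho \<mu> \<kappa> t" using gapD(2)[OF rho(1)[OF assms st(2)], of n] st(3) by simp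
      then show "rho \<mu> \<kappa> s < rho \<mu> \<kappa> t" using gapD(1)[OF rho(1)[OF assms st(1)]] by simp
    qed
    fix t assume t: "t \<in> levels \<mu>"
    show "rho \<mu> \<kappa> t \<notin> levels \<mu>" using gap_not_level[OF rho(1)[OF assms t]] unfolding levels_def by (metis (mono_tags) imageE mem_Collect_eq)
    have "P \<mu> (rho \<mu> \<kappa> t) = (\<Sum>s\<in>levels \<mu>. ?m s / (s - rho \<mu> \<kappa> t))"
      using sum_levels[of "\<lambda>s. 1 / (s - rho \<mu> \<kappa> t)" \<mu>] by (simp add: P_def r_def)
    then have "(\<Sum>s\<in>levels \<mu>. ?m s / (s - rho \<mu> \<kappa> t)) = 1 / \<kappa>" using rho(2)[OF assms t] by simp
    then show "\<kappa> * (\<Sum>s\<in>levels \<mu>. ?m s / (s - rho \<mu> \<kappa> t)) = 1"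
      unfolding \<open>(\<Sum>s\<in>levels \<mu>. ?m s / (s - rho \<mu> \<kappa> t)) = 1 / \<kappa>\<close> using assms by simp
  qed
  moreover have "sum ?m (levels \<mu>) = real (Nmu L \<mu>)"
    using sum_levels[of "\<lambda>_. 1" \<mu>] by (simp add: Nmu_def)
  ultimately show ?thesis by simp
qed

lemma P_mono_iff:
  assumes "gap s x" "gap s y" "0 \<le> \<mu>" "P \<mu> x \<le> P \<mu> y" shows "x \<le> y"
  using P_strict_mono[OF assms(2,1) _ assms(3)] assms(4) by fastforce

lemma P_lam:
  assumes "s \<in> levels \<mu>" shows "P \<mu> (lam s) = g \<mu> (lam s)"
  using F_eq[of "lam s" \<mu>] lam(2)[of s] assms by (simp add: levels_def)

text \<open>Every \<open>lam\<close> is at least \<open>EB\<close> and hence at least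
  \<open>x\<close>, so replacing \<open>g\<close> by its value at \<open>x\<close> raises the
  right-hand side and moves each root up.\<close>

lemma Egs_upper:
  assumes "0 \<le> \<mu>" "x \<le> EB" "0 < g \<mu> x"
  shows "Egs L EB \<mu> - E0 L \<mu> \<le> - real (Nmu L \<mu>) / g \<mu> x"
proof -
  let ?\<kappa> = "1 / g \<mu> x"
  have \<kappa>: "0 < ?\<kappa>" using assms by simp
  have "lam s \<le> rho \<mu> ?\<kappa> s" if s: "s \<in> levels \<mu>" for s
  proof (rule P_mono_iff[OF _ rho(1)[OF \<kappa> s] assms(1)])
    have sr: "s \<in> range e" using s by (simp add: levels_def)
    show gp: "gap s (lam s)" by (rule lam(1)[OF sr])
    have "g \<mu> (lam s) \<le> g \<mu> x"
      using assms(2) EB_le_lam[OF sr] gapD(1)[OF gp] s by (intro g_antimono) (auto simp: levels_def)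
    then show "P \<mu> (lam s) \<le> P \<mu> (rho \<mu> ?\<kappa> s)" unfolding P_lam[OF s] rho(2)[OF \<kappa> s] by simp
  qed
  then have "(\<Sum>s\<in>levels \<mu>. s - rho \<mu> ?\<kappa> s) \<le> (\<Sum>s\<in>levels \<mu>. s - lam s)"
    by (intro sum_mono) auto
  moreover have "Egs L EB \<mu> - E0 L \<mu> = - (\<Sum>s\<in>levels \<mu>. s - lam s)"
    unfolding Egs_minus_E0 levels_def by (simp flip: sum_negf)
  ultimately show ?thesis using sum_rho[OF \<kappa>, of \<mu>] by simp
qed

text \<open>For eigenvalues up to \<open>y\<close>, replacing \<open>g\<close> by its smaller value
  at \<open>y\<close> moves the roots down. Those beyond \<open>y\<close> are not compared: their
  shifts are disjoint intervals inside [y, \<mu>].\<close>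

lemma Egs_lower:
  assumes "0 \<le> \<mu>" "y \<le> \<mu>" "0 < g \<mu> y"
  shows "- real (Nmu L \<mu>) / g \<mu> y - (\<mu> - y) \<le> Egs L EB \<mu> - E0 L \<mu>"
proof -
  let ?\<kappa> = "1 / g \<mu> y" and ?T = "{s \<in> levels \<mu>. lam s > y}" and ?U = "{s \<in> levels \<mu>. lam s \<le> y}"
  have \<kappa>: "0 < ?\<kappa>" using assms by simp
  have lev: "s \<in> range e" "s \<le> \<mu>" if "s \<in> levels \<mu>" for s using that by (auto simp: levels_def)
  have "rho \<mu> ?\<kappa> s \<le> lam s" if "s \<in> ?U" for s
  proof (rule P_mono_iff[OF rho(1)[OF \<kappa>] _ assms(1)])
    show s: "s \<in> levels \<mu>" using that by simp
    show "gap s (lam s)" by (rule lam(1)[OF lev(1)[OF s]])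
    have "g \<mu> y \<le> g \<mu> (lam s)" using that assms(2) by (intro g_antimono) auto
    then show "P \<mu> (rho \<mu> ?\<kappa> s) \<le> P \<mu> (lam s)" unfolding P_lam[OF s] rho(2)[OF \<kappa> s] by simp
  qed
  then have "(\<Sum>s\<in>?U. s - lam s) \<le> (\<Sum>s\<in>?U. s - rho \<mu> ?\<kappa> s)" by (intro sum_mono) auto
  also have "\<dots> \<le> (\<Sum>s\<in>levels \<mu>. s - rho \<mu> ?\<kappa> s)"
    by (rule sum_mono2[OF finite_levels]) (use gapD(1)[OF rho(1)[OF \<kappa>]] in \<open>auto intro: less_imp_le\<close>)
  also have "\<dots> = real (Nmu L \<mu>) / g \<mu> y" using sum_rho[OF \<kappa>, of \<mu>] by simp
  finally have U: "(\<Sum>s\<in>?U. s - lam s) \<le> real (Nmu L \<mu>) / g \<mu> y" .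
  have T: "(\<Sum>s\<in>?T. s - lam s) \<le> \<mu> - y"
  proof (rule sum_disjoint_intervals_le)
    show "finite ?T" using finite_levels by simp
    show "y \<le> lam s \<and> lam s \<le> s \<and> s \<le> \<mu>" if "s \<in> ?T" for s
      using that gapD(1)[OF lam(1)[OF lev(1)], of s] lev(2)[of s] by auto
    show "s \<le> lam t" if st: "s \<in> ?T" "t \<in> ?T" "s < t" for s t
    proof -
      obtain n where "s = e n" using st lev(1)[of s] by auto
      then show ?thesis using gapD(2)[OF lam(1)[OF lev(1)], of t n] st by auto
    qed
  qed (rule assms(2))
  have "levels \<mu> = ?U \<union> ?T" by auto
  then have "(\<Sum>s\<in>levels \<mu>. s - lam s) = (\<Sum>s\<in>?U. s - lam s) + (\<Sum>s\<in>?T. s - lam s)"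
    using sum.union_disjoint[of ?U ?T "\<lambda>s. s - lam s"] finite_levels[of \<mu>] by (simp add: disjoint_iff)
  moreover have "Egs L EB \<mu> - E0 L \<mu> = - (\<Sum>s\<in>levels \<mu>. s - lam s)"
    unfolding Egs_minus_E0 levels_def by (simp flip: sum_negf)
  ultimately show ?thesis using U T by simp
qed

end

section \<open>Lattice sums\<close>

definition qn :: "int \<times> int \<Rightarrow> real" where
  "qn n = (of_int (fst n))^2 + (of_int (snd n))^2"

text \<open>Folds the lattice by the symmetries of the square. Fibres have at most 8 points, and the
  larger entry controls \<open>qn\<close> up to a factor 2, so lattice sums reduce to sums over one
  natural number.\<close>

definition minmax :: "int \<times> int \<Rightarrow> nat \<times> nat" where
  "minmax n = (nat (min \<bar>fst n\<bar> \<bar>snd n\<bar>), nat (max \<bar>fst n\<bar> \<bar>snd n\<bar>))"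

lemma minmax_props:
  shows "fst (minmax n) \<le> snd (minmax n)" "qn n = (real (fst (minmax n)))^2 + (real (snd (minmax n)))^2"
proof -
  show "fst (minmax n) \<le> snd (minmax n)" by (auto simp: minmax_def)
  have "(real (nat \<bar>a\<bar>))^2 = (real_of_int a)^2" for a by simp
  then show "qn n = (real (fst (minmax n)))^2 + (real (snd (minmax n)))^2"
    by (auto simp: minmax_def qn_def min_def max_def)
qed

lemma card_minmax_fiber: "card {n \<in> A. minmax n = p} \<le> 8"
proof -
  obtain m M where p: "p = (m, M)" by (cases p)
  let ?l = "[(int m, int M), (- int m, int M), (int m, - int M), (- int m, - int M),
    (int M, int m), (- int M, int m), (int M, - int m), (- int M, - int m)]"
  have "{n \<in> A. minmax n = p} \<subseteq> set ?l"
  proof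
    fix n assume "n \<in> {n \<in> A. minmax n = p}"
    then have "int m = min \<bar>fst n\<bar> \<bar>snd n\<bar>" "int M = max \<bar>fst n\<bar> \<bar>snd n\<bar>"
      by (auto simp: minmax_def p le_max_iff_disj)
    then have "\<bar>fst n\<bar> = int m \<and> \<bar>snd n\<bar> = int M \<or> \<bar>fst n\<bar> = int M \<and> \<bar>snd n\<bar> = int m"
      by (cases "\<bar>fst n\<bar> \<le> \<bar>snd n\<bar>") (simp_all add: min_def max_def)
    moreover have "x = y \<or> x = - y" if "\<bar>x\<bar> = y" for x y :: int using that by linarith
    ultimately have "(fst n = int m \<or> fst n = - int m) \<and> (snd n = int M \<or> snd n = - int M) \<or>
      (fst n = int M \<or> fst n = - int M) \<and> (snd n = int m \<or> snd n = - int m)" by blast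
    then have "(fst n, snd n) \<in> set ?l" by (elim disjE conjE) simp_all
    then show "n \<in> set ?l" by simp
  qed
  then have "card {n \<in> A. minmax n = p} \<le> card (set ?l)" by (intro card_mono) auto
  also have "\<dots> \<le> length ?l" by (rule card_length)
  finally show ?thesis by simp
qed

lemma sum_minmax_le:
  fixes \<phi> :: "int \<times> int \<Rightarrow> real"
  assumes "finite A" "\<And>n. n \<in> A \<Longrightarrow> \<phi> n \<le> \<psi> (minmax n)" "\<And>n. n \<in> A \<Longrightarrow> 0 \<le> \<psi> (minmax n)"
  shows "sum \<phi> A \<le> 8 * sum \<psi> (minmax ` A)"
proof -
  have "sum \<phi> A \<le> (\<Sum>n\<in>A. \<psi> (minmax n))" using assms by (intro sum_mono) auto
  also have "\<dots> = (\<Sum>p\<in>minmax ` A. \<Sum>n\<in>{n \<in> A. minmax n = p}. \<psi> (minmax n))"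
    by (rule sum.image_gen[OF assms(1)])
  also have "\<dots> = (\<Sum>p\<in>minmax ` A. real (card {n \<in> A. minmax n = p}) * \<psi> p)" by simp
  also have "\<dots> \<le> (\<Sum>p\<in>minmax ` A. 8 * \<psi> p)"
    using card_minmax_fiber[of A] assms(3) by (intro sum_mono mult_right_mono) (auto simp: of_nat_le_iff[of _ 8, simplified])
  finally show ?thesis by (simp add: sum_distrib_left)
qed

lemma sum_pairs_le:
  fixes \<psi> :: "nat \<times> nat \<Rightarrow> real"
  assumes "finite A'" "\<And>p. p \<in> A' \<Longrightarrow> fst p \<le> snd p \<and> snd p \<in> K \<and> \<psi> p \<le> h (snd p)" "finite K"
    "\<And>M. M \<in> K \<Longrightarrow> 0 \<le> h M"
  shows "sum \<psi> A' \<le> (\<Sum>M\<in>K. real (M + 1) * h M)"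
proof -
  have "sum \<psi> A' \<le> (\<Sum>p\<in>A'. h (snd p))" using assms by (intro sum_mono) auto
  also have "\<dots> \<le> (\<Sum>p\<in>(SIGMA M:K. {..M}). h (fst p))"
  proof -
    have "(\<Sum>p\<in>A'. h (snd p)) = (\<Sum>p\<in>prod.swap ` A'. h (fst p))"
      by (subst sum.reindex) (auto intro: inj_onI)
    also have "\<dots> \<le> (\<Sum>p\<in>(SIGMA M:K. {..M}). h (fst p))"
      using assms by (intro sum_mono2) auto
    finally show ?thesis .
  qed
  also have "\<dots> = (\<Sum>M\<in>K. real (M + 1) * h M)"
    using sum.Sigma[of K "\<lambda>M. {..M}" "\<lambda>M _. h M"] assms(3) by (simp add: case_prod_unfold)
  finally show ?thesis .
qed

lemma ln_quotient_ge:
  fixes x y :: real assumes "0 < x" "0 < y" shows "(x - y) / x \<le> ln (x / y)"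
proof -
  have "ln (y / x) \<le> y / x - 1" using assms by (intro ln_le_minus_one) simp
  then have "1 - y / x \<le> ln (x / y)" using assms by (simp add: ln_div)
  then show ?thesis using assms by (simp add: diff_divide_distrib)
qed

text \<open>Each term with positive \<open>M\<close> is dominated by twice an increment of ln (M^2 +
  b), and these telescope; the term at 0 is the separate \<open>1 / b\<close>.\<close>

lemma sum_log_bound:
  assumes "0 < b"
  shows "(\<Sum>M\<le>k. real (M + 1) / ((real M)^2 + b)) \<le> 1 / b + 2 * ln (((real k)^2 + b) / b)"
proof (induction k)
  case 0
  then show ?case using assms by simp
next
  case (Suc k)
  let ?x = "(real (Suc k))^2 + b" and ?y = "(real k)^2 + b"
  have pos: "0 < ?x" "0 < ?y" using assms by (auto intro: add_nonneg_pos)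
  have "real (Suc k + 1) / ?x \<le> 2 * ((?x - ?y) / ?x)"
  proof -
    have "real (Suc k + 1) \<le> 2 * (?x - ?y)" by (simp add: power2_eq_square algebra_simps)
    then have "real (Suc k + 1) / ?x \<le> 2 * (?x - ?y) / ?x" using pos by (intro divide_right_mono) auto
    then show ?thesis by simp
  qed
  also have "\<dots> \<le> 2 * ln (?x / ?y)" by (rule mult_left_mono[OF ln_quotient_ge[OF pos]]) simp
  finally have "real (Suc k + 1) / ?x \<le> 2 * (ln (?x / b) - ln (?y / b))"
    using pos assms by (simp add: ln_div)
  then show ?case using Suc.IH by simp
qed

lemma lattice_sum_inside:
  assumes "0 < b" "0 < R" "finite A" "\<And>n. n \<in> A \<Longrightarrow> qn n \<le> R^2"
  shows "(\<Sum>n\<in>A. 1 / (qn n + b)) \<le> 8 * (1 / b + 2 * ln ((R^2 + b) / b))"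
proof -
  let ?\<psi> = "\<lambda>p. 1 / ((real (snd p))^2 + b)"
  define k where "k = nat \<lfloor>R\<rfloor>"
  have k: "real k \<le> R" using assms(2) by (simp add: k_def)
  have qb: "(real (snd (minmax n)))^2 + b \<le> qn n + b" for n using minmax_props(2)[of n] by simp
  have pos: "0 < (x::real)^2 + b" for x using assms(1) by (simp add: add_nonneg_pos)
  have "(\<Sum>n\<in>A. 1 / (qn n + b)) \<le> 8 * sum ?\<psi> (minmax ` A)"
  proof (rule sum_minmax_le[OF assms(3)])
    show "1 / (qn n + b) \<le> ?\<psi> (minmax n)" for n using qb[of n] pos by (intro frac_le) auto
    show "0 \<le> ?\<psi> (minmax n)" for n using pos by (simp add: less_imp_le)
  qed
  also have "sum ?\<psi> (minmax ` A) \<le> (\<Sum>M\<in>{..k}. real (M + 1) * (1 / ((real M)^2 + b)))"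
  proof (rule sum_pairs_le)
    fix p assume "p \<in> minmax ` A"
    then obtain n where n: "n \<in> A" "p = minmax n" by auto
    have "(real (snd p))^2 \<le> R^2" using minmax_props(2)[of n] assms(4)[OF n(1)]
      zero_le_power2[of "real (fst (minmax n))"] unfolding n(2) by linarith
    then have "real (snd p) \<le> R" by (rule power2_le_imp_le) (use assms(2) in simp)
    then have "snd p \<le> k" by (simp add: k_def le_nat_floor)
    then show "fst p \<le> snd p \<and> snd p \<in> {..k} \<and> 1 / ((real (snd p))\<^sup>2 + b) \<le> 1 / ((real (snd p))\<^sup>2 + b)"
      using minmax_props(1) n by auto
  qed (use assms pos in \<open>auto intro: less_imp_le\<close>)
  also have "\<dots> \<le> 1 / b + 2 * ln (((real k)^2 + b) / b)"
    using sum_log_bound[OF assms(1), of k] by simp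
  also have "ln (((real k)^2 + b) / b) \<le> ln ((R^2 + b) / b)"
    using assms(1,2) k pos[of "real k"] pos[of R] by (subst ln_le_cancel_iff) (auto intro!: divide_right_mono power_mono)
  finally show ?thesis by simp
qed

lemma sum_inverse_cubes:
  assumes "0 < m" shows "(\<Sum>M\<in>{m..<m + k}. 1 / (real M)^3) \<le> 2 / (real m)^2 - 2 / (real (m + k))^2"
proof (induction k)
  case (Suc k)
  define x where "x = real (m + k)"
  have x: "x \<ge> 1" using assms by (simp add: x_def)
  have "1 / x^3 \<le> 2 / x^2 - 2 / (x + 1)^2"
  proof -
    have "(x + 1)^2 \<le> 2 * x * (2 * x + 1)"
    proof -
      have "1 \<le> x * x" using mult_mono[of 1 x 1 x] x by simp
      then show ?thesis by (simp add: power2_eq_square algebra_simps)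
    qed
    then have "1 / x^3 * (x + 1)^2 \<le> 1 / x^3 * (2 * x * (2 * x + 1))" using x by (intro mult_left_mono) auto
    then have "1 / x^3 \<le> (2 * x * (2 * x + 1)) / (x^3 * (x + 1)^2)" using x by (simp add: field_simps)
    also have "\<dots> = 2 / x^2 - 2 / (x + 1)^2"
      using x by (simp add: divide_simps) (simp add: power2_eq_square power3_eq_cube algebra_simps)
    finally show ?thesis .
  qed
  moreover have "(\<Sum>M\<in>{m..<m + Suc k}. 1 / (real M)^3) = (\<Sum>M\<in>{m..<m + k}. 1 / (real M)^3) + 1 / x^3"
    by (simp add: x_def)
  ultimately show ?case using Suc.IH by (simp add: x_def algebra_simps)
qed simp

text \<open>A shell with larger coordinate \<open>M\<close> has at most \<open>M + 1\<close> folded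
  points, leaving twice a sum of inverse cubes; the constant is 8 * 2 * 2.\<close>

lemma lattice_sum_outside:
  assumes "0 < X" "finite A" "\<And>n. n \<in> A \<Longrightarrow> X < (real (snd (minmax n)))^2"
  shows "(\<Sum>n\<in>A. 1 / (real (snd (minmax n)))^4) \<le> 32 / X"
proof (cases "A = {}")
  case False
  let ?\<psi> = "\<lambda>p::nat \<times> nat. 1 / (real (snd p))^4"
  let ?S = "snd ` minmax ` A"
  have finS: "finite ?S" "?S \<noteq> {}" using assms False by auto
  define m where "m = Min ?S"
  define k where "k = Max ?S + 1"
  have "m \<in> ?S" unfolding m_def by (rule Min_in[OF finS])
  then have mX: "X < (real m)^2" using assms(3) by auto
  then have m0: "0 < m" using assms(1) by (cases m) auto
  have "(\<Sum>n\<in>A. 1 / (real (snd (minmax n)))^4) \<le> 8 * sum ?\<psi> (minmax ` A)"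
    using assms(2) by (intro sum_minmax_le) auto
  also have "sum ?\<psi> (minmax ` A) \<le> (\<Sum>M\<in>{m..<m + k}. real (M + 1) * (1 / (real M)^4))"
  proof (rule sum_pairs_le)
    fix p assume p: "p \<in> minmax ` A"
    have "m \<le> snd p" "snd p \<le> Max ?S" unfolding m_def using finS p by auto
    then show "fst p \<le> snd p \<and> snd p \<in> {m..<m + k} \<and> 1 / (real (snd p))^4 \<le> 1 / (real (snd p))^4"
      using minmax_props(1) p by (auto simp: k_def)
  qed (use assms in auto)
  also have "\<dots> \<le> (\<Sum>M\<in>{m..<m + k}. 2 * (1 / (real M)^3))"
  proof (rule sum_mono)
    fix M assume "M \<in> {m..<m + k}"
    then have M: "real M \<ge> 1" using m0 by simp
    then have "real (M + 1) * (1 / (real M)^4) \<le> (2 * real M) * (1 / (real M)^4)" by (intro mult_right_mono) auto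
    also have "\<dots> = 2 * (1 / (real M)^3)" using M by (simp add: power4_eq_xxxx power3_eq_cube)
    finally show "real (M + 1) * (1 / (real M)^4) \<le> 2 * (1 / (real M)^3)" .
  qed
  also have "\<dots> = 2 * (\<Sum>M\<in>{m..<m + k}. 1 / (real M)^3)" by (rule sum_distrib_left[symmetric])
  also have "\<dots> \<le> 2 * (2 / (real m)^2)"
  proof -
    have "0 \<le> 2 / (real (m + k))^2" by simp
    then show ?thesis using sum_inverse_cubes[OF m0, of k] by linarith
  qed
  also have "\<dots> \<le> 2 * (2 / X)" using mX assms(1) m0 by (intro mult_left_mono divide_left_mono mult_pos_pos) auto
  finally show ?thesis by simp
qed (use assms in simp)

lemma sum_harmonic_shift:
  assumes "0 < d" shows "(\<Sum>i=1..k. 1 / (real i + d)) \<le> ln ((real k + d) / d)"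
proof (induction k)
  case (Suc k)
  have "1 / (real (Suc k) + d) \<le> ln ((real (Suc k) + d) / (real k + d))"
    using ln_quotient_ge[of "real (Suc k) + d" "real k + d"] assms by simp
  also have "\<dots> = ln ((real (Suc k) + d) / d) - ln ((real k + d) / d)"
    using assms by (simp add: ln_div)
  finally show ?case using Suc.IH by simp
qed simp

text \<open>For a fixed smaller coordinate, the distance of \<open>qn\<close> to R^2 grows by at
  least R with each step of the larger one. Each of at most 3R columns is then a harmonic sum cut
  off by \<open>\<delta>\<close>, which yields the logarithm without counting lattice points in thin
  annuli.\<close>

lemma lattice_sum_near:
  assumes R: "1 \<le> R" and \<delta>: "0 < \<delta>" "1 \<le> \<delta> * R" and A: "finite A"
    "\<And>n. n \<in> A \<Longrightarrow> R^2 < qn n \<and> real (snd (minmax n)) \<le> 2 * R"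
  shows "(\<Sum>n\<in>A. 1 / (qn n * (qn n - R^2 + \<delta> * R^2))) \<le> 24 / R^2 * (1 + ln (1 + 2 / \<delta>))"
proof -
  define k where "k = nat \<lfloor>2 * R\<rfloor>"
  have k: "real k \<le> 2 * R" using R by (simp add: k_def)
  let ?q = "\<lambda>p::nat \<times> nat. (real (fst p))^2 + (real (snd p))^2"
  let ?\<psi> = "\<lambda>p. 1 / (R^2 * (?q p - R^2 + \<delta> * R^2))"
  define h where "h i = 1 / (R^2 * (R * real i + \<delta> * R^2))" for i :: nat
  define B where "B = {p::nat \<times> nat. fst p \<le> snd p \<and> snd p \<le> k \<and> R^2 < ?q p}"
  have BS: "B \<subseteq> {..k} \<times> {..k}" by (auto simp: B_def)
  have finB: "finite B" by (rule finite_subset[OF BS]) simp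
  have \<delta>R: "0 < \<delta> * R^2" using R \<delta> by simp
  have R2: "0 < R^2" using R by simp
  have hpos: "0 \<le> h i" for i using R \<delta>R by (simp add: h_def)
  have sub: "minmax ` A \<subseteq> B"
  proof
    fix p assume "p \<in> minmax ` A"
    then obtain n where n: "n \<in> A" "p = minmax n" by auto
    then have "snd p \<le> k" using A(2)[OF n(1)] by (simp add: k_def le_nat_floor)
    then show "p \<in> B" using A(2)[OF n(1)] minmax_props[of n] n(2) by (simp add: B_def)
  qed
  have \<psi>0: "0 \<le> ?\<psi> p" if "p \<in> B" for p using that R2 \<delta>R by (auto simp: B_def)
  have "(\<Sum>n\<in>A. 1 / (qn n * (qn n - R^2 + \<delta> * R^2))) \<le> 8 * sum ?\<psi> (minmax ` A)"
  proof (rule sum_minmax_le[OF A(1)])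
    fix n assume n: "n \<in> A"
    have h: "R^2 \<le> qn n" "0 < qn n" "0 < qn n - R^2 + \<delta> * R^2" using A(2)[OF n] R2 \<delta>R by linarith+
    show "1 / (qn n * (qn n - R^2 + \<delta> * R^2)) \<le> ?\<psi> (minmax n)"
      unfolding minmax_props(2)[of n, symmetric]
      by (intro divide_left_mono mult_right_mono mult_pos_pos R2 h less_imp_le[OF h(3)]) simp
    show "0 \<le> ?\<psi> (minmax n)" using \<psi>0 sub n by blast
  qed
  also have "sum ?\<psi> (minmax ` A) \<le> sum ?\<psi> B"
    by (rule sum_mono2[OF finB sub]) (use \<psi>0 in auto)
  also have "sum ?\<psi> B = (\<Sum>m\<in>{..k}. \<Sum>M\<in>{M. (m, M) \<in> B}. ?\<psi> (m, M))"
  proof -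
    have "B = (SIGMA m:{..k}. {M. (m, M) \<in> B})" using BS by auto
    moreover have "finite {M. (m, M) \<in> B}" for m by (rule finite_subset[of _ "{..k}"]) (use BS in auto)
    ultimately show ?thesis
      using sum.Sigma[of "{..k}" "\<lambda>m. {M. (m, M) \<in> B}" "\<lambda>m M. ?\<psi> (m, M)"] by (simp add: case_prod_unfold)
  qed
  also have "\<dots> \<le> (\<Sum>m\<in>{..k}. \<Sum>i\<le>k. h i)"
  proof (rule sum_mono)
    fix m assume "m \<in> {..k}"
    let ?S = "{M. (m, M) \<in> B}"
    have fin: "finite ?S" by (rule finite_subset[of _ "{..k}"]) (use BS in auto)
    show "(\<Sum>M\<in>?S. ?\<psi> (m, M)) \<le> (\<Sum>i\<le>k. h i)"
    proof (cases "?S = {}")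
      case True
      then show ?thesis using hpos by (simp add: sum_nonneg)
    next
      case False
      \<comment> \<open>The first point of the column outside the disc. Being the larger coordinate,
        it is at least R/2, so M^2 - M0^2 = (M + M0)(M - M0) is at least R (M - M0).\<close>
      define M0 where "M0 = Min ?S"
      have M0: "M0 \<in> ?S" unfolding M0_def by (rule Min_in[OF fin False])
      then have m0: "m \<le> M0" "R^2 < (real m)^2 + (real M0)^2" by (auto simp: B_def)
      have "(real m)^2 \<le> (real M0)^2" using m0 by (intro power_mono) auto
      then have "R^2 \<le> 4 * (real M0)^2" using m0 zero_le_power2[of "real M0"] by linarith
      then have "R^2 \<le> (2 * real M0)^2" by (simp add: power_mult_distrib)
      then have RM: "R \<le> 2 * real M0" by (rule power2_le_imp_le) simp
      have "(\<Sum>M\<in>?S. ?\<psi> (m, M)) \<le> (\<Sum>M\<in>?S. h (M - M0))"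
      proof (rule sum_mono)
        fix M assume M: "M \<in> ?S"
        have le: "M0 \<le> M" unfolding M0_def using fin M by simp
        have "R * real (M - M0) \<le> (real M + real M0) * real (M - M0)"
          using RM le by (intro mult_right_mono) auto
        also have "\<dots> = (real M)^2 - (real M0)^2" using le by (simp add: of_nat_diff power2_eq_square algebra_simps)
        also have "\<dots> \<le> (real m)^2 + (real M)^2 - R^2" using m0 by linarith
        finally have "R * real (M - M0) \<le> (real m)^2 + (real M)^2 - R^2" .
        moreover have "0 \<le> R * real (M - M0)" using R by simp
        ultimately show "?\<psi> (m, M) \<le> h (M - M0)"
          unfolding h_def fst_conv snd_conv using R2 \<delta>R \<delta>(1)
          by (intro divide_left_mono mult_left_mono mult_pos_pos add_nonneg_pos) (auto intro: order_trans)
      qed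
      also have "\<dots> = sum h ((\<lambda>M. M - M0) ` ?S)"
      proof -
        have "inj_on (\<lambda>M. M - M0) ?S"
        proof (rule inj_onI)
          fix x y assume xy: "x \<in> ?S" "y \<in> ?S" "x - M0 = y - M0"
          have "M0 \<le> x" "M0 \<le> y" unfolding M0_def using Min_le[OF fin] xy by auto
          then show "x = y" using xy(3) by linarith
        qed
        then show ?thesis by (simp add: sum.reindex)
      qed
      also have "\<dots> \<le> (\<Sum>i\<le>k. h i)"
        by (rule sum_mono2) (use hpos in \<open>auto simp: B_def\<close>)
      finally show ?thesis .
    qed
  qed
  also have "\<dots> = real (k + 1) * (\<Sum>i\<le>k. h i)" by simp
  also have "\<dots> \<le> 3 * R * (1 / R^3 * (1 + ln (1 + 2 / \<delta>)))"
  proof (rule mult_mono)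
    show "real (k + 1) \<le> 3 * R" using k R by simp
    have hi: "h i = 1 / R^3 * (1 / (real i + \<delta> * R))" for i
    proof -
      have "R^2 * (R * real i + \<delta> * R^2) = R^3 * (real i + \<delta> * R)" by (simp add: power2_eq_square power3_eq_cube algebra_simps)
      then show ?thesis by (simp add: h_def)
    qed
    have hs: "(\<Sum>i\<le>k. h i) = 1 / R^3 * (\<Sum>i\<le>k. 1 / (real i + \<delta> * R))"
      unfolding hi by (rule sum_distrib_left[symmetric])
    have "(\<Sum>i\<le>k. 1 / (real i + \<delta> * R)) = 1 / (\<delta> * R) + (\<Sum>i=1..k. 1 / (real i + \<delta> * R))"
      by (simp add: atMost_atLeast0 sum.atLeast_Suc_atMost)
    also have "\<dots> \<le> 1 + ln (1 + 2 / \<delta>)"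
    proof (rule add_mono)
      \<comment> \<open>The first point of a column may be arbitrarily close to the circle;
        \<open>\<delta> * R \<ge> 1\<close> is what bounds its term.\<close>
      show "1 / (\<delta> * R) \<le> 1" using \<delta>(2) by simp
      have "(\<Sum>i=1..k. 1 / (real i + \<delta> * R)) \<le> ln ((real k + \<delta> * R) / (\<delta> * R))"
        by (rule sum_harmonic_shift) (use \<delta> in linarith)
      also have "\<dots> \<le> ln ((2 * R + \<delta> * R) / (\<delta> * R))"
        using k \<delta> R by (subst ln_le_cancel_iff) (auto intro!: divide_right_mono divide_pos_pos add_nonneg_pos)
      also have "(2 * R + \<delta> * R) / (\<delta> * R) = 1 + 2 / \<delta>" using R \<delta> by (simp add: field_simps)
      finally show "(\<Sum>i=1..k. 1 / (real i + \<delta> * R)) \<le> ln (1 + 2 / \<delta>)" .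
    qed
    finally show "(\<Sum>i\<le>k. h i) \<le> 1 / R^3 * (1 + ln (1 + 2 / \<delta>))"
      unfolding hs by (rule mult_left_mono) (use R in simp)
    show "0 \<le> (\<Sum>i\<le>k. h i)" using hpos by (simp add: sum_nonneg)
  qed (use R in auto)
  also have "3 * R * (1 / R^3 * (1 + ln (1 + 2 / \<delta>))) = 3 / R^2 * (1 + ln (1 + 2 / \<delta>))"
    using R by (simp add: power2_eq_square power3_eq_cube)
  finally show ?thesis by simp
qed

text \<open>Where the larger coordinate exceeds 2R, the distance of \<open>qn\<close> to R^2 is
  comparable with its square and inverse fourth powers suffice; the logarithm comes from the near
  part alone.\<close>

lemma lattice_sum_resonant:
  assumes R: "1 \<le> R" and \<delta>: "0 < \<delta>" "1 \<le> \<delta> * R" and A: "finite A" "\<And>n. n \<in> A \<Longrightarrow> R^2 < qn n"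
  shows "(\<Sum>n\<in>A. 1 / (qn n * (qn n - R^2 + \<delta> * R^2))) \<le> (36 + 24 * ln (1 + 2 / \<delta>)) / R^2"
proof -
  let ?f = "\<lambda>n. 1 / (qn n * (qn n - R^2 + \<delta> * R^2))"
  let ?N = "{n \<in> A. real (snd (minmax n)) \<le> 2 * R}" and ?O = "{n \<in> A. real (snd (minmax n)) > 2 * R}"
  have R2: "0 < R^2" "0 < \<delta> * R^2" using R \<delta> by auto
  have "sum ?f A = sum ?f ?N + sum ?f ?O"
  proof -
    have "A = ?N \<union> ?O" by auto
    then show ?thesis using sum.union_disjoint[of ?N ?O ?f] A(1) by (simp add: disjoint_iff)
  qed
  moreover have "sum ?f ?N \<le> 24 / R^2 * (1 + ln (1 + 2 / \<delta>))"
    by (rule lattice_sum_near[OF R \<delta>]) (use A in auto)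
  moreover have "sum ?f ?O \<le> 12 / R^2"
  proof -
    have "sum ?f ?O \<le> (\<Sum>n\<in>?O. 4 / 3 * (1 / (real (snd (minmax n)))^4))"
    proof (rule sum_mono)
      fix n assume n: "n \<in> ?O"
      let ?M = "real (snd (minmax n))"
      have M: "2 * R < ?M" using n by simp
      then have "(2 * R)^2 \<le> ?M^2" using R by (intro power_mono) auto
      then have RM: "4 * R^2 \<le> ?M^2" by (simp add: power_mult_distrib)
      have q: "?M^2 \<le> qn n" using minmax_props(2)[of n] by simp
      have M0: "0 < ?M^2" using M R by simp
      have "?M^2 * (3 / 4 * ?M^2) \<le> qn n * (qn n - R^2 + \<delta> * R^2)"
        using q RM R2 M0 by (intro mult_mono) linarith+
      then have "?f n \<le> 1 / (?M^2 * (3 / 4 * ?M^2))"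
        using M0 by (intro frac_le mult_pos_pos) auto
      also have "\<dots> = 4 / 3 * (1 / ?M^4)" by (simp add: power4_eq_xxxx power2_eq_square)
      finally show "?f n \<le> 4 / 3 * (1 / ?M^4)" .
    qed
    also have "\<dots> = 4 / 3 * (\<Sum>n\<in>?O. 1 / (real (snd (minmax n)))^4)" by (rule sum_distrib_left[symmetric])
    also have "\<dots> \<le> 4 / 3 * (32 / (4 * R^2))"
    proof (intro mult_left_mono lattice_sum_outside)
      fix n assume "n \<in> ?O"
      then have "(2 * R)^2 < (real (snd (minmax n)))^2" using R by (intro power_strict_mono) auto
      then show "4 * R^2 < (real (snd (minmax n)))^2" by (simp add: power_mult_distrib)
    qed (use A R2 in auto)
    also have "\<dots> \<le> 12 / R^2" using R2 by (simp add: field_simps)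
    finally show ?thesis .
  qed
  ultimately have "sum ?f A \<le> 24 / R^2 * (1 + ln (1 + 2 / \<delta>)) + 12 / R^2" by linarith
  also have "\<dots> = (36 + 24 * ln (1 + 2 / \<delta>)) / R^2" by (simp add: add_divide_distrib[symmetric] algebra_simps)
  finally show ?thesis .
qed

lemma lattice_sum_tail:
  assumes R: "0 < R" and A: "finite A" "\<And>n. n \<in> A \<Longrightarrow> R^2 < qn n"
  shows "(\<Sum>n\<in>A. 1 / (qn n)^2) \<le> 64 / R^2"
proof -
  have big: "R^2 / 2 < (real (snd (minmax n)))^2" if "n \<in> A" for n
  proof -
    have "(real (fst (minmax n)))^2 \<le> (real (snd (minmax n)))^2" using minmax_props(1)[of n] by (intro power_mono) auto
    then show ?thesis using minmax_props(2)[of n] A(2)[OF that] by linarith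
  qed
  have "(\<Sum>n\<in>A. 1 / (qn n)^2) \<le> (\<Sum>n\<in>A. 1 / (real (snd (minmax n)))^4)"
  proof (rule sum_mono)
    fix n assume n: "n \<in> A"
    let ?M = "real (snd (minmax n))"
    have M0: "0 < ?M^2" using big[OF n] R zero_less_power[of R 2] by linarith
    have "?M^2 \<le> qn n" using minmax_props(2)[of n] by simp
    then have "(?M^2)^2 \<le> (qn n)^2" using M0 by (intro power_mono) auto
    then have "1 / (qn n)^2 \<le> 1 / (?M^2)^2" using M0 by (intro frac_le) auto
    then show "1 / (qn n)^2 \<le> 1 / ?M^4" by (simp flip: power_mult)
  qed
  also have "\<dots> \<le> 32 / (R^2 / 2)"
    by (rule lattice_sum_outside) (use R A big in auto)
  finally show ?thesis by simp
qed

text \<open>Counts the lattice points of a square inscribed in the disc.\<close>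

lemma lattice_card_ge:
  assumes "0 \<le> T" "finite A" "{n. qn n \<le> T} \<subseteq> A" shows "T / 2 \<le> real (card A)"
proof -
  define m where "m = \<lfloor>sqrt (T / 2)\<rfloor>"
  have m0: "0 \<le> m" using assms by (simp add: m_def)
  have ms: "real_of_int m \<le> sqrt (T / 2)" "sqrt (T / 2) < real_of_int m + 1" by (auto simp: m_def)
  have "{-m..m} \<times> {-m..m} \<subseteq> {n. qn n \<le> T}"
  proof clarify
    fix a b assume ab: "a \<in> {-m..m}" "b \<in> {-m..m}"
    have sq: "(real_of_int x)^2 \<le> T / 2" if "x \<in> {-m..m}" for x
    proof -
      have "\<bar>real_of_int x\<bar> \<le> sqrt (T / 2)" using that ms(1) by (auto simp: abs_if)
      then have "\<bar>real_of_int x\<bar>^2 \<le> (sqrt (T / 2))^2" by (intro power_mono) auto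
      then show ?thesis using assms(1) by simp
    qed
    show "qn (a, b) \<le> T" using sq[OF ab(1)] sq[OF ab(2)] by (simp add: qn_def)
  qed
  then have "{-m..m} \<times> {-m..m} \<subseteq> A" using assms(3) by blast
  then have "card ({-m..m} \<times> {-m..m}) \<le> card A" by (intro card_mono assms(2))
  moreover have "card ({-m..m} \<times> {-m..m}) = nat (2 * m + 1) * nat (2 * m + 1)"
    by (simp add: card_cartesian_product algebra_simps)
  ultimately have "real (nat (2 * m + 1) * nat (2 * m + 1)) \<le> real (card A)" by (metis of_nat_le_iff)
  then have c: "(2 * real_of_int m + 1) * (2 * real_of_int m + 1) \<le> real (card A)" using m0 by simp
  have "T / 2 = sqrt (T / 2) * sqrt (T / 2)" using assms(1) by simp
  also have "\<dots> \<le> (2 * real_of_int m + 1) * (2 * real_of_int m + 1)"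
    using ms m0 assms(1) by (intro mult_mono) auto
  finally show ?thesis using c by linarith
qed

lemma sum_inverse_ge_ln:
  assumes "1 \<le> a" "a \<le> k" shows "ln (real (Suc k) / real a) \<le> (\<Sum>i=a..k. 1 / real i)"
  using assms(2)
proof (induction k rule: dec_induct)
  case base
  have "ln (1 + 1 / real a) \<le> 1 / real a" by (rule ln_add_one_self_le_self) simp
  moreover have "1 + 1 / real a = real (Suc a) / real a" using assms(1) by (simp add: field_simps)
  ultimately show ?case by simp
next
  case (step k)
  have "ln (1 + 1 / real (Suc k)) \<le> 1 / real (Suc k)" by (rule ln_add_one_self_le_self) simp
  moreover have "(real (Suc (Suc k)) / real a) / (real (Suc k) / real a) = real (Suc (Suc k)) / real (Suc k)"
    using assms(1) by simp
  then have "1 + 1 / real (Suc k) = (real (Suc (Suc k)) / real a) / (real (Suc k) / real a)"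
    by (simp add: field_simps)
  then have "ln (1 + 1 / real (Suc k)) = ln (real (Suc (Suc k)) / real a) - ln (real (Suc k) / real a)"
    using assms(1) by (simp add: ln_div)
  ultimately show ?case using step by (simp add: sum.cl_ivl_Suc)
qed

text \<open>Only the triangle of points (x, y) with 1 \<le> y \<le> x and b \<le> x \<le> R/2 is
  kept. There the denominator is at most 3x^2, so each column gives at least 1/(3x), and the
  harmonic sum gives the logarithm.\<close>

lemma lattice_sum_inside_ge:
  assumes b: "0 < b" and R: "2 * (b + 1) \<le> R" and A: "finite A" "{n. qn n \<le> R^2} \<subseteq> A"
    "\<And>n. n \<in> A \<Longrightarrow> 0 \<le> qn n"
  shows "ln (R / (2 * (b + 1))) / 3 \<le> (\<Sum>n\<in>A. 1 / (qn n + b^2))"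
proof -
  define a where "a = nat \<lceil>b\<rceil>"
  define k where "k = nat \<lfloor>R / 2\<rfloor>"
  have a: "b \<le> real a" "real a \<le> b + 1" "1 \<le> a" using b by (auto simp: a_def) linarith+
  have k: "real k \<le> R / 2" "R / 2 \<le> real (Suc k)" using R b by (auto simp: k_def) linarith+
  have ak: "a \<le> k"
  proof -
    have "real a \<le> R / 2" using a R by simp
    then show ?thesis by (simp add: k_def le_nat_floor)
  qed
  let ?B = "(\<lambda>(x, y). (int x, int y)) ` (SIGMA x:{a..k}. {1..x})"
  have pos: "0 < qn n + b^2" if "n \<in> A" for n using A(3)[OF that] b by (simp add: add_nonneg_pos)
  have BA: "?B \<subseteq> A"
  proof -
    have "qn (int x, int y) \<le> R^2" if "x \<in> {a..k}" "y \<in> {1..x}" for x y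
    proof -
      have "real x \<le> R / 2" "real y \<le> R / 2" using that k by auto
      then have "(real x)^2 \<le> (R / 2)^2" "(real y)^2 \<le> (R / 2)^2" by (intro power_mono; simp)+
      moreover have "(R / 2)^2 = R^2 / 4" by (simp add: power_divide)
      moreover have "qn (int x, int y) = (real x)^2 + (real y)^2" by (simp add: qn_def)
      ultimately show ?thesis using zero_le_power2[of R] by linarith
    qed
    then show ?thesis using A(2) by auto
  qed
  have "ln (R / (2 * (b + 1))) \<le> ln (real (Suc k) / real a)"
  proof -
    have "R / (2 * (b + 1)) = (R / 2) / (b + 1)" by simp
    also have "\<dots> \<le> real (Suc k) / real a" using a k R b by (intro frac_le) auto
    finally show ?thesis using a R b by (subst ln_le_cancel_iff) auto
  qed
  also have "\<dots> \<le> (\<Sum>i=a..k. 1 / real i)" by (rule sum_inverse_ge_ln[OF a(3) ak])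
  finally have "ln (R / (2 * (b + 1))) / 3 \<le> (\<Sum>x=a..k. 1 / real x) / 3" by simp
  also have "\<dots> = (\<Sum>x=a..k. \<Sum>y\<in>{1..x}. 1 / (3 * (real x)^2))"
    unfolding sum_divide_distrib using a(3) by (intro sum.cong) (auto simp: power2_eq_square)
  also have "\<dots> \<le> (\<Sum>x=a..k. \<Sum>y\<in>{1..x}. 1 / (qn (int x, int y) + b^2))"
  proof (intro sum_mono)
    fix x y assume xy: "x \<in> {a..k}" "y \<in> {1..x}"
    have "b^2 \<le> (real x)^2" "(real y)^2 \<le> (real x)^2" using xy a b by (auto intro!: power_mono)
    moreover have "qn (int x, int y) = (real x)^2 + (real y)^2" by (simp add: qn_def)
    ultimately have "qn (int x, int y) + b^2 \<le> 3 * (real x)^2" by linarith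
    moreover have "0 < qn (int x, int y) + b^2" using b by (simp add: qn_def add_nonneg_pos)
    ultimately show "1 / (3 * (real x)^2) \<le> 1 / (qn (int x, int y) + b^2)" by (intro frac_le) auto
  qed
  also have "\<dots> = (\<Sum>n\<in>?B. 1 / (qn n + b^2))"
    by (subst sum.reindex) (auto simp: inj_on_def sum.Sigma case_prod_unfold)
  also have "\<dots> \<le> (\<Sum>n\<in>A. 1 / (qn n + b^2))"
    by (rule sum_mono2[OF A(1) BA]) (use pos in \<open>auto intro: less_imp_le\<close>)
  finally show ?thesis .
qed

section \<open>The polaron energy\<close>

context point_interaction begin

text \<open>The polaron equation is a zero of \<open>\<phi>\<close>, which increases strictly as
  long as all arguments of \<open>g\<close> stay below \<open>y\<close>. That range is a half-line
  to the left, so a zero found there is the least solution.\<close>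

lemma eP_bounds:
  assumes \<mu>: "0 < \<mu>" and y: "0 \<le> y" "y < \<mu>" and gy: "0 < g \<mu> y"
    and lo: "\<mu> - y < real (Nmu L \<mu>) / g \<mu> (- 2 * \<mu>)" and up: "real (Nmu L \<mu>) / g \<mu> (- 2 * \<mu>) \<le> 2 * \<mu>"
  shows "real (Nmu L \<mu>) / g \<mu> (- 2 * \<mu>) \<le> - eP L EB \<mu>" "- eP L EB \<mu> \<le> real (Nmu L \<mu>) / g \<mu> y"
proof -
  let ?A = "{n. e n \<le> \<mu>}" and ?N = "real (Nmu L \<mu>)"
  define \<phi> where "\<phi> x = (\<Sum>n\<in>?A. 1 / g \<mu> (e n + x)) + x" for x
  \<comment> \<open>The largest \<open>x\<close> for which \<open>e n + x \<le> y\<close> is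
    guaranteed for every occupied mode.\<close>
  define x1 where "x1 = y - \<mu>"
  have N: "?N = real (card ?A)" by (simp add: Nmu_def)
  have le_y: "e n + x \<le> y" if "n \<in> ?A" "x \<le> x1" for n x using that by (simp add: x1_def)
  have g_ge: "g \<mu> y \<le> g \<mu> (e n + x)" if "n \<in> ?A" "x \<le> x1" for n x
    using le_y[OF that] y by (intro g_antimono) auto
  have g_pos: "0 < g \<mu> (e n + x)" if "n \<in> ?A" "x \<le> x1" for n x
    using g_ge[OF that] gy by linarith
  have mono: "\<phi> x < \<phi> x'" if "x < x'" "x' \<le> x1" for x x'
  proof -
    have "(\<Sum>n\<in>?A. 1 / g \<mu> (e n + x)) \<le> (\<Sum>n\<in>?A. 1 / g \<mu> (e n + x'))"
    proof (rule sum_mono)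
      fix n assume n: "n \<in> ?A"
      have "g \<mu> (e n + x') \<le> g \<mu> (e n + x)"
        using that le_y[OF n that(2)] y by (intro g_antimono) auto
      then show "1 / g \<mu> (e n + x) \<le> 1 / g \<mu> (e n + x')"
        using g_pos[OF n that(2)] by (intro frac_le) auto
    qed
    then show ?thesis using that(1) by (simp add: \<phi>_def)
  qed
  have cont: "continuous_on {..x1} \<phi>"
    unfolding \<phi>_def
  proof (intro continuous_intros)
    fix n assume n: "n \<in> ?A"
    show "continuous_on {..x1} (\<lambda>x. g \<mu> (e n + x))"
    proof (rule continuous_on_compose2[OF continuous_g])
      show "(\<lambda>x. e n + x) ` {..x1} \<subseteq> {..\<mu>}" using le_y[OF n] y by fastforce
    qed (intro continuous_intros)
    show "\<forall>x\<in>{..x1}. g \<mu> (e n + x) \<noteq> 0" using g_pos[OF n] by fastforce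
  qed
  have upper: "(\<Sum>n\<in>?A. 1 / g \<mu> (e n + x)) \<le> ?N / g \<mu> y" if "x \<le> x1" for x
  proof -
    have "(\<Sum>n\<in>?A. 1 / g \<mu> (e n + x)) \<le> (\<Sum>n\<in>?A. 1 / g \<mu> y)"
      using g_ge that gy by (intro sum_mono frac_le) auto
    then show ?thesis by (simp add: N)
  qed
  have lower: "?N / g \<mu> (- 2 * \<mu>) \<le> (\<Sum>n\<in>?A. 1 / g \<mu> (e n + x))" if "x \<le> x1" "- 2 * \<mu> \<le> x" for x
  proof -
    have "(\<Sum>n\<in>?A. 1 / g \<mu> (- 2 * \<mu>)) \<le> (\<Sum>n\<in>?A. 1 / g \<mu> (e n + x))"
    proof (rule sum_mono)
      fix n assume n: "n \<in> ?A"
      have "g \<mu> (e n + x) \<le> g \<mu> (- 2 * \<mu>)"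
        using le_y[OF n that(1)] y that(2) ksq_nonneg[of L n] by (intro g_antimono) linarith+
      then show "1 / g \<mu> (- 2 * \<mu>) \<le> 1 / g \<mu> (e n + x)"
        using g_pos[OF n that(1)] by (intro frac_le) auto
    qed
    then show ?thesis by (simp add: N)
  qed
  have sol: "x \<in> polaron_solutions L EB \<mu> \<longleftrightarrow> \<phi> x = 0" if x: "x \<le> x1" for x
  proof -
    have G: "Gmu L EB \<mu> (- e n - x) = g \<mu> (e n + x) / L^2" for n
      using Gmu_eq[of \<mu> "- e n - x"] by (simp add: add.commute)
    have "- e n - x > - \<mu> \<and> Gmu L EB \<mu> (- e n - x) \<noteq> 0" if "e n \<le> \<mu>" for n
      using le_y[of n x] g_pos[of n x] that x y L_pos by (auto simp: G)
    moreover have "(1 / L^2) * (\<Sum>n\<in>?A. 1 / Gmu L EB \<mu> (- e n - x)) = (\<Sum>n\<in>?A. 1 / g \<mu> (e n + x))"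
      using L_pos unfolding G sum_distrib_left by (intro sum.cong) auto
    ultimately show ?thesis
      unfolding polaron_solutions_def \<phi>_def by (auto simp: eq_neg_iff_add_eq_0 add.commute)
  qed
  define x0 where "x0 = min x1 (- (?N / g \<mu> y) - 1)"
  have "\<phi> x0 \<le> 0" using upper[of x0] unfolding \<phi>_def x0_def by linarith
  \<comment> \<open>Assumption \<open>lo\<close> makes the sum exceed \<open>- x1\<close>.\<close>
  moreover have "0 \<le> \<phi> x1"
    using lower[of x1] lo y \<mu> unfolding \<phi>_def x1_def by linarith
  moreover have "x0 \<le> x1" by (simp add: x0_def)
  ultimately obtain x where x: "x0 \<le> x" "x \<le> x1" "\<phi> x = 0"
    using IVT'[of \<phi> x0 0 x1] continuous_on_subset[OF cont, of "{x0..x1}"] by auto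
  have "eP L EB \<mu> = x"
    unfolding eP_def
  proof (rule Least_equality)
    show "x \<in> polaron_solutions L EB \<mu>" using sol x by simp
    fix x' assume x': "x' \<in> polaron_solutions L EB \<mu>"
    show "x \<le> x'"
    proof (rule ccontr)
      assume "\<not> x \<le> x'"
      then have "x' < x" by simp
      then have "\<phi> x' = 0" "\<phi> x' < \<phi> x" using sol[of x'] x x' mono[of x' x] by auto
      then show False using x by simp
    qed
  qed
  moreover have "- x = (\<Sum>n\<in>?A. 1 / g \<mu> (e n + x))" using x(3) by (simp add: \<phi>_def)
  ultimately show "?N / g \<mu> (- 2 * \<mu>) \<le> - eP L EB \<mu>" "- eP L EB \<mu> \<le> ?N / g \<mu> y"
    using upper[OF x(2)] lower[OF x(2)] up by (cases "- 2 * \<mu> \<le> x"; simp)+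
qed

subsection \<open>Size of the resolvent denominator\<close>

text \<open>The scale that turns energies into squared radii in the integer lattice: e = qn / dens,
  so the Fermi disc has squared radius \<mu> dens.\<close>

definition dens :: real where "dens = L^2 / (4 * pi^2)"

lemma dens_pos: "0 < dens"
  using L_pos by (simp add: dens_def)

lemma e_qn: "e n = qn n / dens"
  by (simp add: ksq_def qn_def dens_def power_divide power_mult_distrib)

lemma r_qn: "r x n = dens / (qn n - x * dens)"
  using dens_pos by (simp add: r_def e_qn field_simps)

lemma qn_nonneg: "0 \<le> qn n"
  by (simp add: qn_def)

lemma infsum_r_le:
  assumes "0 < \<mu>" "x \<le> 0" "y < \<mu>" "\<And>A. finite A \<Longrightarrow> (\<And>n. n \<in> A \<Longrightarrow> \<mu> * dens < qn n) \<Longrightarrow> (\<Sum>n\<in>A. 1 / (qn n * (qn n - y * dens))) \<le> S"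
  shows "infsum (\<lambda>n. r x n * r y n) {n. e n > \<mu>} \<le> dens^2 * S"
proof (rule infsum_le_finite_sums[OF summable_r_prod])
  fix A assume A: "finite A" "A \<subseteq> {n. e n > \<mu>}"
  have q: "\<mu> * dens < qn n" if "n \<in> A" for n using A that dens_pos by (auto simp: e_qn field_simps)
  have "(\<Sum>n\<in>A. r x n * r y n) \<le> (\<Sum>n\<in>A. dens^2 * (1 / (qn n * (qn n - y * dens))))"
  proof (rule sum_mono)
    fix n assume n: "n \<in> A"
    have q0: "0 < qn n" using q[OF n] mult_pos_pos[OF assms(1) dens_pos] by linarith
    have y0: "0 < qn n - y * dens" using q[OF n] mult_strict_right_mono[OF assms(3) dens_pos] by linarith
    have "qn n \<le> qn n - x * dens" using mult_nonpos_nonneg[OF assms(2) less_imp_le[OF dens_pos]] by linarith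
    then have "r x n \<le> dens / qn n" unfolding r_qn using q0 dens_pos by (intro divide_left_mono mult_pos_pos) auto
    then have "r x n * r y n \<le> (dens / qn n) * r y n"
      by (rule mult_right_mono) (use y0 dens_pos in \<open>simp add: r_qn\<close>)
    then show "r x n * r y n \<le> dens^2 * (1 / (qn n * (qn n - y * dens)))"
      by (simp add: r_qn power2_eq_square)
  qed
  also have "\<dots> = dens^2 * (\<Sum>n\<in>A. 1 / (qn n * (qn n - y * dens)))" by (rule sum_distrib_left[symmetric])
  also have "\<dots> \<le> dens^2 * S" using assms(4)[OF A(1) q] by (intro mult_left_mono) auto
  finally show "(\<Sum>n\<in>A. r x n * r y n) \<le> dens^2 * S" .
qed

text \<open>As \<open>F\<close> vanishes at \<open>EB\<close>, the regularised infinite sum there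
  equals a finite sum over the Fermi disc; this is where the logarithm of \<mu> / |E_B|
  appears.\<close>

lemma g_EB: "g \<mu> EB = dens * (\<Sum>n | e n \<le> \<mu>. 1 / (qn n - EB * dens))"
  using F_eq[of EB \<mu>] F_EB by (simp add: P_def r_qn sum_distrib_left)

text \<open>Here \<open>w\<close> is the square root of the logarithm. Both energies lie between
  bounds made of \<open>X\<close> and \<open>Y\<close>, the values of N/g at - 2 \<mu> and at
  \<open>y\<close>, so their difference is at most \<open>Y - X\<close> plus the width of the
  excluded strip.\<close>

theorem Egs_eP_estimate:
  fixes \<mu> w :: real
  assumes \<mu>: "0 < \<mu>" and w: "10000 \<le> w" "\<mu> = - EB * exp (w^2)" and LEB: "1 \<le> L^2 * \<bar>EB\<bar>"
  shows "\<bar>Egs L EB \<mu> - E0 L \<mu> - eP L EB \<mu>\<bar> \<le> 7250 * \<bar>eP L EB \<mu>\<bar> / w"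
proof -
  define R where "R = sqrt (\<mu> * dens)"
  define \<beta> where "\<beta> = sqrt (- EB * dens)"
  define \<delta> where "\<delta> = 1 / w^3"
  define y where "y = (1 - \<delta>) * \<mu>"
  let ?N = "real (Nmu L \<mu>)" and ?A = "{n. e n \<le> \<mu>}"
  have EBt: "0 < - EB * dens" using EB_neg dens_pos by (simp add: mult_neg_pos)
  have w0: "0 < w" "1 \<le> w" using w by auto
  have R2: "R^2 = \<mu> * dens" using \<mu> dens_pos by (simp add: R_def)
  have b2: "\<beta>^2 = - EB * dens" using EBt by (simp add: \<beta>_def)
  have b0: "0 < \<beta>" using EBt by (simp add: \<beta>_def)
  have R0: "0 < R" using \<mu> dens_pos by (simp add: R_def)
  \<comment> \<open>Uses L^2 |E_B| \<ge> 1 and \<pi> < 4; it limits the zero mode's term 1/\<beta>^2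
    to 64.\<close>
  have b64: "1 / 64 \<le> \<beta>^2"
  proof -
    have "pi * pi \<le> 4 * 4" using pi_less_4 by (intro mult_mono) auto
    then have "1 / 64 \<le> 1 / (4 * pi^2)" by (intro frac_le) (auto simp: power2_eq_square)
    also have "\<dots> \<le> (L^2 * \<bar>EB\<bar>) / (4 * pi^2)" using LEB by (intro divide_right_mono) auto
    also have "\<dots> = \<beta>^2" unfolding b2 using EB_neg by (simp add: dens_def)
    finally show ?thesis .
  qed
  have b8: "1 / 8 \<le> \<beta>"
    by (rule power2_le_imp_le) (use b64 b0 in \<open>auto simp: power_divide\<close>)
  have Rb: "R = \<beta> * exp (w^2 / 2)"
  proof -
    have "R^2 = (\<beta> * exp (w^2 / 2))^2"
      unfolding R2 power_mult_distrib b2 w(2) by (simp add: exp_double[symmetric])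
    then show ?thesis using R0 b0 by (simp add: power2_eq_iff_nonneg)
  qed
  have expw: "w^4 / 16 \<le> exp (w^2 / 2)"
  proof -
    have "w^2 / 4 \<le> exp (w^2 / 4)" using exp_ge_add_one_self[of "w^2 / 4"] by linarith
    then have "(w^2 / 4)^2 \<le> (exp (w^2 / 4))^2" by (intro power_mono) auto
    then show ?thesis by (simp add: exp_double[symmetric] power_divide flip: power_mult)
  qed
  have w4: "10000 * w^3 \<le> w^4" using w w0 by (simp add: power4_eq_xxxx power3_eq_cube mult_right_mono)
  have w3: "1 \<le> w^3" using w0 by simp
  have R_ge: "w^4 / 128 \<le> R"
  proof -
    have "1 / 8 * (w^4 / 16) \<le> R" unfolding Rb using b8 expw b0 by (intro mult_mono) auto
    then show ?thesis by simp
  qed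
  have R1: "1 \<le> R" using R_ge w4 w3 by linarith
  have \<delta>0: "0 < \<delta>" "\<delta> \<le> 1" using w0 w3 by (auto simp: \<delta>_def)
  have \<delta>R: "1 \<le> \<delta> * R"
  proof -
    have "w^3 \<le> R" using R_ge w4 w3 by linarith
    then show ?thesis using w0 by (simp add: \<delta>_def)
  qed
  have y: "0 \<le> y" "y < \<mu>" using \<delta>0 \<mu> by (auto simp: y_def)
  have yt: "y * dens = R^2 - \<delta> * R^2" by (simp add: y_def R2 algebra_simps)
  have EB\<mu>: "- EB \<le> \<mu>"
    using w(2) EB_neg mult_left_mono[of 1 "exp (w^2)" "- EB"] by simp
  have A_q: "?A = {n. qn n \<le> R^2}" using dens_pos by (auto simp: e_qn R2 field_simps)
  have finA: "finite ?A" by (rule finite_sublevel)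
  have w2: "100000000 \<le> w^2" using mult_mono[of 10000 w 10000 w] w by (simp add: power2_eq_square)
  have N_ge: "\<mu> * dens / 2 \<le> ?N"
    using lattice_card_ge[of "R^2" ?A, OF zero_le_power2 finA] A_q R2 by (simp add: Nmu_def)
  have gEB: "g \<mu> EB = dens * (\<Sum>n\<in>?A. 1 / (qn n + \<beta>^2))"
    unfolding g_EB b2 by simp
  have gEB_ge: "dens * (w^2 / 12) \<le> g \<mu> EB"
  proof -
    have e18: "18 \<le> exp (w^2 / 2)" using exp_ge_add_one_self[of "w^2 / 2"] w2 by linarith
    \<comment> \<open>\<open>\<beta> \<ge> 1 / 8\<close> turns the summand 2 into at most 16
      \<open>\<beta>\<close>.\<close>
    have "2 * (\<beta> + 1) \<le> \<beta> * 18" using b8 by simp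
    also have "\<dots> \<le> R" unfolding Rb using e18 b0 by (intro mult_left_mono) auto
    finally have bR: "2 * (\<beta> + 1) \<le> R" .
    have "exp (w^2 / 2) / 18 \<le> R / (2 * (\<beta> + 1))"
    proof -
      have "exp (w^2 / 2) / 18 = R / (\<beta> * 18)" using b0 by (simp add: Rb)
      also have "\<dots> \<le> R / (2 * (\<beta> + 1))" using b8 b0 R0 by (intro divide_left_mono) auto
      finally show ?thesis .
    qed
    then have "ln (exp (w^2 / 2) / 18) \<le> ln (R / (2 * (\<beta> + 1)))"
      using b0 R0 by (subst ln_le_cancel_iff) auto
    moreover have "ln (exp (w^2 / 2) / 18) = w^2 / 2 - ln 18" by (simp add: ln_div)
    moreover have "ln 18 \<le> (17::real)" using ln_le_minus_one[of "18::real"] by simp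
    ultimately have "w^2 / 4 \<le> ln (R / (2 * (\<beta> + 1)))" using w2 by linarith
    then have "w^2 / 12 \<le> (\<Sum>n\<in>?A. 1 / (qn n + \<beta>^2))"
      using lattice_sum_inside_ge[OF b0 bR finA] A_q qn_nonneg by fastforce
    then show ?thesis unfolding gEB using dens_pos by (intro mult_left_mono) auto
  qed
  have gEB_le: "g \<mu> EB \<le> dens * (24 * w^2)"
  proof -
    have "(\<Sum>n\<in>?A. 1 / (qn n + \<beta>^2)) \<le> 8 * (1 / \<beta>^2 + 2 * ln ((R^2 + \<beta>^2) / \<beta>^2))"
      by (rule lattice_sum_inside) (use b0 R0 finA A_q in auto)
    also have "(R^2 + \<beta>^2) / \<beta>^2 = exp (w^2) + 1"
    proof -
      have "R^2 = \<beta>^2 * exp (w^2)" unfolding R2 b2 w(2) by simp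
      then show ?thesis using b0 by (simp add: add_divide_distrib)
    qed
    also have "ln (exp (w^2) + 1) \<le> w^2 + 1"
    proof -
      have "exp (w^2) + 1 \<le> exp (w^2) * 2" by simp
      also have "\<dots> \<le> exp (w^2) * exp 1" using exp_ge_add_one_self[of 1] by (intro mult_left_mono) auto
      also have "\<dots> = exp (w^2 + 1)" by (simp add: exp_add)
      finally have "ln (exp (w^2) + 1) \<le> ln (exp (w^2 + 1))" by (subst ln_le_cancel_iff) (auto intro: add_pos_pos)
      then show ?thesis by simp
    qed
    also have "1 / \<beta>^2 \<le> 64" using b64 b0 by (simp add: field_simps)
    finally have "(\<Sum>n\<in>?A. 1 / (qn n + \<beta>^2)) \<le> 24 * w^2" using w2 by simp
    then show ?thesis unfolding gEB using dens_pos by (intro mult_left_mono) auto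
  qed
  have EB2: "- 2 * \<mu> \<le> EB" using EB\<mu> \<mu> by linarith
  have g2_ge: "g \<mu> EB \<le> g \<mu> (- 2 * \<mu>)" using EB2 EB_neg \<mu> by (intro g_antimono) auto
  \<comment> \<open>Moving from E_B down to - 2 \<mu> changes \<open>g\<close> only by a constant
    times \<open>dens\<close>: the distance is at most 2 \<mu>, and the tail of inverse squares
    beyond the Fermi disc is of order 1 / (\<mu> dens).\<close>
  have g2_le: "g \<mu> (- 2 * \<mu>) \<le> dens * (25 * w^2)"
  proof -
    have "infsum (\<lambda>n. r (- 2 * \<mu>) n * r EB n) {n. e n > \<mu>} \<le> dens^2 * (64 / R^2)"
    proof (rule infsum_r_le[OF \<mu>])
      fix B assume B: "finite B" "\<And>n. n \<in> B \<Longrightarrow> \<mu> * dens < qn n"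
      have "(\<Sum>n\<in>B. 1 / (qn n * (qn n - EB * dens))) \<le> (\<Sum>n\<in>B. 1 / (qn n)^2)"
      proof (rule sum_mono)
        fix n assume n: "n \<in> B"
        have "0 < qn n" using B(2)[OF n] mult_pos_pos[OF \<mu> dens_pos] by linarith
        then show "1 / (qn n * (qn n - EB * dens)) \<le> 1 / (qn n)^2"
          unfolding power2_eq_square using EBt by (intro frac_le mult_left_mono) auto
      qed
      also have "\<dots> \<le> 64 / R^2" by (rule lattice_sum_tail[OF R0 B(1)]) (use B(2) R2 in simp)
      finally show "(\<Sum>n\<in>B. 1 / (qn n * (qn n - EB * dens))) \<le> 64 / R^2" .
    qed (use \<mu> EB_neg in auto)
    then have "(EB - (- 2 * \<mu>)) * infsum (\<lambda>n. r (- 2 * \<mu>) n * r EB n) {n. e n > \<mu>} \<le> (2 * \<mu>) * (dens^2 * (64 / R^2))"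
      using EB_neg EB2 \<mu> by (intro mult_mono infsum_nonneg mult_nonneg_nonneg less_imp_le[OF r_pos]) auto
    also have "\<dots> = dens * 128" unfolding R2 using \<mu> dens_pos by (simp add: power2_eq_square)
    finally have "g \<mu> (- 2 * \<mu>) - g \<mu> EB \<le> dens * 128"
      using g_diff[of "- 2 * \<mu>" \<mu> EB] EB_neg \<mu> by simp
    then have "g \<mu> (- 2 * \<mu>) \<le> dens * (24 * w^2) + dens * 128" using gEB_le by linarith
    also have "\<dots> \<le> dens * (25 * w^2)" using dens_pos w2 by (simp flip: distrib_left)
    finally show ?thesis .
  qed
  \<comment> \<open>The resonant sum contributes the logarithm of \<open>1 / \<delta> = w^3\<close>,
    estimated crudely through ln w \<le> w. Compared with \<open>g\<close> of order w^2 this leaves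
    a relative error of order 1/w.\<close>
  have gdiff: "g \<mu> (- 2 * \<mu>) - g \<mu> y \<le> dens * (300 * w)"
  proof -
    have "infsum (\<lambda>n. r (- 2 * \<mu>) n * r y n) {n. e n > \<mu>} \<le> dens^2 * ((36 + 24 * ln (1 + 2 / \<delta>)) / R^2)"
    proof (rule infsum_r_le[OF \<mu>])
      fix B assume B: "finite B" "\<And>n. n \<in> B \<Longrightarrow> \<mu> * dens < qn n"
      have "(\<Sum>n\<in>B. 1 / (qn n * (qn n - R^2 + \<delta> * R^2))) \<le> (36 + 24 * ln (1 + 2 / \<delta>)) / R^2"
        by (rule lattice_sum_resonant[OF R1 \<delta>0(1) \<delta>R B(1)]) (use B(2) R2 in simp)
      then show "(\<Sum>n\<in>B. 1 / (qn n * (qn n - y * dens))) \<le> (36 + 24 * ln (1 + 2 / \<delta>)) / R^2"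
        unfolding yt by (simp add: algebra_simps)
    qed (use \<mu> y in auto)
    also have "\<dots> \<le> dens^2 * ((84 + 72 * w) / R^2)"
    proof -
      have "1 + 2 / \<delta> \<le> 3 * w^3" using w3 by (simp add: \<delta>_def)
      then have "ln (1 + 2 / \<delta>) \<le> ln (3 * w^3)" using \<delta>0 w0 by (subst ln_le_cancel_iff) (auto intro: add_pos_pos)
      also have "\<dots> = ln 3 + 3 * ln w" using w0 by (simp add: ln_mult ln_realpow)
      also have "\<dots> \<le> 2 + 3 * w" using ln_le_minus_one[of "3::real"] ln_le_minus_one[OF w0(1)] by linarith
      finally show ?thesis by (intro mult_left_mono divide_right_mono) auto
    qed
    finally have "(y - (- 2 * \<mu>)) * infsum (\<lambda>n. r (- 2 * \<mu>) n * r y n) {n. e n > \<mu>} \<le> (3 * \<mu>) * (dens^2 * ((84 + 72 * w) / R^2))"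
      using y \<mu> by (intro mult_mono infsum_nonneg mult_nonneg_nonneg less_imp_le[OF r_pos]) auto
    also have "\<dots> = dens * (252 + 216 * w)" unfolding R2 using \<mu> dens_pos by (simp add: power2_eq_square field_simps)
    also have "\<dots> \<le> dens * (300 * w)" using dens_pos w by (intro mult_left_mono) auto
    finally show ?thesis using g_diff[of "- 2 * \<mu>" \<mu> y] y \<mu> by simp
  qed
  have gy_ge: "dens * (w^2 / 24) \<le> g \<mu> y"
  proof -
    have "300 * w \<le> w^2 / 24" using mult_right_mono[OF w(1), of w] w0 by (simp add: power2_eq_square)
    then have "dens * (300 * w) \<le> dens * (w^2 / 24)" using dens_pos by (intro mult_left_mono) auto
    moreover have "dens * (w^2 / 12) = dens * (w^2 / 24) + dens * (w^2 / 24)" by (simp add: field_simps)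
    ultimately show ?thesis using gdiff gEB_ge g2_ge by linarith
  qed
  have tw: "0 < dens * (w^2 / 24)" using dens_pos w0 by simp
  have gy: "0 < g \<mu> y" using gy_ge tw by linarith
  have g2: "0 < g \<mu> (- 2 * \<mu>)" using gdiff gEB_ge g2_ge tw by (simp add: field_simps)
  define X where "X = ?N / g \<mu> (- 2 * \<mu>)"
  define Y where "Y = ?N / g \<mu> y"
  have X_ge: "\<mu> / (50 * w^2) \<le> X"
  proof -
    have "\<mu> / (50 * w^2) = (\<mu> * dens / 2) / (dens * (25 * w^2))" using dens_pos w0 by simp
    also have "\<dots> \<le> X" unfolding X_def using N_ge g2_le g2 \<mu> dens_pos by (intro frac_le) auto
    finally show ?thesis .
  qed
  have X0: "0 < X" using X_ge \<mu> w0 by (auto intro: less_le_trans[of 0 "\<mu> / (50 * w^2)"])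
  \<comment> \<open>The exponent 3 in \<open>\<delta>\<close> is chosen for this: \<open>X\<close>
    is at least \<mu> / (50 w^2), so a strip of width \<mu> / w^3 is a 1/w fraction of it.\<close>
  have \<delta>\<mu>: "\<mu> - y \<le> 50 * X / w"
  proof -
    have "\<mu> - y = 50 * (\<mu> / (50 * w^2)) / w" using w0 by (simp add: y_def \<delta>_def algebra_simps power2_eq_square power3_eq_cube)
    also have "\<dots> \<le> 50 * X / w" using X_ge w0 by (intro divide_right_mono mult_left_mono) auto
    finally show ?thesis .
  qed
  have lo: "\<mu> - y < X"
  proof -
    have "50 * X / w < X" using X0 w by (simp add: field_simps)
    then show ?thesis using \<delta>\<mu> by linarith
  qed
  have up: "X \<le> 2 * \<mu>"
  proof -
    have "?N / (2 * \<mu>) = (\<Sum>n\<in>?A. 1 / (2 * \<mu>))" by (simp add: Nmu_def)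
    also have "\<dots> \<le> P \<mu> EB"
      unfolding P_def r_def using EB\<mu> EB_neg ksq_nonneg[of L] \<mu>
      by (intro sum_mono frac_le) (auto intro: add_nonneg_pos simp: less_diff_eq less_le_trans)
    also have "\<dots> = g \<mu> EB" using F_eq[of EB \<mu>] F_EB by simp
    finally have "?N / (2 * \<mu>) \<le> g \<mu> (- 2 * \<mu>)" using g2_ge by linarith
    then show ?thesis unfolding X_def using g2 \<mu> by (simp add: field_simps)
  qed
  \<comment> \<open>The polaron energy falls between the same two quantities as the total shift, up
    to the strip.\<close>
  have eP: "X \<le> - eP L EB \<mu>" "- eP L EB \<mu> \<le> Y"
    using eP_bounds[OF \<mu> y gy] lo up unfolding X_def Y_def by auto
  have Eup: "Egs L EB \<mu> - E0 L \<mu> \<le> - X"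
    using Egs_upper[of \<mu> "- 2 * \<mu>"] \<mu> EB2 g2 by (simp add: X_def)
  have Elo: "- Y - (\<mu> - y) \<le> Egs L EB \<mu> - E0 L \<mu>"
    using Egs_lower[of \<mu> y] \<mu> y gy by (simp add: Y_def)
  have YX: "Y - X \<le> 7200 * X / w"
  proof -
    have "Y - X = X * ((g \<mu> (- 2 * \<mu>) - g \<mu> y) / g \<mu> y)"
      unfolding X_def Y_def using g2 gy by (simp add: field_simps)
    also have "(g \<mu> (- 2 * \<mu>) - g \<mu> y) / g \<mu> y \<le> dens * (300 * w) / (dens * (w^2 / 24))"
      using gdiff gy_ge tw dens_pos w0 by (intro frac_le) auto
    also have "dens * (300 * w) / (dens * (w^2 / 24)) = 7200 / w" using dens_pos w0 by (simp add: power2_eq_square)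
    finally have "Y - X \<le> X * (7200 / w)" using X0 by (simp add: mult_left_mono)
    then show ?thesis by (simp add: mult.commute)
  qed
  have "\<bar>Egs L EB \<mu> - E0 L \<mu> - eP L EB \<mu>\<bar> \<le> (Y - X) + (\<mu> - y)" using eP Eup Elo y by linarith
  also have "\<dots> \<le> 7200 * X / w + 50 * X / w" using YX \<delta>\<mu> by linarith
  also have "\<dots> = 7250 * X / w" by (simp add: add_divide_distrib[symmetric])
  also have "\<dots> \<le> 7250 * \<bar>eP L EB \<mu>\<bar> / w" using eP X0 w0 by (intro divide_right_mono mult_left_mono) auto
  finally show ?thesis .
qed

end

theorem theorem1:
  fixes EB :: real
  assumes "EB < 0"
  shows "\<exists>c>0. \<exists>C>0. \<forall>L>0. \<forall>\<mu>>0. \<mu> / \<bar>EB\<bar> \<ge> c \<and> L^2 * \<bar>EB\<bar> \<ge> 1 \<longrightarrow>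
     \<bar>Egs L EB \<mu> - E0 L \<mu> - eP L EB \<mu>\<bar> \<le> C * \<bar>eP L EB \<mu>\<bar> / sqrt (ln (\<mu> / \<bar>EB\<bar>))"
proof -
  \<comment> \<open>Both constants are absolute: the threshold 10000 on the root of the logarithm
    becomes exp (10000^2), and 7250 is 7200 from the variation of \<open>g\<close> plus 50 from the
    strip.\<close>
  have "\<bar>Egs L EB \<mu> - E0 L \<mu> - eP L EB \<mu>\<bar> \<le> 7250 * \<bar>eP L EB \<mu>\<bar> / sqrt (ln (\<mu> / \<bar>EB\<bar>))"
    if L: "0 < L" and \<mu>: "0 < \<mu>" and c: "exp (10000^2) \<le> \<mu> / \<bar>EB\<bar>" and LEB: "1 \<le> L^2 * \<bar>EB\<bar>" for L \<mu> :: real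
  proof -
    interpret point_interaction L EB by standard (use L assms in auto)
    have pos: "0 < \<mu> / \<bar>EB\<bar>" using \<mu> assms by (intro divide_pos_pos) auto
    have "ln (exp (10000^2)) \<le> ln (\<mu> / \<bar>EB\<bar>)" using c pos by (subst ln_le_cancel_iff) auto
    then have W: "10000^2 \<le> ln (\<mu> / \<bar>EB\<bar>)" by (simp only: ln_exp)
    have W0: "0 \<le> ln (\<mu> / \<bar>EB\<bar>)" by (rule order_trans[OF _ W]) simp
    show ?thesis
    proof (rule Egs_eP_estimate[OF \<mu> _ _ LEB])
      show "10000 \<le> sqrt (ln (\<mu> / \<bar>EB\<bar>))" by (rule real_le_rsqrt[OF W])
      have "exp ((sqrt (ln (\<mu> / \<bar>EB\<bar>)))^2) = \<mu> / \<bar>EB\<bar>" using W0 pos by simp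
      then show "\<mu> = - EB * exp ((sqrt (ln (\<mu> / \<bar>EB\<bar>)))^2)" using assms by simp
    qed
  qed
  then show ?thesis by (intro exI[of _ "exp (10000^2)"] exI[of _ 7250] conjI) (auto simp del: exp_le_cancel_iff)
qed

end
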